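(* Let $\mu,\nu\in\mathcal P_1^d$ with $\mu\preccurlyeq\nu$, and assume that $\delta F:=F_\nu-F_\mu$ has a single local maximizer on $(0,\infty)$. Then the Hobson–Klimmek martingale coupling satisfies the symmetry relation $$\mathbb S\big(\mathbb Q_{HK}(S(\mu),S(\nu))\big)=\mathbb Q_{HK}(\mu,\nu).$$
   Context: Notation: $\mathbb R_+^*=(0,\infty)$. $\mathcal P_1$ is the set of Borel probability measures $\mu$ on $\mathbb R_+^*$ with $\int x\,\mu(dx)=1$; $\mathcal P_1^d\subset\mathcal P_1$ is the subset of those having a positive density $p_\mu$ with respect to Lebesgue measure. $\mu\preccurlyeq\nu$ (convex order) means $\int f\,d\mu\le\int f\,d\nu$ for all convex $f:\mathbb R_+^*\to\mathbb R$. $F_\mu$ is the cumulative distribution function of $\mu$, $G_\mu(x)=\int_0^x y\,\mu(dy)$, $\delta F=F_\nu-F_\mu$, $\delta G=G_\nu-G_\mu$. On $(\mathbb R_+^* )^2$ let $X,Y$ be the coordinate maps $X(\omega_1,\omega_2)=\omega_1$, $Y(\omega_1,\omega_2)=\omega_2$. $\mathcal M(\mu,\nu)$ is the set of probability measures $Q$ on $(\mathbb R_+^* )^2$ such that under $Q$: $X\sim\mu$, $Y\sim\nu$, and $\mathbb E^Q[Y\mid X]=X$. Symmetry operators: for $\mu\in\mathcal P_1$, $S(\mu)$ is the law of $x\mapsto 1/x$ under the probability $\bar\mu(dx)=x\,\mu(dx)$, i.e. $\int f\,dS(\mu)=\int x f(1/x)\,\mu(dx)$ for bounded measurable $f$.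 For $Q\in\mathcal M(\mu,\nu)$, $\mathbb S(Q)$ is the measure on $(\mathbb R_+^* )^2$ defined by $\mathbb E^{\mathbb S(Q)}[f(X,Y)]=\mathbb E^Q[Y f(1/X,1/Y)]$ for all bounded measurable $f$. Facts used for the objects to be well defined: if $\mu,\nu\in\mathcal P_1^d$, $\mu\preccurlyeq\nu$ and $\delta F$ has a single local maximizer, then $S(\mu),S(\nu)$ satisfy the same properties, and $\delta F$ has a unique global minimizer. Definition of $\mathbb Q_{HK}(\mu,\nu)$ (known theorem of Hobson and Klimmek): under these hypotheses on $\mu,\nu$ there is a unique coupling $\mathbb Q_{HK}(\mu,\nu)\in\mathcal M(\mu,\nu)$ attaining $\inf_{Q\in\mathcal M(\mu,\nu)}\mathbb E^Q[|Y-X|]$. It has the form $\mathbb Q_{HK}(\mu,\nu)(dx,dy)=\mu(dx)\mathcal L_{HK}(x,dy)$ with $$\mathcal L_{HK}(x,\cdot)=\delta_x\mathbf 1_{x\le a}+\big(l(x)\delta_{p(x)}+u(x)\delta_{q(x)}+(1-l(x)-u(x))\delta_x\big)\mathbf 1_{a<x<b}+\delta_x\mathbf 1_{x\ge b},$$ where $a$ (resp. $b$) is the global maximizer (resp. minimizer) of $\delta F$; $p:(a,b)\to[0,a]$ and $q:(a,b)\to[b,\infty]$ are continuous decreasing functions solving, for $x\in(a,b)$, $$\delta F(q(x))+\delta F(p(x))=\delta F(x),\qquad \delta G(q(x))+\delta G(p(x))=\delta G(x);$$ and $$u(x)=\frac{x-p(x)}{q(x)-p(x)}\,\frac{p_\mu(x)-p_\nu(x)}{p_\mu(x)},\qquad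 l(x)=\frac{q(x)-x}{q(x)-p(x)}\,\frac{p_\mu(x)-p_\nu(x)}{p_\mu(x)}.$$ *)

theory Defs
  imports "HOL-Probability.Probability"
begin

abbreviation half_line :: "real measure" where
  "half_line \<equiv> restrict_space borel {0<..}"

abbreviation quadrant :: "(real \<times> real) measure" where
  "quadrant \<equiv> half_line \<Otimes>\<^sub>M half_line"

definition P1 :: "real measure set" where
  "P1 = {\<mu>. prob_space \<mu> \<and> sets \<mu> = sets half_line \<and> (\<integral>x. x \<partial>\<mu>) = 1}"

definition P1d :: "real measure set" where
  "P1d = {\<mu> \<in> P1. \<exists>p \<in> borel_measurable half_line. (\<forall>x>0. (p x :: real) > 0) \<and>
            \<mu> = density (restrict_space lborel {0<..}) (\<lambda>x. ennreal (p x))}"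

(* The integral of a convex function against an element of P1 always makes sense in
   (-\<infinity>, \<infinity>] (there is an affine minorant) but may be \<infinity>, so the Bochner integral, which is 0
   for non-integrable functions, cannot be used in the convex order. *)
definition ext_integral :: "'a measure \<Rightarrow> ('a \<Rightarrow> real) \<Rightarrow> ereal" where
  "ext_integral M f =
     enn2ereal (\<integral>\<^sup>+x. ennreal (f x) \<partial>M) - enn2ereal (\<integral>\<^sup>+x. ennreal (- f x) \<partial>M)"

definition convex_order :: "real measure \<Rightarrow> real measure \<Rightarrow> bool" where
  "convex_order \<mu> \<nu> \<longleftrightarrow>
     (\<forall>f :: real \<Rightarrow> real. convex_on {0<..} f \<longrightarrow> ext_integral \<mu> f \<le> ext_integral \<nu> f)"

(* The library's cdf is not used: {..x} is not a subset of the space of a measure on (0, \<infinity>). *)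
definition F_cdf :: "real measure \<Rightarrow> real \<Rightarrow> real" where
  "F_cdf \<mu> x = measure \<mu> {0<..x}"

definition delta_F :: "real measure \<Rightarrow> real measure \<Rightarrow> real \<Rightarrow> real" where
  "delta_F \<mu> \<nu> x = F_cdf \<nu> x - F_cdf \<mu> x"

definition local_maximizer :: "(real \<Rightarrow> real) \<Rightarrow> real \<Rightarrow> bool" where
  "local_maximizer f a \<longleftrightarrow> 0 < a \<and> (\<forall>\<^sub>F x in nhds a. f x \<le> f a)"

definition martingale_couplings ::
    "real measure \<Rightarrow> real measure \<Rightarrow> (real \<times> real) measure set" where
  "martingale_couplings \<mu> \<nu> =
     {Q. prob_space Q \<and> sets Q = sets quadrant \<and>
         distr Q half_line fst = \<mu> \<and> distr Q half_line snd = \<nu> \<and>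
         (AE \<omega> in Q. real_cond_exp Q (vimage_algebra (space Q) fst half_line) snd \<omega> = fst \<omega>)}"

definition Q_HK :: "real measure \<Rightarrow> real measure \<Rightarrow> (real \<times> real) measure" where
  "Q_HK \<mu> \<nu> =
     (THE Q. Q \<in> martingale_couplings \<mu> \<nu> \<and>
        (\<integral>\<^sup>+\<omega>. ennreal \<bar>snd \<omega> - fst \<omega>\<bar> \<partial>Q) =
        (INF Q' \<in> martingale_couplings \<mu> \<nu>. \<integral>\<^sup>+\<omega>. ennreal \<bar>snd \<omega> - fst \<omega>\<bar> \<partial>Q'))"

definition S_op :: "real measure \<Rightarrow> real measure" where
  "S_op \<mu> = distr (density \<mu> (\<lambda>x. ennreal x)) half_line (\<lambda>x. 1 / x)"

definition SS_op :: "(real \<times> real) measure \<Rightarrow> (real \<times> real) measure" where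
  "SS_op Q =
     distr (density Q (\<lambda>\<omega>. ennreal (snd \<omega>))) quadrant (\<lambda>\<omega>. (1 / fst \<omega>, 1 / snd \<omega>))"

lemma measurable_reciprocal [measurable]: "(\<lambda>x. 1 / x) \<in> measurable half_line half_line"
proof (rule measurable_restrict_space2)
  show "(\<lambda>x. 1 / x) \<in> space half_line \<rightarrow> {0<..}"
    by (auto simp: space_restrict_space)
  show "(\<lambda>x. 1 / x) \<in> borel_measurable half_line"
    by (rule measurable_restrict_space1) simp
qed

lemma measurable_id_half_line [measurable]: "(\<lambda>x. x) \<in> borel_measurable half_line"
  by (rule measurable_restrict_space1) simp

lemma nn_integral_S_op:
  assumes "sets \<mu> = sets half_line" and "f \<in> borel_measurable half_line"
  shows "(\<integral>\<^sup>+x. f x \<partial>S_op \<mu>) = (\<integral>\<^sup>+x. ennreal x * f (1 / x) \<partial>\<mu>)"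
proof -
  note [measurable_cong] = assms(1) and [measurable] = assms(2)
  show ?thesis
    unfolding S_op_def by (simp add: nn_integral_distr nn_integral_density)
qed

lemma nn_integral_SS_op:
  assumes "sets Q = sets quadrant" and "f \<in> borel_measurable quadrant"
  shows "(\<integral>\<^sup>+\<omega>. f \<omega> \<partial>SS_op Q) =
         (\<integral>\<^sup>+\<omega>. ennreal (snd \<omega>) * f (1 / fst \<omega>, 1 / snd \<omega>) \<partial>Q)"
proof -
  note [measurable_cong] = assms(1) and [measurable] = assms(2)
  have [measurable]: "(\<lambda>\<omega>. snd \<omega>) \<in> borel_measurable quadrant"
    by (rule measurable_compose[OF measurable_snd measurable_id_half_line])
  have [measurable]: "(\<lambda>\<omega>. (1 / fst \<omega>, 1 / snd \<omega>)) \<in> measurable quadrant quadrant"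
    by (intro measurable_Pair measurable_compose[OF measurable_fst measurable_reciprocal]
        measurable_compose[OF measurable_snd measurable_reciprocal])
  show ?thesis
    unfolding SS_op_def by (simp add: nn_integral_distr nn_integral_density)
qed

end

(* Idea.  Fubini and F_nu - F_mu = delta F give, for every martingale coupling Q,
     E|Y - X| = INT (2 Q(Y <= z < X) - delta F(z)) dz,
   so it suffices to minimise the crossing probability Q(Y <= z < X) for each z separately.  For a < z < b
   an explicit piecewise linear dual certificate built from p(z), z, q(z) shows that the minimum is attained
   exactly by the couplings that almost surely send (0,p) to (0,p), (p,z) to (p,z) or (q,oo), (z,q) to (0,p)
   or (z,q), and (q,oo) to (q,oo); for z <= a (z >= b) the condition is that no mass crosses z upwards
   (downwards).  These conditions determine the joint distribution function, and they are invariant under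
   (x,y) -> (1/x,1/y) together with z -> 1/z, p -> 1/q, q -> 1/p, a -> 1/b, b -> 1/a.  Since the symmetry operator maps
   martingale couplings to martingale couplings, the theorem follows once one such coupling is
   constructed for (mu, nu); no property of delta F for the pair (S mu, S nu) is needed. *)
theory Submission
  imports Defs
begin

section \<open>The shape of the difference of the distribution functions\<close>

text \<open>Each \<open>z\<close> between \<open>a\<close> and \<open>b\<close> is tied to
  \<open>p z\<close> and \<open>q z\<close> by two balance equations with different roles: the mass
  equation makes the first marginal of the constructed coupling equal to \<open>\<mu>\<close>, and
  the moment equation makes it a martingale. The convex order enters as nonnegativity of an
  antiderivative of \<open>delta_F\<close>; with a single local maximizer this forces the up-down-up
  shape on which the equations can be solved. Since \<open>Q_HK\<close> is a definite description,
  it has a known value only once the minimizer is known to exist and to be unique, and this is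
  needed for both pairs of marginals. A criterion on where mass may move, rather than an explicit
  kernel, lets a single lemma evaluate \<open>Q_HK\<close> twice. Equal costs give equal crossing
  probabilities only for almost every \<open>z\<close>. Continuity in \<open>z\<close>, a
  consequence of atomless marginals, recovers every \<open>z\<close>. Atomlessness also allows all
  conditions on a point to be strict inequalities, which inversion reverses exactly.\<close>

lemma less_max_if_no_local_max:
  fixes f :: "real \<Rightarrow> real"
  assumes cont: "continuous_on {u..w} f" and uv: "u < v" "v < w"
    and no: "\<And>x. u < x \<Longrightarrow> x < w \<Longrightarrow> \<not> (\<forall>\<^sub>F y in nhds x. f y \<le> f x)"
  shows "f v < max (f u) (f w)"
proof (rule ccontr)
  assume c: "\<not> f v < max (f u) (f w)"
  have loc: False if "u < x" "x < w" "\<And>y. y \<in> {u..w} \<Longrightarrow> f y \<le> f x" for x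
  proof -
    have "\<forall>\<^sub>F y in nhds x. y \<in> {u<..<w}"
      using that by (intro eventually_nhds_in_open) auto
    then have "\<forall>\<^sub>F y in nhds x. f y \<le> f x"
      by eventually_elim (use that in auto)
    then show False using no that by blast
  qed
  have "\<exists>x\<in>{u..w}. \<forall>y\<in>{u..w}. f y \<le> f x"
    using uv by (intro continuous_attains_sup cont) auto
  then obtain x where x: "x \<in> {u..w}" "\<And>y. y \<in> {u..w} \<Longrightarrow> f y \<le> f x" by auto
  show False
  proof (cases "x = u \<or> x = w")
    case True
    \<comment> \<open>If the maximum sits at an endpoint, the negated claim makes \<open>v\<close>
      an interior maximizer as well.\<close>
    then have "f x \<le> f v" using c by auto
    then show False using loc[of v] uv x(2) by force
  next
    case False
    then show False using loc[of x] x by auto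
  qed
qed

text \<open>\<open>local_maximizer\<close> is non-strict, so uniqueness of \<open>a\<close> also
  excludes flat pieces; this makes every monotonicity strict. On an interval without
  \<open>a\<close> in its interior, \<open>f\<close> is strictly quasiconvex. The signs come from
  \<open>\<Phi>\<close>: it would turn negative if \<open>f\<close> were not positive on
  \<open>(0, a]\<close>, and it could not return to 0 if \<open>f\<close> stayed nonnegative after
  \<open>a\<close>.\<close>

lemma strict_shape:
  fixes f \<Phi> :: "real \<Rightarrow> real"
  assumes cont: "\<And>x. isCont f x" and f0: "f 0 = 0" and flim: "(f \<longlongrightarrow> 0) at_top"
    and der: "\<And>x. (\<Phi> has_real_derivative f x) (at x)" and \<Phi>0: "\<Phi> 0 = 0"
    and \<Phi>_nonneg: "\<And>x. 0 < x \<Longrightarrow> 0 \<le> \<Phi> x" and \<Phi>lim: "(\<Phi> \<longlongrightarrow> 0) at_top"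
    and ex1: "\<exists>!a. local_maximizer f a"
  obtains a b where "0 < a" "a < b"
    "\<And>s t. 0 \<le> s \<Longrightarrow> s < t \<Longrightarrow> t \<le> a \<Longrightarrow> f s < f t"
    "\<And>s t. a \<le> s \<Longrightarrow> s < t \<Longrightarrow> t \<le> b \<Longrightarrow> f t < f s"
    "\<And>s t. b \<le> s \<Longrightarrow> s < t \<Longrightarrow> f s < f t"
proof -
  obtain a where a: "local_maximizer f a" and uniq: "\<And>x. local_maximizer f x \<Longrightarrow> x = a"
    using ex1 by auto
  have a0: "0 < a" using a by (simp add: local_maximizer_def)
  have contS: "continuous_on S f" for S
    using cont by (simp add: continuous_at_imp_continuous_on)
  have MVT: "\<exists>\<xi>. s < \<xi> \<and> \<xi> < t \<and> \<Phi> t - \<Phi> s = (t - s) * f \<xi>" if "s < t" for s t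
    using MVT2[OF that, of \<Phi> f] der by auto
  have conv: "f v < max (f u) (f w)" if "0 \<le> u" "u < v" "v < w" "w \<le> a \<or> a \<le> u" for u v w
  proof (rule less_max_if_no_local_max[OF contS that(2,3)])
    fix x assume x: "u < x" "x < w"
    then have "x \<noteq> a" using that by auto
    then show "\<not> (\<forall>\<^sub>F y in nhds x. f y \<le> f x)"
      using uniq[of x] x that by (auto simp: local_maximizer_def)
  qed
  have pos: "0 < f v" if v: "0 < v" "v \<le> a" for v
  proof (rule ccontr)
    assume "\<not> 0 < f v"
    then have "f u < 0" if "0 < u" "u < v" for u
      using conv[of 0 u v] that v f0 by auto
    moreover obtain \<xi> where "0 < \<xi>" "\<xi> < v" "\<Phi> v - \<Phi> 0 = (v - 0) * f \<xi>"
      using MVT[OF v(1)] by auto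
    ultimately have "\<Phi> v < 0" using \<Phi>0 v by (simp add: mult_pos_neg)
    then show False using \<Phi>_nonneg[OF v(1)] by simp
  qed
  have inc: "f s < f t" if "0 \<le> s" "s < t" "t \<le> a" for s t
    using conv[of 0 s t] pos[of t] f0 that by (cases "s = 0") auto
  have "\<exists>c>a. f c < 0"
  proof (rule ccontr)
    assume "\<not> (\<exists>c>a. f c < 0)"
    then have nn: "0 \<le> f x" if "0 < x" for x
      using pos[of x] that \<open>\<not> (\<exists>c>a. f c < 0)\<close> by (meson less_imp_le not_le)
    obtain \<xi> where "0 < \<xi>" "\<xi> < a" "\<Phi> a - \<Phi> 0 = (a - 0) * f \<xi>"
      using MVT[OF a0] by auto
    then have \<Phi>a: "0 < \<Phi> a" using \<Phi>0 pos[of \<xi>] a0 by simp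
    have "\<Phi> a \<le> \<Phi> x" if x: "a < x" for x
    proof -
      obtain \<xi> where "a < \<xi>" "\<xi> < x" "\<Phi> x - \<Phi> a = (x - a) * f \<xi>"
        using MVT[OF x] by auto
      moreover have "0 \<le> (x - a) * f \<xi>" using nn[of \<xi>] x a0 calculation by simp
      ultimately show ?thesis by linarith
    qed
    then have "\<Phi> a \<le> 0"
      by (intro tendsto_lowerbound[OF \<Phi>lim] eventually_mono[OF eventually_gt_at_top[of a]]) auto
    with \<Phi>a show False by simp
  qed
  then obtain c where c: "a < c" "f c < 0" by auto
  have "\<forall>\<^sub>F x in at_top. f c < f x"
    using order_tendstoD(1)[OF flim c(2)] .
  then obtain R where R: "\<And>x. R \<le> x \<Longrightarrow> f c < f x"
    by (auto simp: eventually_at_top_linorder)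
  \<comment> \<open>Beyond \<open>R\<close> the values exceed \<open>f c\<close>, so a minimum over
    this compact interval is a minimum over all of \<open>[a, \<infinity>)\<close>.\<close>
  have "\<exists>b\<in>{a..max R c}. \<forall>y\<in>{a..max R c}. f b \<le> f y"
    using c by (intro continuous_attains_inf contS) auto
  then obtain b where b: "b \<in> {a..max R c}" "\<And>y. y \<in> {a..max R c} \<Longrightarrow> f b \<le> f y" by auto
  have fbc: "f b \<le> f c" using b(2)[of c] c by auto
  have bmin: "f b \<le> f y" if "a \<le> y" for y
    using b(2)[of y] R[of y] that fbc by (cases "y \<le> max R c") (auto simp: max_def split: if_splits)
  have "a \<noteq> b" using fbc c pos[of a] a0 by auto
  then have ab: "a < b" using b by auto
  have bstr: "f b < f y" if y: "a \<le> y" "y \<noteq> b" for y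
  proof (rule ccontr)
    assume "\<not> f b < f y"
    with bmin[OF y(1)] have e: "f y = f b" by simp
    \<comment> \<open>A second minimizer would put the midpoint strictly below the minimum.\<close>
    have "f ((y + b) / 2) < max (f (min y b)) (f (max y b))"
      using y ab a0 by (intro conv) (auto simp: min_def max_def field_simps)
    moreover have "f b \<le> f ((y + b) / 2)"
      using y ab by (intro bmin) auto
    ultimately show False using e by (auto simp: min_def max_def split: if_splits)
  qed
  have dec: "f t < f s" if "a \<le> s" "s < t" "t \<le> b" for s t
  proof (cases "t = b")
    case False
    then have "f t < max (f s) (f b)" using that a0 by (intro conv) auto
    then show ?thesis using bstr[of t] that False by auto
  qed (use that bstr[of s] in auto)
  have inc2: "f s < f t" if "b \<le> s" "s < t" for s t
  proof (cases "s = b")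
    case False
    then have "f s < max (f b) (f t)" using that a0 ab by (intro conv) auto
    then show ?thesis using bstr[of s] that False ab by auto
  qed (use that bstr[of t] ab in auto)
  show thesis using that[OF a0 ab inc dec inc2] by blast
qed

section \<open>Mass and moment on the three monotone pieces, and the matching of \<open>z\<close>
  with \<open>p\<close> and \<open>q\<close>\<close>

locale hk_shape =
  fixes f G \<Phi> :: "real \<Rightarrow> real" and a b :: real
  assumes a0: "0 < a" and ab: "a < b"
    and inc1: "\<And>s t. 0 \<le> s \<Longrightarrow> s < t \<Longrightarrow> t \<le> a \<Longrightarrow> f s < f t"
    and dec: "\<And>s t. a \<le> s \<Longrightarrow> s < t \<Longrightarrow> t \<le> b \<Longrightarrow> f t < f s"
    and inc2: "\<And>s t. b \<le> s \<Longrightarrow> s < t \<Longrightarrow> f s < f t"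
    and f_cont: "\<And>x. isCont f x" and f0: "f 0 = 0" and f_lim: "(f \<longlongrightarrow> 0) at_top"
    and \<Phi>_deriv: "\<And>x. (\<Phi> has_real_derivative f x) (at x)" and \<Phi>0: "\<Phi> 0 = 0"
    and G_eq: "\<And>x. G x = x * f x - \<Phi> x" and G_lim: "(G \<longlongrightarrow> 0) at_top"
begin

lemma f_cont_on: "continuous_on S f"
  using f_cont by (simp add: continuous_at_imp_continuous_on)

lemma G_cont: "isCont G x"
  using DERIV_isCont[OF \<Phi>_deriv[of x]] f_cont[of x]
  unfolding G_eq[abs_def] by (intro continuous_intros) auto

lemma G_cont_on: "continuous_on S G"
  using G_cont by (simp add: continuous_at_imp_continuous_on)

lemma G0: "G 0 = 0"
  by (simp add: G_eq \<Phi>0)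

lemma G_diff: assumes "s < t"
  obtains \<xi> where "s < \<xi>" "\<xi> < t" "G t - G s = t * f t - s * f s - (t - s) * f \<xi>"
proof -
  obtain \<xi> where "s < \<xi>" "\<xi> < t" "\<Phi> t - \<Phi> s = (t - s) * f \<xi>"
    using MVT2[OF assms, of \<Phi> f] \<Phi>_deriv by auto
  then show thesis using that by (simp add: G_eq)
qed

text \<open>Formally \<open>dG = y df\<close>, because \<open>G x = x * f x - \<Phi> x\<close> is
  integration by parts. Where \<open>f\<close> increases, the moment gained on an interval therefore
  lies strictly between its endpoints times the mass gained. \<open>G_dec\<close> is the same
  estimate for the loss between \<open>a\<close> and \<open>b\<close>.\<close>

lemma G_inc:
  assumes "0 \<le> s" "s < t" "t \<le> a \<or> b \<le> s"
  shows "s * (f t - f s) < G t - G s" "G t - G s < t * (f t - f s)"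
proof -
  obtain \<xi> where x: "s < \<xi>" "\<xi> < t" "G t - G s = t * f t - s * f s - (t - s) * f \<xi>"
    using G_diff[OF assms(2)] .
  have i: "f s < f \<xi>" "f \<xi> < f t"
    using inc1[of s \<xi>] inc1[of \<xi> t] inc2[of s \<xi>] inc2[of \<xi> t] x assms by auto
  have "0 < (t - s) * (f t - f \<xi>)" "0 < (t - s) * (f \<xi> - f s)" using i assms by simp_all
  then show "s * (f t - f s) < G t - G s" "G t - G s < t * (f t - f s)"
    unfolding x(3) by (auto simp: algebra_simps)
qed

lemma G_dec:
  assumes "a \<le> s" "s < t" "t \<le> b"
  shows "s * (f s - f t) < G s - G t" "G s - G t < t * (f s - f t)"
proof -
  obtain \<xi> where x: "s < \<xi>" "\<xi> < t" "G t - G s = t * f t - s * f s - (t - s) * f \<xi>"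
    using G_diff[OF assms(2)] .
  have i: "f t < f \<xi>" "f \<xi> < f s"
    using dec[of s \<xi>] dec[of \<xi> t] x assms by auto
  have "0 < (t - s) * (f s - f \<xi>)" "0 < (t - s) * (f \<xi> - f t)" using i assms by simp_all
  then show "s * (f s - f t) < G s - G t" "G s - G t < t * (f s - f t)"
    using x(3) by (auto simp: algebra_simps)
qed

lemma f_neg: assumes "b \<le> x" shows "f x < 0"
proof -
  have "f (x + 1) \<le> 0"
    using inc2 assms
    by (intro tendsto_lowerbound[OF f_lim] eventually_mono[OF eventually_gt_at_top[of "x + 1"]])
      (auto intro!: less_imp_le)
  then show ?thesis using inc2[of x "x + 1"] assms by simp
qed

text \<open>As \<open>f\<close> and \<open>G\<close> vanish at infinity, \<open>- f x\<close> and
  \<open>- G x\<close> are the mass and the moment gained beyond \<open>x\<close>, so this is the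
  limit of \<open>G_inc\<close> as the right endpoint goes to infinity.\<close>

lemma G_tail: assumes "b \<le> x" shows "- x * f x \<le> - G x"
proof -
  have "((\<lambda>y. G y - x * f y) \<longlongrightarrow> 0 - x * 0) at_top"
    by (intro tendsto_intros G_lim f_lim)
  moreover have "G x - x * f x \<le> G y - x * f y" if "x < y" for y
    using G_inc(1)[of x y] that assms a0 ab by (auto simp: algebra_simps)
  then have "\<forall>\<^sub>F y in at_top. G x - x * f x \<le> G y - x * f y"
    by (intro eventually_mono[OF eventually_gt_at_top[of x]])
  ultimately have "G x - x * f x \<le> 0 - x * 0"
    by (intro tendsto_lowerbound) auto
  then show ?thesis by simp
qed

text \<open>Subtracting the values at \<open>b\<close> shows the transport meaning: the gains on
  \<open>(0, p)\<close> and \<open>(b, q)\<close> together equal the loss on \<open>(z, b)\<close>,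
  both in mass and in first moment.\<close>

definition matched :: "real \<Rightarrow> real \<Rightarrow> real \<Rightarrow> bool" where
  "matched z p q \<longleftrightarrow> 0 \<le> p \<and> p \<le> a \<and> b \<le> q \<and> f p + f q = f z \<and> G p + G q = G z"

lemma inverse_on_left:
  obtains g where "continuous_on {0..f a} g" "\<And>v. v \<in> {0..f a} \<Longrightarrow> g v \<in> {0..a} \<and> f (g v) = v"
    "\<And>p. p \<in> {0..a} \<Longrightarrow> g (f p) = p"
proof -
  have inj: "inj_on f {0..a}"
    by (rule linorder_inj_onI') (use inc1 in force)
  define g where "g = inv_into {0..a} f"
  have gf: "g (f p) = p" if "p \<in> {0..a}" for p
    using that inj by (simp add: g_def)
  have im: "f ` {0..a} = {0..f a}"
  proof
    show "f ` {0..a} \<subseteq> {0..f a}"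
    proof safe
      fix p assume "p \<in> {0..a}"
      then show "f p \<in> {0..f a}"
        using inc1[of 0 p] inc1[of p a] f0 by (cases "p = 0"; cases "p = a") auto
    qed
    show "{0..f a} \<subseteq> f ` {0..a}"
    proof
      fix v assume "v \<in> {0..f a}"
      then show "v \<in> f ` {0..a}"
        using IVT'[of f 0 v a, OF _ _ _ f_cont_on] f0 a0 by force
    qed
  qed
  have "continuous_on (f ` {0..a}) g"
    using gf by (intro continuous_on_inv f_cont_on) auto
  moreover have "g v \<in> {0..a} \<and> f (g v) = v" if "v \<in> {0..f a}" for v
    using that im gf by (metis imageE)
  ultimately show thesis using that gf im by simp
qed

lemma right_value:
  assumes "f b \<le> v" "v < 0"
  obtains q where "b \<le> q" "f q = v"
proof -
  have "\<forall>\<^sub>F x in at_top. v < f x \<and> b \<le> x"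
    using order_tendstoD(1)[OF f_lim assms(2)] eventually_ge_at_top[of b] by eventually_elim auto
  then obtain x where "v < f x" "b \<le> x"
    by (auto simp: eventually_at_top_linorder)
  then show thesis using IVT'[of f b v x, OF _ _ _ f_cont_on] assms that by auto
qed

text \<open>Intermediate value theorem in \<open>q\<close>, with \<open>p\<close> determined by the mass equation. At one end the
  moment is too small; at the other it is too large, where \<open>q\<close> may have to be sent to infinity.\<close>
lemma matched_exists:
  assumes z: "a < z" "z < b"
  obtains p q where "matched z p q"
proof -
  obtain g where g: "continuous_on {0..f a} g"
    "\<And>v. v \<in> {0..f a} \<Longrightarrow> g v \<in> {0..a} \<and> f (g v) = v" "\<And>p. p \<in> {0..a} \<Longrightarrow> g (f p) = p"
    using inverse_on_left by blast
  have fz: "f b < f z" "f z < f a" using dec[of z b] dec[of a z] z ab by auto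
  have fa: "0 < f a" using inc1[of 0 a] a0 f0 by simp
  define \<Psi> where "\<Psi> q = G (g (f z - f q)) + G q" for q
  \<comment> \<open>Least admissible \<open>q\<close>: either the mass equation forces
    \<open>p = a\<close> there, or \<open>q = b\<close> is already admissible. In the first case the
    loss on \<open>(a, z)\<close> is compared with the same mass beyond \<open>q > z\<close>; in the
    second the loss on \<open>(z, b)\<close> is compared with the same mass in
    \<open>(0, p)\<close>.\<close>
  obtain q1 where q1: "b \<le> q1" "f z - f q1 \<in> {0..f a}" "\<Psi> q1 \<le> G z"
  proof (cases "f b \<le> f z - f a")
    case True
    obtain q where q: "b \<le> q" "f q = f z - f a" using right_value[OF True] fz by auto
    have "G a - G z \<le> z * (f a - f z)" using G_dec(2)[of a z] z by simp
    moreover have "q * (f a - f z) \<le> - G q" using G_tail[OF q(1)] q(2) by (simp add: algebra_simps)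
    moreover have "z * (f a - f z) \<le> q * (f a - f z)"
      using q z fz by (intro mult_right_mono) auto
    moreover have "g (f z - f q) = a" using g(3)[of a] q a0 by simp
    ultimately have "\<Psi> q \<le> G z" by (simp add: \<Psi>_def)
    then show thesis using q fa by (intro that[of q]) auto
  next
    case False
    then have v: "f z - f b \<in> {0..f a}" using fz by auto
    define p where "p = g (f z - f b)"
    have p: "0 \<le> p" "p \<le> a" "f p = f z - f b" using g(2)[OF v] by (auto simp: p_def)
    have "G p \<le> p * f p" using G_inc(2)[of 0 p] p f0 G0 by (cases "p = 0") auto
    also have "\<dots> \<le> z * f p" using p z fz by (intro mult_right_mono) auto
    also have "\<dots> \<le> G z - G b" using G_dec(1)[of z b] z p by simp
    finally have "\<Psi> b \<le> G z" by (simp add: \<Psi>_def p_def)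
    then show thesis using v by (intro that[of b]) auto
  qed
  \<comment> \<open>Largest admissible \<open>q\<close>. As \<open>f\<close> is negative on
    \<open>[b, \<infinity>)\<close>, the value \<open>p = 0\<close> is reached at a finite
    \<open>q\<close> only if \<open>f z < 0\<close>. Otherwise the strict inequality
    \<open>G z < G p\<close> holds in the limit and hence already gives a finite witness.\<close>
  obtain q2 where q2: "q1 \<le> q2" "f q2 \<le> f z" "G z \<le> \<Psi> q2"
  proof (cases "f z < 0")
    case True
    obtain q where q: "b \<le> q" "f q = f z" using right_value[of "f z"] fz True by auto
    have "G q - G b \<ge> b * (f q - f b)" using G_inc(1)[of b q] q a0 ab by (cases "q = b") auto
    moreover have "G z - G b \<le> b * (f z - f b)" using G_dec(2)[of z b] z by simp
    moreover have "g 0 = 0" using g(3)[of 0] a0 f0 by simp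
    ultimately have "G z \<le> \<Psi> q" using q by (simp add: \<Psi>_def G0)
    moreover have "q1 \<le> q" using q1 q inc2[of q q1] by force
    ultimately show thesis using q by (intro that[of q]) auto
  next
    case False
    then have v: "f z \<in> {0..f a}" using fz by auto
    define p where "p = g (f z)"
    have p: "0 \<le> p" "p \<le> a" "f p = f z" using g(2)[OF v] by (auto simp: p_def)
    then have "p < a" using fz by (cases "p = a") auto
    then have "G a - G p < a * (f a - f p)" using G_inc(2)[of p a] p by simp
    moreover have "G a - G z > a * (f a - f z)" using G_dec(1)[of a z] z by simp
    ultimately have Gp: "G z < G p" using p by simp
    have ev: "\<forall>\<^sub>F q in at_top. f z - f q \<in> {0..f a} \<and> b \<le> q"
    proof -
      have "\<forall>\<^sub>F q in at_top. f z - f a < f q"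
        using order_tendstoD(1)[OF f_lim] fz by simp
      then show ?thesis using eventually_ge_at_top[of b]
      proof eventually_elim
        case (elim q)
        then show ?case using f_neg[of q] False by auto
      qed
    qed
    have "((\<lambda>q. f z - f q) \<longlongrightarrow> f z) at_top"
      using tendsto_diff[OF tendsto_const f_lim] by simp
    then have "((\<lambda>q. g (f z - f q)) \<longlongrightarrow> g (f z)) at_top"
      by (rule continuous_on_tendsto_compose[OF g(1) _ v]) (use ev in eventually_elim, simp)
    then have "((\<lambda>q. G (g (f z - f q)) + G q) \<longlongrightarrow> G p + 0) at_top"
      unfolding p_def by (intro tendsto_intros G_lim isCont_tendsto_compose[OF G_cont])
    then have "\<forall>\<^sub>F q in at_top. G z < \<Psi> q"
      using Gp order_tendstoD(1) unfolding \<Psi>_def by force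
    with ev eventually_ge_at_top[of q1]
    have "\<forall>\<^sub>F q in at_top. q1 \<le> q \<and> f q \<le> f z \<and> G z \<le> \<Psi> q"
      by eventually_elim auto
    then show thesis using that by (auto simp: eventually_at_top_linorder)
  qed
  have dom: "f z - f q \<in> {0..f a}" if "q1 \<le> q" "q \<le> q2" for q
  proof -
    have "f q1 \<le> f q" "f q \<le> f q2"
      using inc2[of q1 q] inc2[of q q2] that q1 by (auto simp: le_less)
    then show ?thesis using q1 q2 by auto
  qed
  have "continuous_on {q1..q2} (\<lambda>q. g (f z - f q))"
    using dom by (intro continuous_on_compose2[OF g(1)] continuous_intros f_cont_on) auto
  then have "continuous_on {q1..q2} \<Psi>"
    unfolding \<Psi>_def by (intro continuous_intros G_cont_on
        continuous_on_compose2[OF G_cont_on[of UNIV]]) auto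
  then obtain q where q: "q1 \<le> q" "q \<le> q2" "\<Psi> q = G z"
    using IVT'[of \<Psi> q1 "G z" q2] q1 q2 by auto
  have "matched z (g (f z - f q)) q"
    using g(2)[OF dom[OF q(1,2)]] q q1 by (auto simp: matched_def \<Psi>_def)
  then show thesis by (rule that)
qed

text \<open>Between \<open>z\<close> and \<open>z'\<close> a positive mass is lost whose barycentre
  lies strictly between \<open>a\<close> and \<open>b\<close>. Mass changes on the left piece have
  barycentre at most \<open>a\<close>, those on the right piece at least \<open>b\<close>. If
  \<open>p\<close> did not decrease, the right piece would have to balance everything, with too
  large a moment; if \<open>q\<close> did not, the left piece would, with too small a
  moment.\<close>

lemma matched_decreasing:
  assumes "matched z p q" "matched z' p' q'" and z: "a < z" "z < z'" "z' < b"
  shows "p' < p" "q' < q"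
proof -
  note m = assms(1,2)[unfolded matched_def]
  have fz: "f z' < f z" using dec[of z z'] z by simp
  have Gz: "z * (f z - f z') < G z - G z'" "G z - G z' < z' * (f z - f z')"
    using G_dec[of z z'] z by auto
  have p_up: "f p \<le> f p' \<and> p * (f p' - f p) \<le> G p' - G p \<and> G p' - G p \<le> a * (f p' - f p)"
    if "p \<le> p'"
  proof (cases "p = p'")
    case False
    then have "p < p'" using that by simp
    moreover have "p' * (f p' - f p) \<le> a * (f p' - f p)"
      using inc1[of p p'] calculation m by (intro mult_right_mono) auto
    ultimately show ?thesis
      using G_inc[of p p'] inc1[of p p'] m by linarith
  qed simp
  have q_up: "f q \<le> f q' \<and> b * (f q' - f q) \<le> G q' - G q" if "q \<le> q'"
  proof (cases "q = q'")
    case False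
    then have "q < q'" using that by simp
    moreover have "b * (f q' - f q) \<le> q * (f q' - f q)"
      using inc2[of q q'] calculation m by (intro mult_right_mono) auto
    ultimately show ?thesis
      using G_inc[of q q'] inc2[of q q'] m a0 ab by linarith
  qed simp
  have q_down: "f q' \<le> f q \<and> b * (f q - f q') \<le> G q - G q'" if "q' \<le> q"
  proof (cases "q = q'")
    case False
    then have "q' < q" using that by simp
    moreover have "b * (f q - f q') \<le> q' * (f q - f q')"
      using inc2[of q' q] calculation m by (intro mult_right_mono) auto
    ultimately show ?thesis
      using G_inc[of q' q] inc2[of q' q] m a0 ab by linarith
  qed simp
  have p_down: "f p' \<le> f p \<and> G p - G p' \<le> a * (f p - f p')" if "p' \<le> p"
  proof (cases "p = p'")
    case False
    then have "p' < p" using that by simp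
    moreover have "p * (f p - f p') \<le> a * (f p - f p')"
      using inc1[of p' p] calculation m by (intro mult_right_mono) auto
    ultimately show ?thesis
      using G_inc[of p' p] inc1[of p' p] m by linarith
  qed simp
  have za: "a * (f z - f z') < z * (f z - f z')" "z' * (f z - f z') < b * (f z - f z')"
    using fz z by simp_all
  show "p' < p"
  proof (rule ccontr)
    assume "\<not> p' < p"
    then have up: "p \<le> p'" by simp
    show False
    proof (cases "q \<le> q'")
      case True
      then show False using p_up[OF up] q_up m fz by linarith
    next
      case False
      have "f q - f q' = (f z - f z') + (f p' - f p)" using m by simp
      then have "b * (f q - f q') = b * (f z - f z') + b * (f p' - f p)"
        by (simp only: distrib_left)
      moreover have "a * (f p' - f p) \<le> b * (f p' - f p)"
        using p_up[OF up] ab by (intro mult_right_mono) auto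
      ultimately show False using q_down p_up[OF up] False Gz za m by linarith
    qed
  qed
  then have dn: "p' \<le> p" by simp
  show "q' < q"
  proof (rule ccontr)
    assume "\<not> q' < q"
    then have up: "q \<le> q'" by simp
    have "f p - f p' = (f z - f z') + (f q' - f q)" using m by simp
    then have "a * (f p - f p') = a * (f z - f z') + a * (f q' - f q)"
      by (simp only: distrib_left)
    moreover have "a * (f q' - f q) \<le> b * (f q' - f q)"
      using q_up[OF up] ab by (intro mult_right_mono) auto
    ultimately show False using q_up[OF up] p_down[OF dn] Gz za m by linarith
  qed
qed

end

section \<open>Martingale couplings and the symmetry operators\<close>

lemma space_eq_half_line:
  "sets M = sets half_line \<Longrightarrow> space M = {0<..}"
  using sets_eq_imp_space_eq[of M half_line] by (simp add: space_restrict_space)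

lemma space_eq_quadrant:
  "sets Q = sets quadrant \<Longrightarrow> space Q = {0<..} \<times> {0<..}"
  using sets_eq_imp_space_eq[of Q quadrant] by (simp add: space_pair_measure space_restrict_space)

lemma quadrant_pos:
  assumes "sets Q = sets quadrant" "\<omega> \<in> space Q"
  shows "0 < fst \<omega>" "0 < snd \<omega>"
  using assms(2) unfolding space_eq_quadrant[OF assms(1)] by (simp_all add: mem_Times_iff)

section \<open>Measures determined by their distribution functions\<close>

lemma sets_half_line_iff: "A \<in> sets half_line \<longleftrightarrow> A \<in> sets borel \<and> A \<subseteq> {0<..}"
  by (subst sets_restrict_space_iff) auto

text \<open>Both measures are pushed forward to the whole line, where a finite measure is determined
  by its \<open>cdf\<close>; no mass lies outside the half-line, so the equality restricts
  back.\<close>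

lemma half_line_measure_eqI:
  assumes M: "sets M = sets half_line" "finite_measure M"
    and N: "sets N = sets half_line" "finite_measure N"
    and eq: "\<And>z. 0 < z \<Longrightarrow> emeasure M {0<..z} = emeasure N {0<..z}"
  shows "M = N"
proof -
  let ?D = "\<lambda>M. distr M borel (\<lambda>x. x :: real)"
  have meas: "(\<lambda>x. x) \<in> measurable M borel" "(\<lambda>x. x) \<in> measurable N borel"
    using measurable_id_half_line M(1) N(1) by (simp_all cong: measurable_cong_sets)
  have fin: "finite_borel_measure (?D M)" "finite_borel_measure (?D N)"
    using meas M N by (auto intro!: finite_borel_measure.intro finite_measure.finite_measure_distr
        finite_borel_measure_axioms.intro)
  have vim: "(\<lambda>x. x) -` A \<inter> {0<..} = A \<inter> {0<..}" for A :: "real set" by auto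
  have "cdf (?D M) z = cdf (?D N) z" for z
  proof -
    have "measure M ({..z} \<inter> {0<..}) = measure N ({..z} \<inter> {0<..})"
    proof (cases "0 < z")
      case True
      have "{..z} \<inter> {0<..} = {0<..z}" by auto
      then show ?thesis
        using eq[OF True] by (simp add: measure_def)
    next
      case False
      then have "{..z} \<inter> {0<..} = {}" by auto
      then show ?thesis by simp
    qed
    then show ?thesis
      using meas M N by (simp add: cdf_def measure_distr space_eq_half_line vim)
  qed
  then have D: "?D M = ?D N"
    using fin by (intro cdf_unique') auto
  show ?thesis
  proof (rule measure_eqI)
    fix A assume "A \<in> sets M"
    then have A: "A \<in> sets borel" "A \<inter> {0<..} = A"
      using M(1) by (auto simp: sets_half_line_iff)
    have "emeasure (?D M) A = emeasure (?D N) A" using D by simp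
    then show "emeasure M A = emeasure N A"
      using meas M N A by (simp add: emeasure_distr space_eq_half_line vim)
  qed (use M N in simp)
qed

lemma quadrant_measurable:
  assumes "sets Q = sets quadrant"
  shows "fst \<in> measurable Q half_line" "snd \<in> measurable Q half_line"
    "fst \<in> borel_measurable Q" "snd \<in> borel_measurable Q"
proof -
  note [measurable_cong] = assms
  show "fst \<in> measurable Q half_line" "snd \<in> measurable Q half_line" by simp_all
  then show "fst \<in> borel_measurable Q" "snd \<in> borel_measurable Q"
    using measurable_compose[OF _ measurable_id_half_line] by auto
qed

text \<open>The one-dimensional criterion is used twice. With the first factor fixed as
  \<open>{0<..z}\<close> it frees the second; with an arbitrary second factor it then frees the
  first. Rectangles form an intersection-stable generator.\<close>

lemma quadrant_measure_eqI:
  assumes P: "sets P = sets quadrant" "finite_measure P"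
    and Q: "sets Q = sets quadrant" "finite_measure Q"
    and eq: "\<And>z w. 0 < z \<Longrightarrow> 0 < w \<Longrightarrow>
      emeasure P ({0<..z} \<times> {0<..w}) = emeasure Q ({0<..z} \<times> {0<..w})"
  shows "P = Q"
proof -
  let ?S = "\<lambda>Q A. distr (density Q (indicator (A \<times> {0<..}))) half_line snd"
  let ?F = "\<lambda>Q B. distr (density Q (indicator ({0<..} \<times> B))) half_line fst"
  have UN: "{0<..} \<in> sets half_line" by (simp add: sets_half_line_iff)
  have S: "sets (?S Q A) = sets half_line \<and> finite_measure (?S Q A) \<and>
      (\<forall>B\<in>sets half_line. emeasure (?S Q A) B = emeasure Q (A \<times> B))"
    if Q: "sets Q = sets quadrant" "finite_measure Q" and A: "A \<in> sets half_line" for Q A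
  proof -
    have s: "A \<times> {0<..} \<in> sets Q" using A UN Q by auto
    have m: "snd \<in> measurable (density Q (indicator (A \<times> {0<..}))) half_line"
      using quadrant_measurable(2)[OF Q(1)] by (simp cong: measurable_cong_sets)
    have e: "emeasure (?S Q A) B = emeasure Q (A \<times> B)" if B: "B \<in> sets half_line" for B
    proof -
      have "A \<times> {0<..} \<inter> (snd -` B \<inter> space Q) = A \<times> B"
        using A B space_eq_quadrant[OF Q(1)] by (auto simp: sets_half_line_iff)
      moreover have "snd -` B \<inter> space Q \<in> sets Q"
        using measurable_sets[OF quadrant_measurable(2)[OF Q(1)] B] .
      ultimately show ?thesis using B m s by (simp add: emeasure_distr emeasure_restricted)
    qed
    have "emeasure (?S Q A) {0<..} \<noteq> \<infinity>"
      unfolding e[OF UN] using finite_measure.emeasure_finite[OF Q(2)] by simp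
    then show ?thesis using e by (auto intro!: finite_measureI simp: space_restrict_space)
  qed
  have F: "sets (?F Q B) = sets half_line \<and> finite_measure (?F Q B) \<and>
      (\<forall>A\<in>sets half_line. emeasure (?F Q B) A = emeasure Q (A \<times> B))"
    if Q: "sets Q = sets quadrant" "finite_measure Q" and B: "B \<in> sets half_line" for Q B
  proof -
    have s: "{0<..} \<times> B \<in> sets Q" using B UN Q by auto
    have m: "fst \<in> measurable (density Q (indicator ({0<..} \<times> B))) half_line"
      using quadrant_measurable(1)[OF Q(1)] by (simp cong: measurable_cong_sets)
    have e: "emeasure (?F Q B) A = emeasure Q (A \<times> B)" if A: "A \<in> sets half_line" for A
    proof -
      have "{0<..} \<times> B \<inter> (fst -` A \<inter> space Q) = A \<times> B"
        using A B space_eq_quadrant[OF Q(1)] by (auto simp: sets_half_line_iff)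
      moreover have "fst -` A \<inter> space Q \<in> sets Q"
        using measurable_sets[OF quadrant_measurable(1)[OF Q(1)] A] .
      ultimately show ?thesis using A m s by (simp add: emeasure_distr emeasure_restricted)
    qed
    have "emeasure (?F Q B) {0<..} \<noteq> \<infinity>"
      unfolding e[OF UN] using finite_measure.emeasure_finite[OF Q(2)] by simp
    then show ?thesis using e by (auto intro!: finite_measureI simp: space_restrict_space)
  qed
  have Ioc: "{0<..z} \<in> sets half_line" for z :: real by (auto simp: sets_half_line_iff)
  have 1: "emeasure P ({0<..z} \<times> B) = emeasure Q ({0<..z} \<times> B)"
    if z: "0 < z" and B: "B \<in> sets half_line" for z B
  proof -
    have "?S P {0<..z} = ?S Q {0<..z}"
      using S[OF P Ioc] S[OF Q Ioc] eq z Ioc by (intro half_line_measure_eqI) auto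
    then show ?thesis using S[OF P Ioc] S[OF Q Ioc] B by metis
  qed
  have 2: "emeasure P (A \<times> B) = emeasure Q (A \<times> B)"
    if A: "A \<in> sets half_line" and B: "B \<in> sets half_line" for A B
  proof -
    have "?F P B = ?F Q B"
      using F[OF P B] F[OF Q B] 1 B Ioc by (intro half_line_measure_eqI) auto
    then show ?thesis using F[OF P B] F[OF Q B] A by metis
  qed
  have sp: "space half_line = ({0<..} :: real set)" by (simp add: space_restrict_space)
  show ?thesis
  proof (rule measure_eqI_generator_eq[OF Int_stable_pair_measure_generator[of half_line half_line],
        where \<Omega> = "{0<..} \<times> {0<..}" and A = "\<lambda>_. {0<..} \<times> {0<..}"])
    show "{a \<times> b |a b. a \<in> sets half_line \<and> b \<in> sets half_line}
        \<subseteq> Pow ({0 :: real<..} \<times> {0 :: real<..})"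
      by (auto simp: sets_half_line_iff)
    show "sets P = sigma_sets ({0<..} \<times> {0<..}) {a \<times> b |a b. a \<in> sets half_line \<and> b \<in> sets half_line}"
      "sets Q = sigma_sets ({0<..} \<times> {0<..}) {a \<times> b |a b. a \<in> sets half_line \<and> b \<in> sets half_line}"
      using P Q by (simp_all add: sets_pair_measure sp)
    show "range (\<lambda>_. {0<..} \<times> {0<..}) \<subseteq> {a \<times> b |a b. a \<in> sets half_line \<and> b \<in> sets half_line}"
      using UN by auto
    show "emeasure P ({0<..} \<times> {0<..}) \<noteq> \<infinity>"
      using finite_measure.emeasure_finite[OF P(2)] by simp
  qed (use 2 in auto)
qed

section \<open>Mean-one laws and the martingale property\<close>

lemma P1D:
  assumes "\<mu> \<in> P1"
  shows "prob_space \<mu>" "sets \<mu> = sets half_line" "integrable \<mu> (\<lambda>x. x)" "(\<integral>x. x \<partial>\<mu>) = 1"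
    "(\<integral>\<^sup>+x. ennreal x \<partial>\<mu>) = 1"
proof -
  show 1: "prob_space \<mu>" "sets \<mu> = sets half_line" "(\<integral>x. x \<partial>\<mu>) = 1" using assms by (auto simp: P1_def)
  \<comment> \<open>A non-integrable function has Bochner integral 0, so the value 1 already implies
    integrability.\<close>
  show 2: "integrable \<mu> (\<lambda>x. x)" using 1(3) not_integrable_integral_eq by fastforce
  have "(\<integral>\<^sup>+x. ennreal x \<partial>\<mu>) = ennreal (\<integral>x. x \<partial>\<mu>)"
    using 2 space_eq_half_line[OF 1(2)] by (intro nn_integral_eq_integral AE_I2) auto
  then show "(\<integral>\<^sup>+x. ennreal x \<partial>\<mu>) = 1" using 1 by simp
qed

lemma P1I:
  assumes "prob_space \<mu>" "sets \<mu> = sets half_line" "(\<integral>\<^sup>+x. ennreal x \<partial>\<mu>) = 1"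
  shows "\<mu> \<in> P1"
proof -
  have "(\<lambda>x. x) \<in> borel_measurable \<mu>"
    using measurable_id_half_line assms(2) by (simp cong: measurable_cong_sets)
  then have "(\<integral>x. x \<partial>\<mu>) = enn2real (\<integral>\<^sup>+x. ennreal x \<partial>\<mu>)"
    using space_eq_half_line[OF assms(2)] by (intro integral_eq_nn_integral AE_I2) auto
  then show ?thesis using assms by (auto simp: P1_def)
qed

lemma coupling_integrals:
  assumes P1: "\<mu> \<in> P1" "\<nu> \<in> P1" and Q: "sets Q = sets quadrant"
    "distr Q half_line fst = \<mu>" "distr Q half_line snd = \<nu>"
  shows "integrable Q fst" "integrable Q snd"
    "(\<integral>\<^sup>+\<omega>. ennreal (fst \<omega>) \<partial>Q) = 1" "(\<integral>\<^sup>+\<omega>. ennreal (snd \<omega>) \<partial>Q) = 1"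
proof -
  note m = quadrant_measurable[OF Q(1)]
  show "integrable Q fst"
    using P1D(3)[OF P1(1)] unfolding Q(2)[symmetric]
    by (subst (asm) integrable_distr_eq[OF m(1)]) (simp_all add: measurable_id_half_line)
  show "integrable Q snd"
    using P1D(3)[OF P1(2)] unfolding Q(3)[symmetric]
    by (subst (asm) integrable_distr_eq[OF m(2)]) (simp_all add: measurable_id_half_line)
  show "(\<integral>\<^sup>+\<omega>. ennreal (fst \<omega>) \<partial>Q) = 1"
    using P1D(5)[OF P1(1)] unfolding Q(2)[symmetric]
    by (subst (asm) nn_integral_distr[OF m(1)]) (simp_all add: measurable_id_half_line)
  show "(\<integral>\<^sup>+\<omega>. ennreal (snd \<omega>) \<partial>Q) = 1"
    using P1D(5)[OF P1(2)] unfolding Q(3)[symmetric]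
    by (subst (asm) nn_integral_distr[OF m(2)]) (simp_all add: measurable_id_half_line)
qed

text \<open>The martingale property written as an equality of measures: \<open>E[Y; X \<in> A] = E[X; X \<in> A]\<close>.\<close>
definition reproduces_mean :: "(real \<times> real) measure \<Rightarrow> bool" where
  "reproduces_mean Q \<longleftrightarrow>
     distr (density Q (\<lambda>\<omega>. ennreal (snd \<omega>))) half_line fst =
     distr (density Q (\<lambda>\<omega>. ennreal (fst \<omega>))) half_line fst"

lemma nn_integral_distr_density_fst:
  assumes Q: "sets Q = sets quadrant" and f: "f \<in> borel_measurable half_line"
    and g: "g \<in> borel_measurable Q"
  shows "(\<integral>\<^sup>+x. f x \<partial>distr (density Q g) half_line fst) = (\<integral>\<^sup>+\<omega>. g \<omega> * f (fst \<omega>) \<partial>Q)"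
proof -
  have m: "fst \<in> measurable (density Q g) half_line"
    using quadrant_measurable(1)[OF Q(1)] by (simp cong: measurable_cong_sets)
  have fm: "(\<lambda>\<omega>. f (fst \<omega>)) \<in> borel_measurable Q"
    using measurable_compose[OF quadrant_measurable(1)[OF Q] f] .
  show ?thesis using g fm by (simp add: nn_integral_distr[OF m] f nn_integral_density)
qed

lemma reproduces_meanD:
  assumes Q: "sets Q = sets quadrant" and f: "f \<in> borel_measurable half_line"
    and m: "reproduces_mean Q"
  shows "(\<integral>\<^sup>+\<omega>. ennreal (snd \<omega>) * f (fst \<omega>) \<partial>Q) = (\<integral>\<^sup>+\<omega>. ennreal (fst \<omega>) * f (fst \<omega>) \<partial>Q)"
  using m[unfolded reproduces_mean_def] quadrant_measurable[OF Q]
  by (simp add: nn_integral_distr_density_fst[OF Q f, symmetric])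

lemma reproduces_meanI:
  assumes Q: "sets Q = sets quadrant"
    and eq: "\<And>A. A \<in> sets half_line \<Longrightarrow> (\<integral>\<^sup>+\<omega>. ennreal (snd \<omega>) * indicator A (fst \<omega>) \<partial>Q) =
      (\<integral>\<^sup>+\<omega>. ennreal (fst \<omega>) * indicator A (fst \<omega>) \<partial>Q)"
  shows "reproduces_mean Q"
  unfolding reproduces_mean_def
proof (rule measure_eqI)
  let ?D = "\<lambda>g. distr (density Q g) half_line fst"
  fix A assume "A \<in> sets (?D (\<lambda>\<omega>. ennreal (snd \<omega>)))"
  then have A: "A \<in> sets half_line" by simp
  have "emeasure (?D g) A = (\<integral>\<^sup>+\<omega>. g \<omega> * indicator A (fst \<omega>) \<partial>Q)" if "g \<in> borel_measurable Q" for g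
    using nn_integral_distr_density_fst[OF Q _ that, of "indicator A"] A by simp
  then show "emeasure (?D (\<lambda>\<omega>. ennreal (snd \<omega>))) A = emeasure (?D (\<lambda>\<omega>. ennreal (fst \<omega>))) A"
    using eq[OF A] quadrant_measurable[OF Q] by simp
qed simp

text \<open>Conditional expectation is characterized by its integrals over sets determined by the
  first coordinate. Both coordinates are positive, so these integrals can be taken in
  \<open>ennreal\<close>, where the symmetry operators act by change of variables.\<close>

lemma real_cond_exp_fst_iff:
  assumes Q: "prob_space Q" "sets Q = sets quadrant" and int: "integrable Q fst" "integrable Q snd"
  shows "(AE \<omega> in Q. real_cond_exp Q (vimage_algebra (space Q) fst half_line) snd \<omega> = fst \<omega>)
    \<longleftrightarrow> reproduces_mean Q"
proof -
  interpret prob_space Q by fact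
  let ?F = "vimage_algebra (space Q) fst half_line"
  note m = quadrant_measurable[OF Q(2)]
  have fs: "fst \<in> space Q \<rightarrow> space half_line"
    using m(1) by (auto simp: measurable_def)
  have setsF: "sets ?F = {fst -` A \<inter> space Q |A. A \<in> sets half_line}"
    using sets_vimage_algebra2[OF fs] .
  have sub: "subalgebra Q ?F"
    using measurable_sets[OF m(1)] by (auto simp: subalgebra_def setsF)
  interpret finite_measure_subalgebra Q ?F by unfold_locales (rule sub)
  note pos = quadrant_pos[OF Q(2)]
  have conv: "(\<integral>\<^sup>+\<omega>. ennreal (g \<omega>) * indicator A (fst \<omega>) \<partial>Q)
      = ennreal (\<integral>\<omega>\<in>(fst -` A \<inter> space Q). g \<omega> \<partial>Q)"
    if g: "integrable Q g" "\<And>\<omega>. \<omega> \<in> space Q \<Longrightarrow> 0 < g \<omega>" and A: "A \<in> sets half_line" for g A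
  proof -
    have s: "fst -` A \<inter> space Q \<in> sets Q" using measurable_sets[OF m(1) A] .
    have "(\<integral>\<^sup>+\<omega>. ennreal (g \<omega>) * indicator A (fst \<omega>) \<partial>Q)
      = (\<integral>\<^sup>+\<omega>. ennreal (indicator (fst -` A \<inter> space Q) \<omega> *\<^sub>R g \<omega>) \<partial>Q)"
      by (intro nn_integral_cong) (auto simp: indicator_def)
    also have "\<dots> = ennreal (\<integral>\<omega>. indicator (fst -` A \<inter> space Q) \<omega> *\<^sub>R g \<omega> \<partial>Q)"
      using g s by (intro nn_integral_eq_integral integrable_mult_indicator AE_I2)
        (auto simp: indicator_def less_imp_le)
    finally show ?thesis by (simp add: set_lebesgue_integral_def)
  qed
  \<comment> \<open>\<open>ennreal\<close> truncates negative numbers to 0, so returning from an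
    equality of \<open>ennreal\<close> values to one of reals requires the sign.\<close>
  have nn: "0 \<le> (\<integral>\<omega>\<in>(fst -` A \<inter> space Q). g \<omega> \<partial>Q)"
    if "\<And>\<omega>. \<omega> \<in> space Q \<Longrightarrow> 0 < g \<omega>" for g :: "real \<times> real \<Rightarrow> real" and A
    unfolding set_lebesgue_integral_def
    by (rule integral_nonneg_AE, rule AE_I2) (use that in \<open>auto simp: indicator_def less_imp_le\<close>)
  show ?thesis
  proof
    assume ce: "AE \<omega> in Q. real_cond_exp Q ?F snd \<omega> = fst \<omega>"
    show "reproduces_mean Q"
    proof (rule reproduces_meanI[OF Q(2)])
      fix A assume A: "A \<in> sets half_line"
      have "fst -` A \<inter> space Q \<in> sets ?F" using A setsF by auto
      from real_cond_exp_intA[OF int(2) this]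
      have "(\<integral>\<omega>\<in>(fst -` A \<inter> space Q). snd \<omega> \<partial>Q)
        = (\<integral>\<omega>\<in>(fst -` A \<inter> space Q). real_cond_exp Q ?F snd \<omega> \<partial>Q)" .
      also have "\<dots> = (\<integral>\<omega>\<in>(fst -` A \<inter> space Q). fst \<omega> \<partial>Q)"
        unfolding set_lebesgue_integral_def
        using measurable_sets[OF m(1) A] m ce
        by (intro integral_cong_AE) auto
      finally show "(\<integral>\<^sup>+\<omega>. ennreal (snd \<omega>) * indicator A (fst \<omega>) \<partial>Q) =
          (\<integral>\<^sup>+\<omega>. ennreal (fst \<omega>) * indicator A (fst \<omega>) \<partial>Q)"
        using conv[OF int(2) pos(2) A] conv[OF int(1) pos(1) A] by simp
    qed
  next
    assume r: "reproduces_mean Q"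
    show "AE \<omega> in Q. real_cond_exp Q ?F snd \<omega> = fst \<omega>"
    proof (rule real_cond_exp_charact[OF _ int(2,1)])
      show "fst \<in> borel_measurable ?F"
        using measurable_compose[OF measurable_vimage_algebra1[OF fs] measurable_id_half_line] .
    next
      fix B assume "B \<in> sets ?F"
      then obtain A where A: "A \<in> sets half_line" "B = fst -` A \<inter> space Q" using setsF by auto
      have "(\<integral>\<^sup>+\<omega>. ennreal (snd \<omega>) * indicator A (fst \<omega>) \<partial>Q) =
          (\<integral>\<^sup>+\<omega>. ennreal (fst \<omega>) * indicator A (fst \<omega>) \<partial>Q)"
        using A by (intro reproduces_meanD[OF Q(2) _ r]) auto
      then show "(\<integral>\<omega>\<in>B. snd \<omega> \<partial>Q) = (\<integral>\<omega>\<in>B. fst \<omega> \<partial>Q)"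
        using conv[OF int(2) pos(2) A(1)] conv[OF int(1) pos(1) A(1)]
          nn[of fst A, OF pos(1)] nn[of snd A, OF pos(2)] by (simp add: A)
    qed
  qed
qed

lemma martingale_couplings_iff:
  assumes "\<mu> \<in> P1" "\<nu> \<in> P1"
  shows "Q \<in> martingale_couplings \<mu> \<nu> \<longleftrightarrow> prob_space Q \<and> sets Q = sets quadrant \<and>
    distr Q half_line fst = \<mu> \<and> distr Q half_line snd = \<nu> \<and> reproduces_mean Q"
  using real_cond_exp_fst_iff coupling_integrals[OF assms]
  unfolding martingale_couplings_def by auto

section \<open>Action of the symmetry operators\<close>

lemma S_op_P1:
  assumes "\<mu> \<in> P1" shows "S_op \<mu> \<in> P1"
proof (rule P1I)
  note P = P1D[OF assms]
  show s: "sets (S_op \<mu>) = sets half_line" by (simp add: S_op_def)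
  have "emeasure (S_op \<mu>) (space (S_op \<mu>)) = (\<integral>\<^sup>+x. 1 \<partial>S_op \<mu>)" by simp
  also have "\<dots> = 1" using P by (subst nn_integral_S_op) auto
  finally show "prob_space (S_op \<mu>)" by (rule prob_spaceI)
  have "(\<integral>\<^sup>+x. ennreal x \<partial>S_op \<mu>) = (\<integral>\<^sup>+x. ennreal x * ennreal (1 / x) \<partial>\<mu>)"
    using P by (subst nn_integral_S_op) auto
  also have "\<dots> = (\<integral>\<^sup>+x. 1 \<partial>\<mu>)"
    using space_eq_half_line[OF P(2)] by (intro nn_integral_cong) (auto simp add: ennreal_mult[symmetric])
  finally show "(\<integral>\<^sup>+x. ennreal x \<partial>S_op \<mu>) = 1" using prob_space.emeasure_space_1[OF P(1)] by simp
qed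

lemma sets_SS_op [simp]: "sets (SS_op Q) = sets quadrant"
  by (simp add: SS_op_def)

lemma measure_eq_if_nn_integrals:
  assumes "sets M = sets R" "sets N = sets R"
    and "\<And>f :: 'a \<Rightarrow> ennreal. f \<in> borel_measurable R \<Longrightarrow> (\<integral>\<^sup>+x. f x \<partial>M) = (\<integral>\<^sup>+x. f x \<partial>N)"
  shows "M = N"
proof (rule measure_eqI)
  fix A assume "A \<in> sets M"
  then show "emeasure M A = emeasure N A" using assms(3)[of "indicator A"] assms by simp
qed (use assms in simp)

text \<open>The second marginal is a plain change of variables. The first one carries the weight
  \<open>snd \<omega>\<close> where \<open>S_op\<close> asks for \<open>fst \<omega>\<close>; the
  martingale property exchanges them, because the rest of the integrand depends on
  \<open>fst \<omega>\<close> only.\<close>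

lemma SS_op_martingale_coupling:
  assumes P: "\<mu> \<in> P1" "\<nu> \<in> P1" and "Q \<in> martingale_couplings \<mu> \<nu>"
  shows "SS_op Q \<in> martingale_couplings (S_op \<mu>) (S_op \<nu>)"
proof -
  note Q = assms(3)[unfolded martingale_couplings_iff[OF P]]
  have s: "sets Q = sets quadrant" using Q by simp
  note m = quadrant_measurable[OF s]
  note pos = quadrant_pos[OF s]
  have f1: "(\<lambda>\<omega>. f (fst \<omega>)) \<in> borel_measurable quadrant" "(\<lambda>\<omega>. f (snd \<omega>)) \<in> borel_measurable quadrant"
    if "f \<in> borel_measurable half_line" for f :: "real \<Rightarrow> ennreal"
    using that by simp_all
  have inv: "(\<lambda>x. f (1 / x)) \<in> borel_measurable half_line"
    if "f \<in> borel_measurable half_line" for f :: "real \<Rightarrow> ennreal"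
    using that by simp
  have fst_law: "(\<integral>\<^sup>+\<omega>. f (fst \<omega>) \<partial>SS_op Q) = (\<integral>\<^sup>+x. f x \<partial>S_op \<mu>)"
    if f: "f \<in> borel_measurable half_line" for f
  proof -
    have "(\<integral>\<^sup>+\<omega>. f (fst \<omega>) \<partial>SS_op Q) = (\<integral>\<^sup>+\<omega>. ennreal (snd \<omega>) * f (1 / fst \<omega>) \<partial>Q)"
      using nn_integral_SS_op[OF s f1(1)[OF f]] by simp
    also have "\<dots> = (\<integral>\<^sup>+\<omega>. ennreal (fst \<omega>) * f (1 / fst \<omega>) \<partial>Q)"
      using reproduces_meanD[OF s inv[OF f]] Q by simp
    also have "\<dots> = (\<integral>\<^sup>+x. ennreal x * f (1 / x) \<partial>distr Q half_line fst)"
      using m f by (simp add: nn_integral_distr)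
    also have "\<dots> = (\<integral>\<^sup>+x. f x \<partial>S_op \<mu>)"
      using Q nn_integral_S_op[OF P1D(2)[OF P(1)] f] by simp
    finally show ?thesis .
  qed
  have snd_law: "(\<integral>\<^sup>+\<omega>. f (snd \<omega>) \<partial>SS_op Q) = (\<integral>\<^sup>+x. f x \<partial>S_op \<nu>)"
    if f: "f \<in> borel_measurable half_line" for f
  proof -
    have "(\<integral>\<^sup>+\<omega>. f (snd \<omega>) \<partial>SS_op Q) = (\<integral>\<^sup>+\<omega>. ennreal (snd \<omega>) * f (1 / snd \<omega>) \<partial>Q)"
      using nn_integral_SS_op[OF s f1(2)[OF f]] by simp
    also have "\<dots> = (\<integral>\<^sup>+x. ennreal x * f (1 / x) \<partial>distr Q half_line snd)"
      using m f by (simp add: nn_integral_distr)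
    also have "\<dots> = (\<integral>\<^sup>+x. f x \<partial>S_op \<nu>)"
      using Q nn_integral_S_op[OF P1D(2)[OF P(2)] f] by simp
    finally show ?thesis .
  qed
  note mS = quadrant_measurable[OF sets_SS_op[of Q]]
  have "distr (SS_op Q) half_line fst = S_op \<mu>"
    using fst_law mS by (intro measure_eq_if_nn_integrals[where R=half_line])
      (simp_all add: nn_integral_distr S_op_def)
  moreover have "distr (SS_op Q) half_line snd = S_op \<nu>"
    using snd_law mS by (intro measure_eq_if_nn_integrals[where R=half_line])
      (simp_all add: nn_integral_distr S_op_def)
  moreover have "prob_space (SS_op Q)"
  proof (rule prob_spaceI)
    have "emeasure (SS_op Q) (space (SS_op Q)) = (\<integral>\<^sup>+\<omega>. 1 \<partial>SS_op Q)" by simp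
    also have "\<dots> = 1" using nn_integral_SS_op[OF s, of "\<lambda>_. 1"] coupling_integrals(4)[OF P s] Q by simp
    finally show "emeasure (SS_op Q) (space (SS_op Q)) = 1" .
  qed
  moreover have "reproduces_mean (SS_op Q)"
  proof (rule reproduces_meanI[OF sets_SS_op])
    fix A assume A: "A \<in> sets half_line"
    then have A': "(indicator A :: real \<Rightarrow> ennreal) \<in> borel_measurable half_line" by simp
    have im: "(\<lambda>x. ennreal (1 / x) * indicator A (1 / x)) \<in> borel_measurable half_line"
      using measurable_compose[OF measurable_reciprocal, of "\<lambda>x. ennreal x * indicator A x"] A' by simp
    have "(\<integral>\<^sup>+\<omega>. ennreal (snd \<omega>) * indicator A (fst \<omega>) \<partial>SS_op Q)
      = (\<integral>\<^sup>+\<omega>. ennreal (snd \<omega>) * (ennreal (1 / snd \<omega>) * indicator A (1 / fst \<omega>)) \<partial>Q)"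
      using A' by (subst nn_integral_SS_op[OF s]) auto
    \<comment> \<open>Each weight cancels its own reciprocal, so the product for
      \<open>snd \<omega>\<close> may be replaced by the one for \<open>fst \<omega>\<close>. The
      martingale property then restores the weight \<open>snd \<omega>\<close> while the factor
      \<open>1 / fst \<omega>\<close> stays.\<close>
    also have "\<dots> = (\<integral>\<^sup>+\<omega>. ennreal (fst \<omega>) * (ennreal (1 / fst \<omega>) * indicator A (1 / fst \<omega>)) \<partial>Q)"
    proof (rule nn_integral_cong)
      fix \<omega> assume "\<omega> \<in> space Q"
      note p = pos[OF this]
      have "ennreal (fst \<omega>) * ennreal (1 / fst \<omega>) = 1" "ennreal (snd \<omega>) * ennreal (1 / snd \<omega>) = 1"
        using p by (simp_all add: ennreal_mult[symmetric])
      then show "ennreal (snd \<omega>) * (ennreal (1 / snd \<omega>) * indicator A (1 / fst \<omega>)) =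
          ennreal (fst \<omega>) * (ennreal (1 / fst \<omega>) * indicator A (1 / fst \<omega>))"
        by (simp only: mult.assoc[symmetric])
    qed
    also have "\<dots> = (\<integral>\<^sup>+\<omega>. ennreal (snd \<omega>) * (ennreal (1 / fst \<omega>) * indicator A (1 / fst \<omega>)) \<partial>Q)"
      using reproduces_meanD[OF s im] Q by simp
    also have "\<dots> = (\<integral>\<^sup>+\<omega>. ennreal (fst \<omega>) * indicator A (fst \<omega>) \<partial>SS_op Q)"
      using A' by (subst nn_integral_SS_op[OF s]) auto
    finally show "(\<integral>\<^sup>+\<omega>. ennreal (snd \<omega>) * indicator A (fst \<omega>) \<partial>SS_op Q)
      = (\<integral>\<^sup>+\<omega>. ennreal (fst \<omega>) * indicator A (fst \<omega>) \<partial>SS_op Q)" .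
  qed
  ultimately show ?thesis
    using martingale_couplings_iff[OF S_op_P1[OF P(1)] S_op_P1[OF P(2)]] by simp
qed

lemma measurable_reciprocal_pair:
  "(\<lambda>\<omega>. (1 / fst \<omega>, 1 / snd \<omega>)) \<in> measurable quadrant quadrant"
  by (intro measurable_Pair measurable_compose[OF measurable_fst measurable_reciprocal]
        measurable_compose[OF measurable_snd measurable_reciprocal])

text \<open>The two successive weights are \<open>snd \<omega>\<close> and
  \<open>1 / snd \<omega>\<close>, with product 1.\<close>

lemma SS_op_SS_op:
  assumes s: "sets Q = sets quadrant"
  shows "SS_op (SS_op Q) = Q"
proof (rule measure_eq_if_nn_integrals[where R=quadrant])
  fix f :: "real \<times> real \<Rightarrow> ennreal" assume f: "f \<in> borel_measurable quadrant"
  have "snd \<in> borel_measurable quadrant" by (rule quadrant_measurable(4)) simp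
  then have g: "(\<lambda>\<omega>. ennreal (snd \<omega>) * f (1 / fst \<omega>, 1 / snd \<omega>)) \<in> borel_measurable quadrant"
    using measurable_compose[OF measurable_reciprocal_pair f] by simp
  have "(\<integral>\<^sup>+\<omega>. f \<omega> \<partial>SS_op (SS_op Q))
    = (\<integral>\<^sup>+\<omega>. ennreal (snd \<omega>) * f (1 / fst \<omega>, 1 / snd \<omega>) \<partial>SS_op Q)"
    by (rule nn_integral_SS_op[OF sets_SS_op f])
  also have "\<dots> = (\<integral>\<^sup>+\<omega>. ennreal (snd \<omega>) * (ennreal (1 / snd \<omega>) * f \<omega>) \<partial>Q)"
    by (subst nn_integral_SS_op[OF s g]) simp
  also have "\<dots> = (\<integral>\<^sup>+\<omega>. f \<omega> \<partial>Q)"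
  proof (rule nn_integral_cong)
    fix \<omega> assume "\<omega> \<in> space Q"
    then have "0 < snd \<omega>" using quadrant_pos[OF s] by auto
    then have "ennreal (snd \<omega>) * ennreal (1 / snd \<omega>) = 1" by (simp add: ennreal_mult[symmetric])
    then show "ennreal (snd \<omega>) * (ennreal (1 / snd \<omega>) * f \<omega>) = f \<omega>"
      by (simp only: mult.assoc[symmetric] mult_1)
  qed
  finally show "(\<integral>\<^sup>+\<omega>. f \<omega> \<partial>SS_op (SS_op Q)) = (\<integral>\<^sup>+\<omega>. f \<omega> \<partial>Q)" .
qed (use s in simp_all)

lemma AE_SS_opI:
  assumes s: "sets Q = sets quadrant" and P: "{\<omega> \<in> space quadrant. P \<omega>} \<in> sets quadrant"
    and ae: "AE \<omega> in Q. P (1 / fst \<omega>, 1 / snd \<omega>)"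
  shows "AE \<omega> in SS_op Q. P \<omega>"
proof -
  note [measurable_cong] = s
  have m: "(\<lambda>\<omega>. (1 / fst \<omega>, 1 / snd \<omega>)) \<in> measurable (density Q (\<lambda>\<omega>. ennreal (snd \<omega>))) quadrant"
    using measurable_reciprocal_pair s by (simp cong: measurable_cong_sets)
  show ?thesis
    unfolding SS_op_def using ae quadrant_measurable(4)[OF s]
    by (subst AE_distr_iff[OF m P]) (auto simp: AE_density elim: eventually_mono)
qed

section \<open>Minimality of the crossing probabilities\<close>

lemma isCont_F_cdf:
  assumes "sets M = sets half_line" "finite_measure M" "\<And>x. 0 < x \<Longrightarrow> emeasure M {x} = 0"
  shows "isCont (F_cdf M) x"
proof -
  let ?D = "distr M borel (\<lambda>x. x :: real)"
  have meas: "(\<lambda>x. x) \<in> measurable M borel"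
    using measurable_id_half_line assms(1) by (simp cong: measurable_cong_sets)
  interpret D: finite_borel_measure ?D
    using meas assms(2) by (auto intro!: finite_borel_measure.intro finite_measure.finite_measure_distr
        finite_borel_measure_axioms.intro)
  have vim: "(\<lambda>x. x) -` A \<inter> {0<..} = A \<inter> {0<..}" for A :: "real set" by auto
  have "{..z} \<inter> {0<..} = {0<..z}" for z :: real by auto
  then have "cdf ?D = F_cdf M"
    using meas by (intro ext) (simp add: cdf_def F_cdf_def measure_distr vim space_eq_half_line[OF assms(1)])
  moreover have "measure ?D {x} = 0"
  proof (cases "0 < x")
    case True
    then have "{x} \<inter> {0<..} = {x}" by auto
    moreover have "measure M {x} = 0" using assms(3)[OF True] by (simp add: measure_def)
    ultimately show ?thesis
      using meas by (simp add: measure_distr vim space_eq_half_line[OF assms(1)])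
  next
    case False
    then have "{x} \<inter> {0<..} = {}" by auto
    then show ?thesis
      using meas by (simp add: measure_distr vim space_eq_half_line[OF assms(1)])
  qed
  ultimately show ?thesis using D.isCont_cdf by metis
qed

text \<open>All inequalities are strict: half-open cells would turn into half-open cells of the
  opposite kind under inversion, and the lines at \<open>p\<close>, \<open>z\<close>,
  \<open>q\<close> are null for atomless marginals. Every diagonal point satisfies the condition, so
  mass that stays put never violates it.\<close>

definition hk_jump :: "real \<Rightarrow> real \<Rightarrow> real \<Rightarrow> real \<times> real \<Rightarrow> bool" where
  "hk_jump p z q \<omega> \<longleftrightarrow>
     (fst \<omega> < p \<longrightarrow> snd \<omega> < p) \<and>
     (p < fst \<omega> \<and> fst \<omega> < z \<longrightarrow> p < snd \<omega> \<and> snd \<omega> < z \<or> q < snd \<omega>) \<and>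
     (z < fst \<omega> \<and> fst \<omega> < q \<longrightarrow> snd \<omega> < p \<or> z < snd \<omega> \<and> snd \<omega> < q) \<and>
     (q < fst \<omega> \<longrightarrow> q < snd \<omega>)"

definition hk_pattern ::
    "real \<Rightarrow> real \<Rightarrow> (real \<Rightarrow> real) \<Rightarrow> (real \<Rightarrow> real) \<Rightarrow> real \<Rightarrow> real \<times> real \<Rightarrow> bool" where
  "hk_pattern a b p q z \<omega> \<longleftrightarrow>
     (if z \<le> a then \<not> (fst \<omega> < z \<and> z < snd \<omega>)
      else if b \<le> z then \<not> (snd \<omega> < z \<and> z < fst \<omega>)
      else hk_jump (p z) z (q z) \<omega>)"

text \<open>Strict positivity of \<open>p z\<close> keeps \<open>1 / p z\<close> finite, so the
  class of parameters is closed under inversion.\<close>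

definition hk_params :: "real \<Rightarrow> real \<Rightarrow> (real \<Rightarrow> real) \<Rightarrow> (real \<Rightarrow> real) \<Rightarrow> bool" where
  "hk_params a b p q \<longleftrightarrow>
     0 < a \<and> a < b \<and> (\<forall>z. a < z \<and> z < b \<longrightarrow> 0 < p z \<and> p z \<le> a \<and> b \<le> q z)"

text \<open>Under a martingale coupling the last term of the gap has mean zero, and the two terms in \<open>\<beta>\<close>
  depend on the marginals only; so a nonnegative gap bounds the crossing probability from below, with
  equality iff the gap vanishes almost surely.\<close>
definition gap ::
    "real \<Rightarrow> real \<Rightarrow> (real \<Rightarrow> real) \<Rightarrow> real set \<Rightarrow> real \<times> real \<Rightarrow> real" where
  "gap z \<kappa> \<beta> A \<omega> =
     \<kappa> * indicator {\<omega>. snd \<omega> \<le> z \<and> z < fst \<omega>} \<omega> - \<beta> (snd \<omega>) + \<beta> (fst \<omega>)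
       + indicator A (fst \<omega>) * (snd \<omega> - fst \<omega>)"

lemma gap_exists:
  assumes "hk_params a b p q" "0 < z"
  obtains \<kappa> \<beta> A B where "0 < \<kappa>" "\<beta> \<in> borel_measurable borel" "A \<in> sets borel"
    "\<And>x. 0 < x \<Longrightarrow> \<bar>\<beta> x\<bar> \<le> B"
    "\<And>\<omega>. 0 < fst \<omega> \<Longrightarrow> 0 < snd \<omega> \<Longrightarrow> 0 \<le> gap z \<kappa> \<beta> A \<omega>"
    "\<And>\<omega>. 0 < fst \<omega> \<Longrightarrow> 0 < snd \<omega> \<Longrightarrow> fst \<omega> \<notin> {p z, z, q z} \<Longrightarrow> snd \<omega> \<notin> {p z, z, q z} \<Longrightarrow>
      gap z \<kappa> \<beta> A \<omega> = 0 \<longleftrightarrow> hk_pattern a b p q z \<omega>"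
proof -
  consider "z \<le> a" | "b \<le> z" | "a < z" "z < b" by linarith
  then show thesis
  proof cases
    case 1
    show thesis
    \<comment> \<open>With this choice the gap is the indicator of an upward crossing,
      \<open>fst \<omega> \<le> z\<close> and \<open>z < snd \<omega>\<close>.\<close>
    proof (rule that[of 1 "indicator {..z}" "{}" 1])
      fix \<omega> :: "real \<times> real"
      show "0 \<le> gap z 1 (indicator {..z}) {} \<omega>"
        by (auto simp: gap_def indicator_def)
      show "gap z 1 (indicator {..z}) {} \<omega> = 0 \<longleftrightarrow> hk_pattern a b p q z \<omega>"
        if "fst \<omega> \<notin> {p z, z, q z}" "snd \<omega> \<notin> {p z, z, q z}"
        using that 1 by (auto simp: gap_def hk_pattern_def indicator_def)
    qed (auto simp: indicator_def)
  next
    case 2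
    then have za: "\<not> z \<le> a" using assms by (auto simp: hk_params_def)
    show thesis
    \<comment> \<open>Here the gap is the indicator of the downward crossing itself, so the minimum
      is 0.\<close>
    proof (rule that[of 1 "\<lambda>_. 0" "{}" 0])
      fix \<omega> :: "real \<times> real"
      show "0 \<le> gap z 1 (\<lambda>_. 0) {} \<omega>"
        by (auto simp: gap_def indicator_def)
      show "gap z 1 (\<lambda>_. 0) {} \<omega> = 0 \<longleftrightarrow> hk_pattern a b p q z \<omega>"
        if "fst \<omega> \<notin> {p z, z, q z}" "snd \<omega> \<notin> {p z, z, q z}"
        using that 2 za by (auto simp: gap_def hk_pattern_def indicator_def)
    qed auto
  next
    case 3
    define p0 q0 where "p0 = p z" and "q0 = q z"
    have pq: "0 < p0" "p0 < z" "z < q0" using 3 assms by (auto simp: hk_params_def p0_def q0_def)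
    \<comment> \<open>On each of the four cells cut out by \<open>p0\<close>, \<open>z\<close>,
      \<open>q0\<close> the function has slope 1 or 0, and \<open>A\<close> collects the cells of
      slope 1. Hence \<open>\<beta> x + indicator A x * (y - x)\<close> is the affine piece at
      \<open>x\<close> evaluated at \<open>y\<close>, and the gap measures its height above
      \<open>\<beta> y\<close>, corrected by the crossing term.\<close>
    define \<beta> where "\<beta> y = (if y \<le> z then min 0 (y - p0) else min 0 (y - q0))" for y
    define A where "A = {..<p0} \<union> {z<..<q0}"
    have J: "hk_pattern a b p q z \<omega> \<longleftrightarrow> hk_jump p0 z q0 \<omega>" for \<omega>
      using 3 by (auto simp: hk_pattern_def p0_def q0_def)
    show thesis
    \<comment> \<open>The factor \<open>q0 - p0\<close> is the distance between the two lines of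
      slope 1, so the gap vanishes exactly on jumps from \<open>(z, q0)\<close> to
      \<open>(0, p0)\<close>. The bound \<open>q0\<close> holds on positive arguments and yields
      integrability.\<close>
    proof (rule that[of "q0 - p0" \<beta> A "q0"])
      show "\<beta> \<in> borel_measurable borel" unfolding \<beta>_def[abs_def] by measurable
      show "A \<in> sets borel" unfolding A_def by simp
      show "\<bar>\<beta> x\<bar> \<le> q0" if "0 < x" for x using that pq by (auto simp: \<beta>_def min_def)
      show "0 < q0 - p0" using pq by simp
    next
      fix \<omega> :: "real \<times> real"
      define x y where "x = fst \<omega>" and "y = snd \<omega>"
      have x: "x < p0 \<and> \<beta> x = x - p0 \<and> indicator A x = (1 :: real) \<or>
          p0 \<le> x \<and> x \<le> z \<and> \<beta> x = 0 \<and> indicator A x = (0 :: real) \<or>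
          z < x \<and> x < q0 \<and> \<beta> x = x - q0 \<and> indicator A x = (1 :: real) \<or>
          q0 \<le> x \<and> \<beta> x = 0 \<and> indicator A x = (0 :: real)"
        using pq by (auto simp: \<beta>_def A_def indicator_def)
      have y: "y < p0 \<and> \<beta> y = y - p0 \<or> p0 \<le> y \<and> y \<le> z \<and> \<beta> y = 0 \<or>
          z < y \<and> y < q0 \<and> \<beta> y = y - q0 \<or> q0 \<le> y \<and> \<beta> y = 0"
        using pq by (auto simp: \<beta>_def)
      have gap: "gap z (q0 - p0) \<beta> A \<omega> =
          (if y \<le> z \<and> z < x then q0 - p0 else 0) - \<beta> y + \<beta> x + indicator A x * (y - x)"
        by (simp add: gap_def x_def y_def)
      show "0 \<le> gap z (q0 - p0) \<beta> A \<omega>"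
        unfolding gap using x y pq by (elim disjE conjE; simp)
      show "gap z (q0 - p0) \<beta> A \<omega> = 0 \<longleftrightarrow> hk_pattern a b p q z \<omega>"
        if "fst \<omega> \<notin> {p z, z, q z}" "snd \<omega> \<notin> {p z, z, q z}"
      proof -
        have ne: "x \<noteq> p0" "x \<noteq> z" "x \<noteq> q0" "y \<noteq> p0" "y \<noteq> z" "y \<noteq> q0"
          using that by (auto simp: p0_def q0_def x_def y_def)
        have x': "x < p0 \<and> \<beta> x = x - p0 \<and> indicator A x = (1 :: real) \<or>
            p0 < x \<and> x < z \<and> \<beta> x = 0 \<and> indicator A x = (0 :: real) \<or>
            z < x \<and> x < q0 \<and> \<beta> x = x - q0 \<and> indicator A x = (1 :: real) \<or>
            q0 < x \<and> \<beta> x = 0 \<and> indicator A x = (0 :: real)"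
          using x ne(1-3) by (metis le_less)
        have y': "y < p0 \<and> \<beta> y = y - p0 \<or> p0 < y \<and> y < z \<and> \<beta> y = 0 \<or>
            z < y \<and> y < q0 \<and> \<beta> y = y - q0 \<or> q0 < y \<and> \<beta> y = 0"
          using y ne(4-6) by (metis le_less)
        show ?thesis
          unfolding J hk_jump_def gap unfolding x_def[symmetric] y_def[symmetric] using x' y' pq
          by (elim disjE conjE; simp)
      qed
    qed
  qed
qed

section \<open>Crossing probabilities of a single coupling\<close>

locale atomless_coupling =
  fixes \<mu> \<nu> :: "real measure" and Q :: "(real \<times> real) measure"
  assumes \<mu>: "\<mu> \<in> P1" and \<nu>: "\<nu> \<in> P1" and Q: "Q \<in> martingale_couplings \<mu> \<nu>"
    and \<mu>_atomless: "\<And>x. 0 < x \<Longrightarrow> emeasure \<mu> {x} = 0"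
    and \<nu>_atomless: "\<And>x. 0 < x \<Longrightarrow> emeasure \<nu> {x} = 0"
begin

lemma Q_sets: "sets Q = sets quadrant"
  and Q_fst: "distr Q half_line fst = \<mu>" and Q_snd: "distr Q half_line snd = \<nu>"
  and Q_mean: "reproduces_mean Q"
  using Q martingale_couplings_iff[OF \<mu> \<nu>] by auto

sublocale prob_space Q
  using Q martingale_couplings_iff[OF \<mu> \<nu>] by auto

lemmas Q_meas [measurable] = quadrant_measurable(3,4)[OF Q_sets]
lemmas Q_meas' = quadrant_measurable(1,2)[OF Q_sets]
lemmas Q_int = coupling_integrals(1,2)[OF \<mu> \<nu> Q_sets Q_fst Q_snd]
lemmas Q_pos = quadrant_pos[OF Q_sets]

lemma mean_zero:
  assumes A: "A \<in> sets borel"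
  shows "integrable Q (\<lambda>\<omega>. indicator A (fst \<omega>) * (snd \<omega> - fst \<omega>))"
    "(\<integral>\<omega>. indicator A (fst \<omega>) * (snd \<omega> - fst \<omega>) \<partial>Q) = 0"
proof -
  have S: "fst -` A \<inter> space Q \<in> sets Q" using A by measurable
  have int: "integrable Q (\<lambda>\<omega>. indicator A (fst \<omega>) * g \<omega>)" if "integrable Q g" for g :: "real \<times> real \<Rightarrow> real"
  proof -
    have "integrable Q (\<lambda>\<omega>. indicator (fst -` A \<inter> space Q) \<omega> *\<^sub>R g \<omega>)"
      using that S by (intro integrable_mult_indicator)
    then show ?thesis
      by (rule Bochner_Integration.integrable_cong[THEN iffD1, rotated -1]) (auto simp: indicator_def)
  qed
  have "(\<integral>\<^sup>+\<omega>. ennreal (snd \<omega>) * indicator A (fst \<omega>) \<partial>Q) =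
      (\<integral>\<^sup>+\<omega>. ennreal (fst \<omega>) * indicator A (fst \<omega>) \<partial>Q)"
    using A by (intro reproduces_meanD[OF Q_sets _ Q_mean] measurable_restrict_space1) simp
  moreover have "(\<integral>\<^sup>+\<omega>. ennreal (g \<omega>) * indicator A (fst \<omega>) \<partial>Q)
      = ennreal (\<integral>\<omega>. indicator A (fst \<omega>) * g \<omega> \<partial>Q) \<and> 0 \<le> (\<integral>\<omega>. indicator A (fst \<omega>) * g \<omega> \<partial>Q)"
    if g: "integrable Q g" "\<And>\<omega>. \<omega> \<in> space Q \<Longrightarrow> 0 < g \<omega>" for g :: "real \<times> real \<Rightarrow> real"
  proof
    have "(\<integral>\<^sup>+\<omega>. ennreal (g \<omega>) * indicator A (fst \<omega>) \<partial>Q) = (\<integral>\<^sup>+\<omega>. ennreal (indicator A (fst \<omega>) * g \<omega>) \<partial>Q)"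
      by (intro nn_integral_cong) (auto simp: indicator_def)
    then show "(\<integral>\<^sup>+\<omega>. ennreal (g \<omega>) * indicator A (fst \<omega>) \<partial>Q)
      = ennreal (\<integral>\<omega>. indicator A (fst \<omega>) * g \<omega> \<partial>Q)"
      using int[OF g(1)] g(2)
      by (simp add: nn_integral_eq_integral less_imp_le AE_I2)
    show "0 \<le> (\<integral>\<omega>. indicator A (fst \<omega>) * g \<omega> \<partial>Q)"
      using g(2) by (intro Bochner_Integration.integral_nonneg) (simp add: less_imp_le)
  qed
  note * = this[OF Q_int(1) Q_pos(1)] this[OF Q_int(2) Q_pos(2)]
  ultimately have e: "(\<integral>\<omega>. indicator A (fst \<omega>) * snd \<omega> \<partial>Q) = (\<integral>\<omega>. indicator A (fst \<omega>) * fst \<omega> \<partial>Q)"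
    using * by simp
  show "integrable Q (\<lambda>\<omega>. indicator A (fst \<omega>) * (snd \<omega> - fst \<omega>))"
    using int[OF Q_int(1)] int[OF Q_int(2)] by (simp add: algebra_simps)
  show "(\<integral>\<omega>. indicator A (fst \<omega>) * (snd \<omega> - fst \<omega>) \<partial>Q) = 0"
    using int[OF Q_int(1)] int[OF Q_int(2)] e by (simp add: algebra_simps)
qed

lemma AE_ne: "AE \<omega> in Q. fst \<omega> \<noteq> c" "AE \<omega> in Q. snd \<omega> \<noteq> c"
proof -
  have at: "AE x in M. x \<noteq> c" if M: "sets M = sets half_line" "\<And>x. 0 < x \<Longrightarrow> emeasure M {x} = 0"
    for M :: "real measure"
  proof (cases "0 < c")
    case True
    have "{c} \<in> null_sets M"
      using M True by (auto simp: null_sets_def sets_half_line_iff)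
    then show ?thesis by (rule AE_I'[where N="{c}"]) auto
  next
    case False
    then show ?thesis using space_eq_half_line[OF M(1)] by (intro AE_I2) auto
  qed
  have p: "{x \<in> space half_line. x \<noteq> c} \<in> sets half_line"
  proof -
    have "{x \<in> space half_line. x \<noteq> c} = {0<..} - {c}" by (auto simp: space_restrict_space)
    then show ?thesis by (auto simp: sets_half_line_iff)
  qed
  have "AE x in distr Q half_line fst. x \<noteq> c"
    using at[OF P1D(2)[OF \<mu>] \<mu>_atomless] unfolding Q_fst .
  then show "AE \<omega> in Q. fst \<omega> \<noteq> c" using AE_distr_iff[OF Q_meas'(1) p] by simp
  have "AE x in distr Q half_line snd. x \<noteq> c"
    using at[OF P1D(2)[OF \<nu>] \<nu>_atomless] unfolding Q_snd .
  then show "AE \<omega> in Q. snd \<omega> \<noteq> c" using AE_distr_iff[OF Q_meas'(2) p] by simp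
qed

lemma prob_fst_le: "measure Q {\<omega> \<in> space Q. fst \<omega> \<le> z} = F_cdf \<mu> z"
proof -
  have "{\<omega> \<in> space Q. fst \<omega> \<le> z} = fst -` {0<..z} \<inter> space Q" using Q_pos by auto
  moreover have "{0<..z} \<in> sets half_line" by (auto simp: sets_half_line_iff)
  ultimately show ?thesis
    using Q_meas'(1) unfolding F_cdf_def Q_fst[symmetric] by (simp add: measure_distr)
qed

lemma prob_snd_le: "measure Q {\<omega> \<in> space Q. snd \<omega> \<le> z} = F_cdf \<nu> z"
proof -
  have "{\<omega> \<in> space Q. snd \<omega> \<le> z} = snd -` {0<..z} \<inter> space Q" using Q_pos by auto
  moreover have "{0<..z} \<in> sets half_line" by (auto simp: sets_half_line_iff)
  ultimately show ?thesis
    using Q_meas'(2) unfolding F_cdf_def Q_snd[symmetric] by (simp add: measure_distr)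
qed

lemma prob_split:
  assumes "{\<omega> \<in> space Q. P \<omega>} \<in> sets Q" "{\<omega> \<in> space Q. R \<omega>} \<in> sets Q"
  shows "measure Q {\<omega> \<in> space Q. P \<omega>} =
    measure Q {\<omega> \<in> space Q. P \<omega> \<and> R \<omega>} + measure Q {\<omega> \<in> space Q. P \<omega> \<and> \<not> R \<omega>}"
proof -
  let ?A = "{\<omega> \<in> space Q. P \<omega>}" and ?B = "{\<omega> \<in> space Q. R \<omega>}"
  have "measure Q ?A = measure Q (?A \<inter> ?B) + measure Q (?A - ?B)"
    using assms by (subst finite_measure_Union[symmetric]) (auto intro!: arg_cong[of _ _ "measure Q"])
  moreover have "?A \<inter> ?B = {\<omega> \<in> space Q. P \<omega> \<and> R \<omega>}" "?A - ?B = {\<omega> \<in> space Q. P \<omega> \<and> \<not> R \<omega>}" by auto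
  ultimately show ?thesis by simp
qed

lemma prob_cong:
  assumes "AE \<omega> in Q. P \<omega> \<longleftrightarrow> R \<omega>"
    and "{\<omega> \<in> space Q. P \<omega>} \<in> sets Q" "{\<omega> \<in> space Q. R \<omega>} \<in> sets Q"
  shows "measure Q {\<omega> \<in> space Q. P \<omega>} = measure Q {\<omega> \<in> space Q. R \<omega>}"
  using assms by (intro finite_measure_eq_AE) auto

definition crossing :: "real \<Rightarrow> real" where
  "crossing z = measure Q {\<omega> \<in> space Q. snd \<omega> \<le> z \<and> z < fst \<omega>}"

text \<open>The net flow through level \<open>z\<close> is fixed by the marginals: both crossing
  events are what remains of \<open>fst \<omega> \<le> z\<close> and
  \<open>snd \<omega> \<le> z\<close> once their common part is removed.\<close>

lemma up_crossing:
  "measure Q {\<omega> \<in> space Q. fst \<omega> \<le> z \<and> z < snd \<omega>} = crossing z - delta_F \<mu> \<nu> z"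
proof -
  have "F_cdf \<mu> z = measure Q {\<omega> \<in> space Q. fst \<omega> \<le> z \<and> snd \<omega> \<le> z} +
      measure Q {\<omega> \<in> space Q. fst \<omega> \<le> z \<and> \<not> snd \<omega> \<le> z}"
    unfolding prob_fst_le[symmetric] by (rule prob_split) measurable
  moreover have "F_cdf \<nu> z = measure Q {\<omega> \<in> space Q. snd \<omega> \<le> z \<and> fst \<omega> \<le> z} +
      measure Q {\<omega> \<in> space Q. snd \<omega> \<le> z \<and> \<not> fst \<omega> \<le> z}"
    unfolding prob_snd_le[symmetric] by (rule prob_split) measurable
  ultimately show ?thesis
    by (simp add: crossing_def delta_F_def not_le conj_commute)
qed

lemma cost_eq:
  "(\<integral>\<^sup>+\<omega>. ennreal \<bar>snd \<omega> - fst \<omega>\<bar> \<partial>Q) =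
   (\<integral>\<^sup>+z. ennreal (2 * crossing z - delta_F \<mu> \<nu> z) \<partial>lborel)"
proof -
  interpret L: pair_sigma_finite Q lborel by standard
  let ?D = "\<lambda>\<omega> z. snd \<omega> \<le> z \<and> z < fst \<omega> \<or> fst \<omega> \<le> z \<and> z < (snd \<omega> :: real)"
  let ?f = "\<lambda>(\<omega>, z). indicator {(\<omega>, z). ?D \<omega> z} (\<omega>, z) :: ennreal"
  have m: "?f \<in> borel_measurable (Q \<Otimes>\<^sub>M lborel)"
  proof -
    have "{x \<in> space (Q \<Otimes>\<^sub>M lborel). ?D (fst x) (snd x)} \<in> sets (Q \<Otimes>\<^sub>M lborel)" by measurable
    also have "{x \<in> space (Q \<Otimes>\<^sub>M lborel). ?D (fst x) (snd x)} =
        {(\<omega>, z). ?D \<omega> z} \<inter> space (Q \<Otimes>\<^sub>M lborel)" by auto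
    finally show ?thesis
      unfolding case_prod_beta' prod.collapse by (simp only: borel_measurable_indicator_iff)
  qed
  have "(\<integral>\<^sup>+\<omega>. ennreal \<bar>snd \<omega> - fst \<omega>\<bar> \<partial>Q) = (\<integral>\<^sup>+\<omega>. (\<integral>\<^sup>+z. ?f (\<omega>, z) \<partial>lborel) \<partial>Q)"
  proof (rule nn_integral_cong)
    fix \<omega> :: "real \<times> real"
    \<comment> \<open>The distance of the coordinates is the length of the set of levels that
      separate them.\<close>
    have "(\<integral>\<^sup>+z. ?f (\<omega>, z) \<partial>lborel) =
        (\<integral>\<^sup>+z. indicator {min (fst \<omega>) (snd \<omega>)..<max (fst \<omega>) (snd \<omega>)} z \<partial>lborel)"
      by (intro nn_integral_cong) (auto simp: indicator_def min_def max_def)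
    then show "ennreal \<bar>snd \<omega> - fst \<omega>\<bar> = (\<integral>\<^sup>+z. ?f (\<omega>, z) \<partial>lborel)"
      by (auto simp: min_def max_def)
  qed
  also have "\<dots> = (\<integral>\<^sup>+z. (\<integral>\<^sup>+\<omega>. ?f (\<omega>, z) \<partial>Q) \<partial>lborel)"
    using L.Fubini[OF m] by simp
  also have "\<dots> = (\<integral>\<^sup>+z. ennreal (2 * crossing z - delta_F \<mu> \<nu> z) \<partial>lborel)"
  proof (rule nn_integral_cong)
    fix z :: real
    have "(\<integral>\<^sup>+\<omega>. ?f (\<omega>, z) \<partial>Q) = (\<integral>\<^sup>+\<omega>. indicator {\<omega> \<in> space Q. ?D \<omega> z} \<omega> \<partial>Q)"
      by (intro nn_integral_cong) (auto simp: indicator_def)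
    also have "\<dots> = ennreal (measure Q {\<omega> \<in> space Q. ?D \<omega> z})"
      by (simp add: emeasure_eq_measure)
    also have "measure Q {\<omega> \<in> space Q. ?D \<omega> z} =
        measure Q {\<omega> \<in> space Q. ?D \<omega> z \<and> snd \<omega> \<le> z} + measure Q {\<omega> \<in> space Q. ?D \<omega> z \<and> \<not> snd \<omega> \<le> z}"
      by (rule prob_split) measurable
    also have "{\<omega> \<in> space Q. ?D \<omega> z \<and> snd \<omega> \<le> z} = {\<omega> \<in> space Q. snd \<omega> \<le> z \<and> z < fst \<omega>}" by auto
    also have "{\<omega> \<in> space Q. ?D \<omega> z \<and> \<not> snd \<omega> \<le> z} = {\<omega> \<in> space Q. fst \<omega> \<le> z \<and> z < snd \<omega>}" by auto
    finally show "(\<integral>\<^sup>+\<omega>. ?f (\<omega>, z) \<partial>Q) = ennreal (2 * crossing z - delta_F \<mu> \<nu> z)"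
      by (simp add: up_crossing crossing_def[symmetric])
  qed
  finally show ?thesis .
qed

lemma cost_finite: "(\<integral>\<^sup>+\<omega>. ennreal \<bar>snd \<omega> - fst \<omega>\<bar> \<partial>Q) < \<infinity>"
proof -
  have "(\<integral>\<^sup>+\<omega>. ennreal \<bar>snd \<omega> - fst \<omega>\<bar> \<partial>Q) \<le> (\<integral>\<^sup>+\<omega>. ennreal (snd \<omega>) + ennreal (fst \<omega>) \<partial>Q)"
  proof (rule nn_integral_mono)
    fix \<omega> assume "\<omega> \<in> space Q"
    then have "0 < fst \<omega>" "0 < snd \<omega>" by (rule Q_pos)+
    then show "ennreal \<bar>snd \<omega> - fst \<omega>\<bar> \<le> ennreal (snd \<omega>) + ennreal (fst \<omega>)"
      by (subst ennreal_plus[symmetric]) (simp_all add: less_imp_le ennreal_leI del: ennreal_plus)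
  qed
  also have "\<dots> = 2"
    using coupling_integrals(3,4)[OF \<mu> \<nu> Q_sets Q_fst Q_snd]
    by (subst nn_integral_add) (auto simp: one_add_one)
  finally show ?thesis by (simp add: order_le_less_trans)
qed

lemma integral_gap:
  assumes "\<beta> \<in> borel_measurable borel" "A \<in> sets borel" "\<And>x. 0 < x \<Longrightarrow> \<bar>\<beta> x\<bar> \<le> B"
  shows "integrable Q (gap z \<kappa> \<beta> A)"
    "(\<integral>\<omega>. gap z \<kappa> \<beta> A \<omega> \<partial>Q) = \<kappa> * crossing z - (\<integral>y. \<beta> y \<partial>\<nu>) + (\<integral>x. \<beta> x \<partial>\<mu>)"
proof -
  have \<beta>h: "\<beta> \<in> borel_measurable half_line" using assms(1) by (rule measurable_restrict_space1)
  note [measurable] = assms(1)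
  have 1: "integrable Q (\<lambda>\<omega>. \<beta> (fst \<omega>))" "integrable Q (\<lambda>\<omega>. \<beta> (snd \<omega>))"
    using assms(3) Q_pos by (auto intro!: integrable_const_bound[where B=B] AE_I2)
  let ?C = "{\<omega> \<in> space Q. snd \<omega> \<le> z \<and> z < fst \<omega>}"
  have C: "?C \<in> sets Q" by measurable
  have 2: "integrable Q (indicator ?C :: _ \<Rightarrow> real)"
    using C emeasure_finite[of ?C] by (intro integrable_real_indicator) (auto simp only: less_top infinity_ennreal_def)
  have g: "gap z \<kappa> \<beta> A \<omega> = \<kappa> * indicator ?C \<omega> - \<beta> (snd \<omega>) + \<beta> (fst \<omega>)
      + indicator A (fst \<omega>) * (snd \<omega> - fst \<omega>)" if "\<omega> \<in> space Q" for \<omega>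
    using that by (auto simp: gap_def indicator_def)
  have "integrable Q (\<lambda>\<omega>. \<kappa> * indicator ?C \<omega> - \<beta> (snd \<omega>) + \<beta> (fst \<omega>)
      + indicator A (fst \<omega>) * (snd \<omega> - fst \<omega>))"
    using 1 2 mean_zero[OF assms(2)] by simp
  then show "integrable Q (gap z \<kappa> \<beta> A)"
    by (rule Bochner_Integration.integrable_cong[THEN iffD1, rotated -1]) (simp_all add: g)
  have "(\<integral>\<omega>. gap z \<kappa> \<beta> A \<omega> \<partial>Q) = (\<integral>\<omega>. \<kappa> * indicator ?C \<omega> - \<beta> (snd \<omega>) + \<beta> (fst \<omega>)
      + indicator A (fst \<omega>) * (snd \<omega> - fst \<omega>) \<partial>Q)"
    by (intro Bochner_Integration.integral_cong) (simp_all add: g)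
  also have "\<dots> = \<kappa> * crossing z - (\<integral>\<omega>. \<beta> (snd \<omega>) \<partial>Q) + (\<integral>\<omega>. \<beta> (fst \<omega>) \<partial>Q)"
    using 1 2 mean_zero[OF assms(2)] C by (simp add: crossing_def)
  also have "(\<integral>\<omega>. \<beta> (snd \<omega>) \<partial>Q) = (\<integral>y. \<beta> y \<partial>\<nu>)"
    unfolding Q_snd[symmetric] by (rule integral_distr[OF Q_meas'(2) \<beta>h, symmetric])
  also have "(\<integral>\<omega>. \<beta> (fst \<omega>) \<partial>Q) = (\<integral>y. \<beta> y \<partial>\<mu>)"
    unfolding Q_fst[symmetric] by (rule integral_distr[OF Q_meas'(1) \<beta>h, symmetric])
  finally show "(\<integral>\<omega>. gap z \<kappa> \<beta> A \<omega> \<partial>Q) = \<kappa> * crossing z - (\<integral>y. \<beta> y \<partial>\<nu>) + (\<integral>x. \<beta> x \<partial>\<mu>)" .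
qed

lemma F_cdf_cont: "isCont (F_cdf \<mu>) z" "isCont (F_cdf \<nu>) z"
proof -
  show "isCont (F_cdf \<mu>) z"
    using P1D[OF \<mu>] \<mu>_atomless by (intro isCont_F_cdf prob_space.finite_measure)
  show "isCont (F_cdf \<nu>) z"
    using P1D[OF \<nu>] \<nu>_atomless by (intro isCont_F_cdf prob_space.finite_measure)
qed

text \<open>The crossing events at \<open>z\<close> and \<open>z'\<close> can differ only if a
  coordinate lies between the two levels. This bounds the oscillation by the increments of the
  marginal distribution functions and gives continuity.\<close>

lemma crossing_diff:
  assumes "z \<le> z'"
  shows "\<bar>crossing z' - crossing z\<bar> \<le>
    (F_cdf \<mu> z' - F_cdf \<mu> z) + (F_cdf \<nu> z' - F_cdf \<nu> z)"
proof -
  have \<mu>': "measure Q {\<omega> \<in> space Q. fst \<omega> \<le> z' \<and> \<not> fst \<omega> \<le> z} = F_cdf \<mu> z' - F_cdf \<mu> z"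
  proof -
    have "F_cdf \<mu> z' = measure Q {\<omega> \<in> space Q. fst \<omega> \<le> z' \<and> fst \<omega> \<le> z} +
        measure Q {\<omega> \<in> space Q. fst \<omega> \<le> z' \<and> \<not> fst \<omega> \<le> z}"
      unfolding prob_fst_le[symmetric] by (rule prob_split) measurable
    moreover have "{\<omega> \<in> space Q. fst \<omega> \<le> z' \<and> fst \<omega> \<le> z} = {\<omega> \<in> space Q. fst \<omega> \<le> z}" using assms by auto
    ultimately show ?thesis using prob_fst_le by simp
  qed
  have \<nu>': "measure Q {\<omega> \<in> space Q. snd \<omega> \<le> z' \<and> \<not> snd \<omega> \<le> z} = F_cdf \<nu> z' - F_cdf \<nu> z"
  proof -
    have "F_cdf \<nu> z' = measure Q {\<omega> \<in> space Q. snd \<omega> \<le> z' \<and> snd \<omega> \<le> z} +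
        measure Q {\<omega> \<in> space Q. snd \<omega> \<le> z' \<and> \<not> snd \<omega> \<le> z}"
      unfolding prob_snd_le[symmetric] by (rule prob_split) measurable
    moreover have "{\<omega> \<in> space Q. snd \<omega> \<le> z' \<and> snd \<omega> \<le> z} = {\<omega> \<in> space Q. snd \<omega> \<le> z}" using assms by auto
    ultimately show ?thesis using prob_snd_le by simp
  qed
  have "crossing z' \<le> measure Q ({\<omega> \<in> space Q. snd \<omega> \<le> z \<and> z < fst \<omega>} \<union> {\<omega> \<in> space Q. snd \<omega> \<le> z' \<and> \<not> snd \<omega> \<le> z})"
    unfolding crossing_def using assms by (intro finite_measure_mono) auto
  also have "\<dots> \<le> crossing z + (F_cdf \<nu> z' - F_cdf \<nu> z)"
    unfolding crossing_def \<nu>'[symmetric] by (intro measure_Un_le) measurable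
  finally have 1: "crossing z' \<le> crossing z + (F_cdf \<nu> z' - F_cdf \<nu> z)" .
  have "crossing z \<le> measure Q ({\<omega> \<in> space Q. snd \<omega> \<le> z' \<and> z' < fst \<omega>} \<union> {\<omega> \<in> space Q. fst \<omega> \<le> z' \<and> \<not> fst \<omega> \<le> z})"
    unfolding crossing_def using assms by (intro finite_measure_mono) auto
  also have "\<dots> \<le> crossing z' + (F_cdf \<mu> z' - F_cdf \<mu> z)"
    unfolding crossing_def \<mu>'[symmetric] by (intro measure_Un_le) measurable
  finally have 2: "crossing z \<le> crossing z' + (F_cdf \<mu> z' - F_cdf \<mu> z)" .
  have "0 \<le> F_cdf \<mu> z' - F_cdf \<mu> z" "0 \<le> F_cdf \<nu> z' - F_cdf \<nu> z"
    unfolding \<mu>'[symmetric] \<nu>'[symmetric] by simp_all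
  with 1 2 show ?thesis by linarith
qed

lemma crossing_cont: "isCont crossing z"
proof -
  let ?b = "\<lambda>w. \<bar>F_cdf \<mu> w - F_cdf \<mu> z\<bar> + \<bar>F_cdf \<nu> w - F_cdf \<nu> z\<bar>"
  have n: "norm (crossing w - crossing z) \<le> ?b w" for w
    using crossing_diff[of w z] crossing_diff[of z w] by (cases "w \<le> z") auto
  have "(?b \<longlongrightarrow> \<bar>F_cdf \<mu> z - F_cdf \<mu> z\<bar> + \<bar>F_cdf \<nu> z - F_cdf \<nu> z\<bar>) (at z)"
    using F_cdf_cont[of z] unfolding isCont_def by (intro tendsto_intros)
  then have "(?b \<longlongrightarrow> 0) (at z)" by simp
  then have "((\<lambda>w. crossing w - crossing z) \<longlongrightarrow> 0) (at z)"
    by (rule Lim_null_comparison[rotated]) (use n in simp)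
  then show ?thesis unfolding isCont_def by (rule LIM_zero_cancel)
qed

text \<open>The exceptional null set may depend on \<open>z\<close>: optimality is decided level by
  level, and this order of quantifiers is what such an argument delivers.\<close>

definition structured :: "real \<Rightarrow> real \<Rightarrow> (real \<Rightarrow> real) \<Rightarrow> (real \<Rightarrow> real) \<Rightarrow> bool" where
  "structured a b p q \<longleftrightarrow> (\<forall>z>0. AE \<omega> in Q. hk_pattern a b p q z \<omega>)"

end

section \<open>Comparison of two couplings with the same marginals\<close>

lemma structured_crossing_minimal:
  assumes "atomless_coupling \<mu> \<nu> Q" "atomless_coupling \<mu> \<nu> Q'"
    and pq: "hk_params a b p q" and s: "AE \<omega> in Q. hk_pattern a b p q z \<omega>" and z: "0 < z"
  shows "atomless_coupling.crossing Q z \<le> atomless_coupling.crossing Q' z"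
    and "atomless_coupling.crossing Q' z = atomless_coupling.crossing Q z \<Longrightarrow>
      AE \<omega> in Q'. hk_pattern a b p q z \<omega>"
proof -
  interpret A: atomless_coupling \<mu> \<nu> Q by fact
  interpret B: atomless_coupling \<mu> \<nu> Q' by fact
  obtain \<kappa> \<beta> A B where g: "0 < \<kappa>" "\<beta> \<in> borel_measurable borel" "A \<in> sets borel"
    "\<And>x. 0 < x \<Longrightarrow> \<bar>\<beta> x\<bar> \<le> B"
    "\<And>\<omega>. 0 < fst \<omega> \<Longrightarrow> 0 < snd \<omega> \<Longrightarrow> 0 \<le> gap z \<kappa> \<beta> A \<omega>"
    "\<And>\<omega>. 0 < fst \<omega> \<Longrightarrow> 0 < snd \<omega> \<Longrightarrow> fst \<omega> \<notin> {p z, z, q z} \<Longrightarrow> snd \<omega> \<notin> {p z, z, q z} \<Longrightarrow>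
      gap z \<kappa> \<beta> A \<omega> = 0 \<longleftrightarrow> hk_pattern a b p q z \<omega>"
    using gap_exists[OF pq z] by metis
  have generic: "AE \<omega> in Q. fst \<omega> \<notin> {p z, z, q z} \<and> snd \<omega> \<notin> {p z, z, q z}"
    "AE \<omega> in Q'. fst \<omega> \<notin> {p z, z, q z} \<and> snd \<omega> \<notin> {p z, z, q z}"
    using A.AE_ne[of "p z"] A.AE_ne[of z] A.AE_ne[of "q z"] B.AE_ne[of "p z"] B.AE_ne[of z] B.AE_ne[of "q z"]
    by (auto elim!: eventually_elim2)
  have "AE \<omega> in Q. gap z \<kappa> \<beta> A \<omega> = 0"
    using s generic(1) AE_space by eventually_elim (use g(6) A.Q_pos in blast)
  then have "(\<integral>\<omega>. gap z \<kappa> \<beta> A \<omega> \<partial>Q) = 0"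
    using integral_eq_zero_AE by blast
  \<comment> \<open>The two integrals of \<open>\<beta>\<close> are shared by all couplings, so
    vanishing of the mean gap for one and nonnegativity for the other compare the crossing
    probabilities. In case of equality a nonnegative gap of mean zero vanishes almost
    surely.\<close>
  then have A0: "\<kappa> * A.crossing z - (\<integral>y. \<beta> y \<partial>\<nu>) + (\<integral>x. \<beta> x \<partial>\<mu>) = 0"
    using A.integral_gap(2)[OF g(2,3,4)] by simp
  have nn: "AE \<omega> in Q'. 0 \<le> gap z \<kappa> \<beta> A \<omega>"
    using g(5) B.Q_pos by (intro AE_I2) auto
  then have "0 \<le> (\<integral>\<omega>. gap z \<kappa> \<beta> A \<omega> \<partial>Q')" by (rule integral_nonneg_AE)
  then have "0 \<le> \<kappa> * B.crossing z - (\<integral>y. \<beta> y \<partial>\<nu>) + (\<integral>x. \<beta> x \<partial>\<mu>)"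
    using B.integral_gap(2)[OF g(2,3,4)] by simp
  with A0 have "\<kappa> * A.crossing z \<le> \<kappa> * B.crossing z" by linarith
  then show "A.crossing z \<le> B.crossing z" using g(1) by simp
  assume "B.crossing z = A.crossing z"
  then have "(\<integral>\<omega>. gap z \<kappa> \<beta> A \<omega> \<partial>Q') = 0"
    using A0 B.integral_gap(2)[OF g(2,3,4)] by simp
  then have "AE \<omega> in Q'. gap z \<kappa> \<beta> A \<omega> = 0"
    using integral_nonneg_eq_0_iff_AE[OF B.integral_gap(1)[OF g(2,3,4)] nn] by simp
  then show "AE \<omega> in Q'. hk_pattern a b p q z \<omega>"
    using generic(2) AE_space by eventually_elim (use g(6) B.Q_pos in blast)
qed

text \<open>A disagreement at a point of continuity would persist on an open interval, which has
  positive length.\<close>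

lemma AE_lborel_eq_isCont:
  fixes f g :: "real \<Rightarrow> real"
  assumes ae: "AE z in lborel. f z = g z" and c: "isCont f z" "isCont g z"
  shows "f z = g z"
proof (rule ccontr)
  assume "f z \<noteq> g z"
  then have "\<forall>\<^sub>F w in nhds z. f w - g w \<noteq> 0"
    using c tendsto_diff[of f "f z" "nhds z" g "g z"] tendsto_imp_eventually_ne[of "\<lambda>w. f w - g w" "f z - g z" "nhds z" 0]
    by (simp add: isCont_def tendsto_nhds_iff)
  then obtain e where e: "0 < e" "\<And>w. dist w z < e \<Longrightarrow> f w - g w \<noteq> 0"
    by (auto simp: eventually_nhds_metric)
  have "AE w in lborel. w \<notin> {z - e<..<z + e}"
    using ae by eventually_elim (use e(2) in \<open>force simp: dist_real_def\<close>)
  then have "emeasure lborel {z - e<..<z + e} = 0"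
    by (subst (asm) AE_iff_measurable[where N="{z - e<..<z + e}"]) auto
  then show False using e(1) by simp
qed

lemma structured_optimal:
  assumes A: "atomless_coupling \<mu> \<nu> Q" and B: "atomless_coupling \<mu> \<nu> Q'"
    and pq: "hk_params a b p q" and s: "atomless_coupling.structured Q a b p q"
  shows "(\<integral>\<^sup>+\<omega>. ennreal \<bar>snd \<omega> - fst \<omega>\<bar> \<partial>Q) \<le> (\<integral>\<^sup>+\<omega>. ennreal \<bar>snd \<omega> - fst \<omega>\<bar> \<partial>Q')"
    and "(\<integral>\<^sup>+\<omega>. ennreal \<bar>snd \<omega> - fst \<omega>\<bar> \<partial>Q') = (\<integral>\<^sup>+\<omega>. ennreal \<bar>snd \<omega> - fst \<omega>\<bar> \<partial>Q) \<Longrightarrow>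
      atomless_coupling.structured Q' a b p q"
proof -
  interpret A: atomless_coupling \<mu> \<nu> Q by fact
  interpret B: atomless_coupling \<mu> \<nu> Q' by fact
  have le: "A.crossing z \<le> B.crossing z" for z
  proof (cases "0 < z")
    case True
    then show ?thesis
      using structured_crossing_minimal(1)[OF A B pq _ True] s by (auto simp: A.structured_def)
  next
    case False
    then have "{\<omega> \<in> space Q. snd \<omega> \<le> z \<and> z < fst \<omega>} = {}" using A.Q_pos by force
    then have "A.crossing z = 0" unfolding A.crossing_def by (simp only: measure_empty)
    then show ?thesis by (simp add: B.crossing_def)
  qed
  let ?a = "\<lambda>z. 2 * A.crossing z - delta_F \<mu> \<nu> z" and ?b = "\<lambda>z. 2 * B.crossing z - delta_F \<mu> \<nu> z"
  have c: "isCont (delta_F \<mu> \<nu>) z" for z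
    unfolding delta_F_def[abs_def] by (intro continuous_intros A.F_cdf_cont)
  have ca: "continuous_on UNIV ?a" "continuous_on UNIV ?b"
    using c A.crossing_cont B.crossing_cont by (auto intro!: continuous_at_imp_continuous_on continuous_intros)
  have [measurable]: "?a \<in> borel_measurable borel" "?b \<in> borel_measurable borel"
    using ca by (auto intro: borel_measurable_continuous_onI)
  show "(\<integral>\<^sup>+\<omega>. ennreal \<bar>snd \<omega> - fst \<omega>\<bar> \<partial>Q) \<le> (\<integral>\<^sup>+\<omega>. ennreal \<bar>snd \<omega> - fst \<omega>\<bar> \<partial>Q')"
    unfolding A.cost_eq B.cost_eq using le by (intro nn_integral_mono ennreal_leI) simp
  assume "(\<integral>\<^sup>+\<omega>. ennreal \<bar>snd \<omega> - fst \<omega>\<bar> \<partial>Q') = (\<integral>\<^sup>+\<omega>. ennreal \<bar>snd \<omega> - fst \<omega>\<bar> \<partial>Q)"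
  then have eq: "(\<integral>\<^sup>+z. ennreal (?b z) \<partial>lborel) = (\<integral>\<^sup>+z. ennreal (?a z) \<partial>lborel)"
    unfolding A.cost_eq B.cost_eq .
  have fin: "(\<integral>\<^sup>+z. ennreal (?a z) \<partial>lborel) \<noteq> \<infinity>"
    using A.cost_finite unfolding A.cost_eq by simp
  \<comment> \<open>The integrand is the sum of the downward and the upward crossing probability.
    Its sign matters because \<open>ennreal\<close> would truncate negative values.\<close>
  have a_nn: "0 \<le> ?a z" for z
  proof -
    have "0 \<le> A.crossing z + (A.crossing z - delta_F \<mu> \<nu> z)"
      unfolding A.up_crossing[symmetric] unfolding A.crossing_def by simp
    then show ?thesis by simp
  qed
  \<comment> \<open>Subtraction is legitimate because the cost is finite, the coordinates being
    integrable.\<close>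
  have "(\<integral>\<^sup>+z. ennreal (?b z) - ennreal (?a z) \<partial>lborel) = 0"
    using le fin by (subst nn_integral_diff) (auto simp: eq intro!: AE_I2 ennreal_leI)
  then have "AE z in lborel. ennreal (?b z) - ennreal (?a z) = 0"
    by (subst (asm) nn_integral_0_iff_AE) auto
  then have "AE z in lborel. B.crossing z = A.crossing z"
  proof eventually_elim
    case (elim z)
    then have "ennreal (?b z) \<le> ennreal (?a z)" by (simp add: diff_eq_0_iff_ennreal)
    then have "?b z \<le> ?a z" using a_nn[of z] by (simp add: ennreal_le_iff)
    then show ?case using le[of z] by simp
  qed
  then have "B.crossing z = A.crossing z" for z
    using B.crossing_cont A.crossing_cont by (rule AE_lborel_eq_isCont)
  then show "B.structured a b p q"
    using structured_crossing_minimal(2)[OF A B pq] s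
    by (auto simp: A.structured_def B.structured_def)
qed

section \<open>Uniqueness and invariance under reciprocals\<close>

context atomless_coupling
begin

text \<open>No mass moves upward through any level up to \<open>a\<close>, so
  \<open>snd \<omega> \<le> fst \<omega>\<close> to the left of \<open>a\<close>; a martingale
  increment of one sign on such a set vanishes.\<close>

lemma diagonal_left:
  assumes s: "structured a b p q"
  shows "AE \<omega> in Q. fst \<omega> \<le> a \<longrightarrow> snd \<omega> = fst \<omega>"
proof -
  \<comment> \<open>Rational levels suffice to separate the coordinates and keep the union of null
    sets countable.\<close>
  have "AE \<omega> in Q. 0 < real_of_rat r \<and> real_of_rat r \<le> a \<longrightarrow>
      \<not> (fst \<omega> < real_of_rat r \<and> real_of_rat r < snd \<omega>)" for r
  proof (cases "0 < real_of_rat r \<and> real_of_rat r \<le> a")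
    case True
    then have "AE \<omega> in Q. hk_pattern a b p q (real_of_rat r) \<omega>" using s by (auto simp: structured_def)
    then show ?thesis by eventually_elim (use True in \<open>simp add: hk_pattern_def\<close>)
  qed (auto intro!: AE_I2)
  then have "AE \<omega> in Q. \<forall>r. 0 < real_of_rat r \<and> real_of_rat r \<le> a \<longrightarrow>
      \<not> (fst \<omega> < real_of_rat r \<and> real_of_rat r < snd \<omega>)"
    by (subst AE_all_countable) auto
  then have le: "AE \<omega> in Q. fst \<omega> < a \<longrightarrow> snd \<omega> \<le> fst \<omega>"
    using AE_space
  proof eventually_elim
    case (elim \<omega>)
    show ?case
    proof (rule impI, rule ccontr)
      assume "fst \<omega> < a" "\<not> snd \<omega> \<le> fst \<omega>"
      then obtain r where "fst \<omega> < real_of_rat r" "real_of_rat r < min (snd \<omega>) a"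
        using of_rat_dense[of "fst \<omega>" "min (snd \<omega>) a"] by auto
      then show False using elim Q_pos(1)[of \<omega>] by (metis less_imp_le min_less_iff_conj order_less_trans)
    qed
  qed
  let ?g = "\<lambda>\<omega>. indicator {..<a} (fst \<omega>) * (snd \<omega> - fst \<omega>) :: real"
  have "AE \<omega> in Q. 0 \<le> - ?g \<omega>"
    using le by eventually_elim (auto simp: indicator_def)
  moreover have "integrable Q (\<lambda>\<omega>. - ?g \<omega>)" "(\<integral>\<omega>. - ?g \<omega> \<partial>Q) = 0"
    using mean_zero[of "{..<a}"] by simp_all
  ultimately have "AE \<omega> in Q. - ?g \<omega> = 0"
    using integral_nonneg_eq_0_iff_AE by blast
  then show ?thesis
    using AE_ne(1)[of a] by eventually_elim (auto simp: indicator_def split: if_splits)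
qed

lemma diagonal_right:
  assumes s: "structured a b p q" and pq: "hk_params a b p q"
  shows "AE \<omega> in Q. b \<le> fst \<omega> \<longrightarrow> snd \<omega> = fst \<omega>"
proof -
  have "AE \<omega> in Q. b \<le> real_of_rat r \<longrightarrow>
      \<not> (snd \<omega> < real_of_rat r \<and> real_of_rat r < fst \<omega>)" for r
  proof (cases "b \<le> real_of_rat r")
    case True
    then have "0 < real_of_rat r" using pq unfolding hk_params_def by linarith
    then have "AE \<omega> in Q. hk_pattern a b p q (real_of_rat r) \<omega>"
      using s by (simp add: structured_def)
    then show ?thesis
      by eventually_elim (use True pq in \<open>auto simp: hk_pattern_def hk_params_def\<close>)
  qed (auto intro!: AE_I2)
  then have "AE \<omega> in Q. \<forall>r. b \<le> real_of_rat r \<longrightarrow>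
      \<not> (snd \<omega> < real_of_rat r \<and> real_of_rat r < fst \<omega>)"
    by (subst AE_all_countable) auto
  then have le: "AE \<omega> in Q. b < fst \<omega> \<longrightarrow> fst \<omega> \<le> snd \<omega>"
  proof eventually_elim
    case (elim \<omega>)
    show ?case
    proof (rule impI, rule ccontr)
      assume "b < fst \<omega>" "\<not> fst \<omega> \<le> snd \<omega>"
      then obtain r where "max (snd \<omega>) b < real_of_rat r" "real_of_rat r < fst \<omega>"
        using of_rat_dense[of "max (snd \<omega>) b" "fst \<omega>"] by auto
      then show False using elim by (metis less_imp_le max_less_iff_conj)
    qed
  qed
  let ?g = "\<lambda>\<omega>. indicator {b<..} (fst \<omega>) * (snd \<omega> - fst \<omega>) :: real"
  have "AE \<omega> in Q. 0 \<le> ?g \<omega>"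
    using le by eventually_elim (auto simp: indicator_def)
  then have "AE \<omega> in Q. ?g \<omega> = 0"
    using integral_nonneg_eq_0_iff_AE[OF mean_zero(1), of "{b<..}"] mean_zero(2)[of "{b<..}"] by simp
  then show ?thesis
    using AE_ne(1)[of b] by eventually_elim (auto simp: indicator_def split: if_splits)
qed

text \<open>The right-hand side involves only the marginals and the parameters, hence uniqueness.
  Each forbidden region allows the event, or its counterpart with \<open>z < fst \<omega>\<close>,
  to be replaced almost surely by one concerning a single coordinate or by one whose probability is
  already known.\<close>

lemma structured_joint_cdf:
  assumes s: "structured a b p q" and pq: "hk_params a b p q" and z: "0 < z" and w: "0 < w"
  shows "measure Q {\<omega> \<in> space Q. fst \<omega> \<le> z \<and> snd \<omega> \<le> w} =
    (if z \<le> a then F_cdf \<mu> (min z w)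
     else if b \<le> z then F_cdf \<nu> w - (F_cdf \<mu> (max z w) - F_cdf \<mu> z)
     else if w \<le> p z then F_cdf \<mu> w
     else if w \<le> z then F_cdf \<nu> w - F_cdf \<nu> (p z) + F_cdf \<mu> (p z)
     else if w \<le> q z then F_cdf \<nu> z - F_cdf \<nu> (p z) + F_cdf \<mu> (p z)
     else F_cdf \<mu> z + F_cdf \<nu> w - F_cdf \<mu> w)"
proof -
  note L = diagonal_left[OF s] and R = diagonal_right[OF s pq]
  let ?J = "\<lambda>w. measure Q {\<omega> \<in> space Q. fst \<omega> \<le> z \<and> snd \<omega> \<le> w}"
  have sF: "F_cdf \<nu> w = ?J w + measure Q {\<omega> \<in> space Q. snd \<omega> \<le> w \<and> \<not> fst \<omega> \<le> z}" for w
    unfolding prob_snd_le[symmetric]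
    by (subst prob_split[where R="\<lambda>\<omega>. fst \<omega> \<le> z"]) (measurable, simp add: conj_commute)
  have s\<mu>: "measure Q {\<omega> \<in> space Q. fst \<omega> \<le> w \<and> \<not> fst \<omega> \<le> z} = F_cdf \<mu> (max z w) - F_cdf \<mu> z" for w
  proof -
    have "F_cdf \<mu> (max z w) = measure Q {\<omega> \<in> space Q. fst \<omega> \<le> max z w \<and> fst \<omega> \<le> z} +
        measure Q {\<omega> \<in> space Q. fst \<omega> \<le> max z w \<and> \<not> fst \<omega> \<le> z}"
      unfolding prob_fst_le[symmetric] by (rule prob_split) measurable
    moreover have "{\<omega> \<in> space Q. fst \<omega> \<le> max z w \<and> fst \<omega> \<le> z} = {\<omega> \<in> space Q. fst \<omega> \<le> z}"
      "{\<omega> \<in> space Q. fst \<omega> \<le> max z w \<and> \<not> fst \<omega> \<le> z} = {\<omega> \<in> space Q. fst \<omega> \<le> w \<and> \<not> fst \<omega> \<le> z}"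
      by auto
    ultimately show ?thesis using prob_fst_le by simp
  qed
  consider "z \<le> a" | "b \<le> z" "\<not> z \<le> a" | "a < z" "z < b" by linarith
  then show ?thesis
  proof cases
    case 1
    have "?J w = measure Q {\<omega> \<in> space Q. fst \<omega> \<le> min z w}"
      by (rule prob_cong, use L in eventually_elim) (use 1 in auto)
    then show ?thesis using 1 prob_fst_le[of "min z w"] by simp
  next
    case 2
    have "measure Q {\<omega> \<in> space Q. snd \<omega> \<le> w \<and> \<not> fst \<omega> \<le> z} =
        measure Q {\<omega> \<in> space Q. fst \<omega> \<le> w \<and> \<not> fst \<omega> \<le> z}"
      by (rule prob_cong, use R in eventually_elim) (use 2 in auto)
    then show ?thesis using 2 sF[of w] s\<mu>[of w] by simp
  next
    case 3
    have pz: "0 < p z" "p z \<le> a" "p z < z" "b \<le> q z" "z < q z"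
      using pq 3 by (auto simp: hk_params_def)
    have "AE \<omega> in Q. hk_jump (p z) z (q z) \<omega>"
    proof -
      have "AE \<omega> in Q. hk_pattern a b p q z \<omega>" using s z by (auto simp: structured_def)
      then show ?thesis by eventually_elim (use 3 in \<open>simp add: hk_pattern_def\<close>)
    qed
    then have jump: "AE \<omega> in Q. hk_jump (p z) z (q z) \<omega> \<and>
        fst \<omega> \<noteq> p z \<and> fst \<omega> \<noteq> z \<and> fst \<omega> \<noteq> q z \<and> snd \<omega> \<noteq> p z \<and> snd \<omega> \<noteq> z \<and> snd \<omega> \<noteq> q z"
      using AE_ne[of "p z"] AE_ne[of z] AE_ne[of "q z"] by eventually_elim simp
    have low: "?J w = F_cdf \<mu> w" if w: "w \<le> p z" for w
    proof -
      have "?J w = measure Q {\<omega> \<in> space Q. fst \<omega> \<le> w}"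
      proof (rule prob_cong)
        show "AE \<omega> in Q. (fst \<omega> \<le> z \<and> snd \<omega> \<le> w) = (fst \<omega> \<le> w)"
          using jump L
        proof eventually_elim
          case (elim \<omega>)
          show ?case
          proof (cases "fst \<omega> < p z")
            case True
            then show ?thesis using elim pz w by auto
          next
            case False
            then have gt: "p z < fst \<omega>" using elim by simp
            then have "\<not> fst \<omega> \<le> w" using w by simp
            moreover have "\<not> snd \<omega> \<le> w" if "fst \<omega> \<le> z"
            proof -
              have "fst \<omega> < z" using that elim by simp
              then have "p z < snd \<omega> \<or> q z < snd \<omega>" using elim gt unfolding hk_jump_def by blast
              then show ?thesis using pz w by linarith
            qed
            ultimately show ?thesis by blast
          qed
        qed
      qed measurable
      then show ?thesis by (simp add: prob_fst_le)
    qed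
    \<comment> \<open>Mass from above \<open>z\<close> that ends below \<open>w\<close> must end
      below \<open>p z\<close>, so its amount is the same for all such \<open>w\<close> and follows
      from \<open>low\<close> at \<open>p z\<close>.\<close>
    have mid: "?J w = F_cdf \<nu> w - F_cdf \<nu> (p z) + F_cdf \<mu> (p z)" if w: "p z < w" "w \<le> z" for w
    proof -
      have "measure Q {\<omega> \<in> space Q. snd \<omega> \<le> w \<and> \<not> fst \<omega> \<le> z} =
          measure Q {\<omega> \<in> space Q. snd \<omega> \<le> p z \<and> \<not> fst \<omega> \<le> z}"
      proof (rule prob_cong)
        show "AE \<omega> in Q. (snd \<omega> \<le> w \<and> \<not> fst \<omega> \<le> z) = (snd \<omega> \<le> p z \<and> \<not> fst \<omega> \<le> z)"
          using jump
        proof eventually_elim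
          case (elim \<omega>)
          have "snd \<omega> \<le> w \<longleftrightarrow> snd \<omega> \<le> p z" if "\<not> fst \<omega> \<le> z"
          proof -
            have "snd \<omega> < p z \<or> z < snd \<omega> \<or> q z < snd \<omega>"
              using that elim unfolding hk_jump_def by (meson not_le neqE)
            then show ?thesis using pz w by linarith
          qed
          then show ?case by blast
        qed
      qed measurable
      then show ?thesis using sF[of w] sF[of "p z"] low[of "p z"] by simp
    qed
    have midhigh: "?J w = ?J z" if w: "z < w" "w \<le> q z" for w
    proof (rule prob_cong)
      show "AE \<omega> in Q. (fst \<omega> \<le> z \<and> snd \<omega> \<le> w) = (fst \<omega> \<le> z \<and> snd \<omega> \<le> z)"
        using jump
      proof eventually_elim
        case (elim \<omega>)
        have "snd \<omega> \<le> w \<longleftrightarrow> snd \<omega> \<le> z" if "fst \<omega> \<le> z"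
        proof -
          have "fst \<omega> < z" using that elim by simp
          then have "snd \<omega> < p z \<or> snd \<omega> < z \<or> q z < snd \<omega>"
            using elim unfolding hk_jump_def by (meson neqE)
          then show ?thesis using pz w by linarith
        qed
        then show ?case by blast
      qed
    qed measurable
    \<comment> \<open>Above \<open>z\<close>, points starting before \<open>q z\<close> end below
      \<open>q z\<close>, and those starting after it stay put; so ending below \<open>w\<close>
      means starting below \<open>w\<close>.\<close>
    have high: "?J w = F_cdf \<mu> z + F_cdf \<nu> w - F_cdf \<mu> w" if w: "q z < w" for w
    proof -
      have "measure Q {\<omega> \<in> space Q. snd \<omega> \<le> w \<and> \<not> fst \<omega> \<le> z} =
          measure Q {\<omega> \<in> space Q. fst \<omega> \<le> w \<and> \<not> fst \<omega> \<le> z}"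
      proof (rule prob_cong)
        show "AE \<omega> in Q. (snd \<omega> \<le> w \<and> \<not> fst \<omega> \<le> z) = (fst \<omega> \<le> w \<and> \<not> fst \<omega> \<le> z)"
          using jump R
        proof eventually_elim
          case (elim \<omega>)
          show ?case
          proof (cases "fst \<omega> < q z")
            case True
            have "snd \<omega> \<le> w" if "\<not> fst \<omega> \<le> z"
            proof -
              have "snd \<omega> < p z \<or> snd \<omega> < q z"
                using that True elim unfolding hk_jump_def by (meson not_le)
              then show ?thesis using pz w by linarith
            qed
            moreover have "fst \<omega> \<le> w" using True w by simp
            ultimately show ?thesis by blast
          next
            case False
            then show ?thesis using elim pz by auto
          qed
        qed
      qed measurable
      then show ?thesis using sF[of w] s\<mu>[of w] w pz by simp
    qed
    show ?thesis
      using 3 low[of w] mid[of w] mid[of z] midhigh[of w] high[of w] pz by auto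
  qed
qed

end

lemma structured_unique:
  assumes A: "atomless_coupling \<mu> \<nu> Q" and B: "atomless_coupling \<mu> \<nu> Q'"
    and pq: "hk_params a b p q" and s: "atomless_coupling.structured Q a b p q"
      "atomless_coupling.structured Q' a b p q"
  shows "Q = Q'"
proof -
  interpret A: atomless_coupling \<mu> \<nu> Q by fact
  interpret B: atomless_coupling \<mu> \<nu> Q' by fact
  show ?thesis
  proof (rule quadrant_measure_eqI[OF A.Q_sets A.finite_measure_axioms B.Q_sets B.finite_measure_axioms])
    fix z w :: real assume zw: "0 < z" "0 < w"
    have "{0<..z} \<times> {0<..w} = {\<omega> \<in> space Q. fst \<omega> \<le> z \<and> snd \<omega> \<le> w}"
      "{0<..z} \<times> {0<..w} = {\<omega> \<in> space Q'. fst \<omega> \<le> z \<and> snd \<omega> \<le> w}"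
      unfolding space_eq_quadrant[OF A.Q_sets] space_eq_quadrant[OF B.Q_sets] by auto
    then have "measure Q ({0<..z} \<times> {0<..w}) = measure Q' ({0<..z} \<times> {0<..w})"
      using A.structured_joint_cdf[OF s(1) pq zw] B.structured_joint_cdf[OF s(2) pq zw] by metis
    then show "emeasure Q ({0<..z} \<times> {0<..w}) = emeasure Q' ({0<..z} \<times> {0<..w})"
      by (simp add: A.emeasure_eq_measure B.emeasure_eq_measure)
  qed
qed

text \<open>Every competitor has the same marginals and is thus again atomless. A competitor of
  equal cost is structured, and structured couplings coincide, which discharges the definite
  description.\<close>

lemma Q_HK_eqI:
  assumes A: "atomless_coupling \<mu> \<nu> Q"
    and pq: "hk_params a b p q" and s: "atomless_coupling.structured Q a b p q"
  shows "Q_HK \<mu> \<nu> = Q"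
proof -
  interpret A: atomless_coupling \<mu> \<nu> Q by fact
  let ?c = "\<lambda>Q :: (real \<times> real) measure. \<integral>\<^sup>+\<omega>. ennreal \<bar>snd \<omega> - fst \<omega>\<bar> \<partial>Q"
  have B: "atomless_coupling \<mu> \<nu> Q'" if "Q' \<in> martingale_couplings \<mu> \<nu>" for Q'
    using A.\<mu> A.\<nu> A.\<mu>_atomless A.\<nu>_atomless that by unfold_locales
  have inf: "?c Q = (INF Q' \<in> martingale_couplings \<mu> \<nu>. ?c Q')"
    using structured_optimal(1)[OF A B pq s] A.Q by (intro antisym INF_greatest INF_lower) auto
  show ?thesis
    unfolding Q_HK_def
  proof (rule the_equality)
    show "Q \<in> martingale_couplings \<mu> \<nu> \<and> ?c Q = (INF Q' \<in> martingale_couplings \<mu> \<nu>. ?c Q')"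
      using A.Q inf by simp
    fix Q' assume Q': "Q' \<in> martingale_couplings \<mu> \<nu> \<and> ?c Q' = (INF Q' \<in> martingale_couplings \<mu> \<nu>. ?c Q')"
    then have "atomless_coupling.structured Q' a b p q"
      using structured_optimal(2)[OF A B pq s] inf by simp
    then show "Q' = Q"
      using structured_unique[OF A B pq s] Q' by metis
  qed
qed

section \<open>Invariance of the criterion under inversion\<close>

lemma S_op_atomless:
  assumes s: "sets \<mu> = sets half_line" and at: "\<And>x. 0 < x \<Longrightarrow> emeasure \<mu> {x} = 0" and x: "0 < x"
  shows "emeasure (S_op \<mu>) {x} = 0"
proof -
  have sx: "{c} \<in> sets half_line" if "0 < c" for c :: real using that by (simp add: sets_half_line_iff)
  have "emeasure (S_op \<mu>) {x} = (\<integral>\<^sup>+y. indicator {x} y \<partial>S_op \<mu>)"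
    using sx[OF x] by (simp add: S_op_def)
  also have "\<dots> = (\<integral>\<^sup>+y. ennreal y * indicator {x} (1 / y) \<partial>\<mu>)"
    using sx[OF x] by (intro nn_integral_S_op[OF s]) simp
  also have "\<dots> = (\<integral>\<^sup>+y. ennreal (1 / x) * indicator {1 / x} y \<partial>\<mu>)"
    using space_eq_half_line[OF s] x by (intro nn_integral_cong) (auto simp: indicator_def field_simps)
  also have "\<dots> = ennreal (1 / x) * emeasure \<mu> {1 / x}"
    using sx[of "1 / x"] x s by (intro nn_integral_cmult_indicator) simp
  finally show ?thesis using at[of "1 / x"] x by simp
qed

lemma hk_params_reciprocal:
  assumes "hk_params a b p q"
  shows "hk_params (1 / b) (1 / a) (\<lambda>z. 1 / q (1 / z)) (\<lambda>z. 1 / p (1 / z))"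
  unfolding hk_params_def
proof (intro conjI allI impI)
  have ab: "0 < a" "a < b" using assms by (auto simp: hk_params_def)
  then show "0 < 1 / b" "1 / b < 1 / a" by (auto simp: frac_less2)
  fix z assume z: "1 / b < z \<and> z < 1 / a"
  have z0: "0 < z" using z ab by (meson divide_pos_pos order_less_trans zero_less_one)
  have "a < 1 / z" "1 / z < b" using z ab z0 by (auto simp: field_simps)
  then have "0 < p (1 / z)" "p (1 / z) \<le> a" "b \<le> q (1 / z)" using assms by (auto simp: hk_params_def)
  then show "0 < 1 / q (1 / z)" "1 / q (1 / z) \<le> 1 / b" "1 / a \<le> 1 / p (1 / z)"
    using ab by (auto simp: frac_le)
qed

lemma reciprocal_less_iff:
  fixes x y :: real assumes "0 < x" "0 < y"
  shows "1 / x < 1 / y \<longleftrightarrow> y < x"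
  using assms by (simp add: field_simps)

lemma hk_pattern_reciprocal:
  assumes pq: "hk_params a b p q" and z: "0 < z" and pos: "0 < x" "0 < y"
    and pat: "hk_pattern a b p q (1 / z) (x, y)"
  shows "hk_pattern (1 / b) (1 / a) (\<lambda>z. 1 / q (1 / z)) (\<lambda>z. 1 / p (1 / z)) z (1 / x, 1 / y)"
proof -
  have ab: "0 < a" "a < b" using pq by (auto simp: hk_params_def)
  define u where "u = 1 / z"
  have u: "0 < u" "z = 1 / u" using z by (auto simp: u_def)
  note r = reciprocal_less_iff
  have zb: "z \<le> 1 / b \<longleftrightarrow> b \<le> u"
    using r[of b u] ab u by (auto simp: not_less[symmetric])
  have za: "1 / a \<le> z \<longleftrightarrow> u \<le> a"
    using r[of u a] ab u by (auto simp: not_less[symmetric])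
  consider "u \<le> a" | "b \<le> u" | "a < u" "u < b" by linarith
  then show ?thesis
  proof cases
    case 1
    then show ?thesis
      using pat ab pos u zb za by (auto simp: hk_pattern_def r u_def[symmetric])
  next
    case 2
    then show ?thesis
      using pat ab pos u zb za by (auto simp: hk_pattern_def r u_def[symmetric])
  next
    case 3
    have pu: "0 < p u" "0 < q u" using pq 3 ab by (auto simp: hk_params_def)
    have "hk_jump (p u) u (q u) (x, y)"
      using pat 3 by (simp add: hk_pattern_def u_def[symmetric])
    then have "hk_jump (1 / q u) (1 / u) (1 / p u) (1 / x, 1 / y)"
      using pu u(1) pos by (auto simp: hk_jump_def r)
    then show ?thesis using 3 zb za u by (simp add: hk_pattern_def)
  qed
qed

lemma SS_op_structured:
  assumes A: "atomless_coupling \<mu> \<nu> Q"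
    and pq: "hk_params a b p q" and s: "atomless_coupling.structured Q a b p q"
  shows "atomless_coupling (S_op \<mu>) (S_op \<nu>) (SS_op Q)"
    and "atomless_coupling.structured (SS_op Q) (1 / b) (1 / a) (\<lambda>z. 1 / q (1 / z)) (\<lambda>z. 1 / p (1 / z))"
proof -
  interpret A: atomless_coupling \<mu> \<nu> Q by fact
  show B: "atomless_coupling (S_op \<mu>) (S_op \<nu>) (SS_op Q)"
    using S_op_P1[OF A.\<mu>] S_op_P1[OF A.\<nu>] SS_op_martingale_coupling[OF A.\<mu> A.\<nu> A.Q]
      S_op_atomless[OF P1D(2)[OF A.\<mu>] A.\<mu>_atomless] S_op_atomless[OF P1D(2)[OF A.\<nu>] A.\<nu>_atomless]
    by unfold_locales
  interpret B: atomless_coupling "S_op \<mu>" "S_op \<nu>" "SS_op Q" by fact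
  show "B.structured (1 / b) (1 / a) (\<lambda>z. 1 / q (1 / z)) (\<lambda>z. 1 / p (1 / z))"
    unfolding B.structured_def
  proof (intro allI impI AE_SS_opI[OF A.Q_sets])
    fix z :: real assume z: "0 < z"
    have [measurable]: "fst \<in> borel_measurable quadrant" "snd \<in> borel_measurable quadrant"
      by (rule quadrant_measurable; simp)+
    show "{\<omega> \<in> space quadrant. hk_pattern (1 / b) (1 / a) (\<lambda>z. 1 / q (1 / z)) (\<lambda>z. 1 / p (1 / z)) z \<omega>}
        \<in> sets quadrant"
      unfolding hk_pattern_def hk_jump_def by measurable
    have "AE \<omega> in Q. hk_pattern a b p q (1 / z) \<omega>"
      using s z by (auto simp: A.structured_def)
    then show "AE \<omega> in Q. hk_pattern (1 / b) (1 / a) (\<lambda>z. 1 / q (1 / z)) (\<lambda>z. 1 / p (1 / z)) z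
        (1 / fst \<omega>, 1 / snd \<omega>)"
      using AE_space
      by eventually_elim (use hk_pattern_reciprocal[OF pq z A.Q_pos] in simp)
  qed
qed

text \<open>\<open>Q_HK_eqI\<close> is used twice, for \<open>Q\<close> and for
  \<open>SS_op Q\<close> with inverted parameters; the involution property closes the
  circle.\<close>

lemma SS_op_Q_HK:
  assumes A: "atomless_coupling \<mu> \<nu> Q"
    and pq: "hk_params a b p q" and s: "atomless_coupling.structured Q a b p q"
  shows "SS_op (Q_HK (S_op \<mu>) (S_op \<nu>)) = Q_HK \<mu> \<nu>"
proof -
  have "Q_HK (S_op \<mu>) (S_op \<nu>) = SS_op Q"
    by (rule Q_HK_eqI[OF SS_op_structured(1)[OF A pq s] hk_params_reciprocal[OF pq] SS_op_structured(2)[OF A pq s]])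
  moreover have "Q_HK \<mu> \<nu> = Q"
    by (rule Q_HK_eqI[OF A pq s])
  moreover have "SS_op (SS_op Q) = Q"
    using SS_op_SS_op[OF atomless_coupling.Q_sets[OF A]] .
  ultimately show ?thesis by simp
qed

section \<open>First moments and put values\<close>

definition G_cdf :: "real measure \<Rightarrow> real \<Rightarrow> real" where
  "G_cdf \<mu> x = (\<integral>y. indicator {0<..x} y * y \<partial>\<mu>)"

definition delta_G :: "real measure \<Rightarrow> real measure \<Rightarrow> real \<Rightarrow> real" where
  "delta_G \<mu> \<nu> x = G_cdf \<nu> x - G_cdf \<mu> x"

text \<open>This is the antiderivative of \<open>F_cdf\<close> vanishing at 0 and at the same time
  the integral of a convex function of \<open>y\<close>; it thus links the convex order with the
  shape of \<open>delta_F\<close>.\<close>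

definition put_value :: "real measure \<Rightarrow> real \<Rightarrow> real" where
  "put_value \<mu> x = (\<integral>y. max 0 (x - y) \<partial>\<mu>)"

lemma P1d_atomless:
  assumes "\<mu> \<in> P1d" "0 < x"
  shows "emeasure \<mu> {x} = 0"
proof -
  let ?L = "restrict_space lborel {0 :: real<..}"
  obtain p where p: "p \<in> borel_measurable half_line" "\<mu> = density ?L (\<lambda>x. ennreal (p x))"
    using assms(1) by (auto simp: P1d_def)
  have "sets ?L = sets half_line" by (intro sets_restrict_space_cong) simp
  then have "(\<lambda>x. ennreal (p x)) \<in> borel_measurable ?L"
    using p(1) by (simp cong: measurable_cong_sets)
  then have "absolutely_continuous ?L \<mu>" unfolding p(2) by (rule absolutely_continuousI_density)
  moreover have "{x} \<in> null_sets ?L"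
    using assms(2) by (subst null_sets_restrict_space) auto
  ultimately show ?thesis unfolding absolutely_continuous_def by blast
qed

context
  fixes \<mu> :: "real measure"
  assumes \<mu>: "\<mu> \<in> P1"
begin

interpretation prob_space \<mu> by (rule P1D(1)[OF \<mu>])

lemma half_line_borel_measurable:
  "f \<in> borel_measurable borel \<Longrightarrow> f \<in> borel_measurable \<mu>"
  unfolding measurable_cong_sets[OF P1D(2)[OF \<mu>] refl] by (rule measurable_restrict_space1)

lemma P1_pos: "x \<in> space \<mu> \<Longrightarrow> 0 < x"
  unfolding space_eq_half_line[OF P1D(2)[OF \<mu>]] by simp

lemma Ioc_sets: "0 \<le> s \<Longrightarrow> {s<..t} \<in> sets \<mu>"
  using P1D(2)[OF \<mu>] by (auto simp: sets_half_line_iff)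

lemma integrable_indicator_Ioc: "integrable \<mu> (\<lambda>y. indicator {0<..x} y * y)"
proof -
  have "integrable \<mu> (\<lambda>y. indicator {0<..x} y *\<^sub>R y)"
    by (rule integrable_mult_indicator[OF Ioc_sets P1D(3)[OF \<mu>]]) simp
  then show ?thesis by simp
qed

lemma F_cdf_integral: "F_cdf \<mu> x = (\<integral>y. indicator {0<..x} y \<partial>\<mu>)"
  using Ioc_sets[of 0 x] by (simp add: F_cdf_def)

lemma integrable_put: "integrable \<mu> (\<lambda>y. max 0 (x - y))"
proof (rule integrable_const_bound[where B="\<bar>x\<bar>"])
  show "AE y in \<mu>. norm (max 0 (x - y)) \<le> \<bar>x\<bar>"
    using P1_pos by (intro AE_I2) (force simp: max_def)
  show "(\<lambda>y. max 0 (x - y)) \<in> borel_measurable \<mu>"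
    by (rule half_line_borel_measurable) measurable
qed

text \<open>Pointwise, the difference of the payoffs equals \<open>t - s\<close> for
  \<open>y \<le> s\<close>, vanishes for \<open>y > t\<close>, and lies in between
  otherwise.\<close>

lemma put_value_diff:
  assumes "s \<le> t"
  shows "(t - s) * F_cdf \<mu> s \<le> put_value \<mu> t - put_value \<mu> s"
    "put_value \<mu> t - put_value \<mu> s \<le> (t - s) * F_cdf \<mu> t"
proof -
  have i: "integrable \<mu> (indicator {0<..x} :: real \<Rightarrow> real)" for x
    using Ioc_sets[of 0 x] emeasure_finite
    by (intro integrable_real_indicator) (auto simp only: less_top infinity_ennreal_def)
  have d: "put_value \<mu> t - put_value \<mu> s = (\<integral>y. max 0 (t - y) - max 0 (s - y) \<partial>\<mu>)"
    using integrable_put unfolding put_value_def by simp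
  have j: "integrable \<mu> (\<lambda>y. max 0 (t - y) - max 0 (s - y))" using integrable_put by simp
  have k: "integrable \<mu> (\<lambda>y. (t - s) * indicator {0<..x} y)" for x using i by (rule integrable_mult_right)
  have c: "(t - s) * F_cdf \<mu> x = (\<integral>y. (t - s) * indicator {0<..x} y \<partial>\<mu>)" for x
    unfolding F_cdf_integral by simp
  show "(t - s) * F_cdf \<mu> s \<le> put_value \<mu> t - put_value \<mu> s"
    unfolding d c
    by (intro integral_mono j k) (use assms in \<open>auto simp: indicator_def max_def dest: P1_pos\<close>)
  show "put_value \<mu> t - put_value \<mu> s \<le> (t - s) * F_cdf \<mu> t"
    unfolding d c
    by (intro integral_mono j k) (use assms in \<open>auto simp: indicator_def max_def dest: P1_pos\<close>)
qed

lemma put_value_deriv: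
  assumes "isCont (F_cdf \<mu>) x"
  shows "(put_value \<mu> has_real_derivative F_cdf \<mu> x) (at x)"
  unfolding has_field_derivative_iff
proof (rule tendsto_sandwich)
  let ?l = "\<lambda>y. min (F_cdf \<mu> x) (F_cdf \<mu> y)" and ?u = "\<lambda>y. max (F_cdf \<mu> x) (F_cdf \<mu> y)"
  have b: "?l y \<le> (put_value \<mu> y - put_value \<mu> x) / (y - x) \<and>
      (put_value \<mu> y - put_value \<mu> x) / (y - x) \<le> ?u y" if "y \<noteq> x" for y
  proof (cases "x < y")
    case True
    then show ?thesis using put_value_diff[of x y]
      by (auto simp: field_simps min_le_iff_disj le_max_iff_disj)
  next
    case False
    then have "y < x" using that by simp
    then show ?thesis using put_value_diff[of y x]
      by (auto simp: field_simps min_le_iff_disj le_max_iff_disj)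
  qed
  show "\<forall>\<^sub>F y in at x. ?l y \<le> (put_value \<mu> y - put_value \<mu> x) / (y - x)"
    "\<forall>\<^sub>F y in at x. (put_value \<mu> y - put_value \<mu> x) / (y - x) \<le> ?u y"
    using b by (auto simp: eventually_at_filter)
  show "(?l \<longlongrightarrow> F_cdf \<mu> x) (at x)" "(?u \<longlongrightarrow> F_cdf \<mu> x) (at x)"
    using tendsto_min[OF tendsto_const assms[unfolded isCont_def], of "F_cdf \<mu> x"]
      tendsto_max[OF tendsto_const assms[unfolded isCont_def], of "F_cdf \<mu> x"] by simp_all
qed

lemma put_value_0: "put_value \<mu> 0 = 0"
proof -
  have "put_value \<mu> 0 = (\<integral>y. 0 \<partial>\<mu>)"
    unfolding put_value_def by (intro Bochner_Integration.integral_cong) (auto simp: max_def dest: P1_pos)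
  then show ?thesis by simp
qed

lemma G_cdf_eq: "G_cdf \<mu> x = x * F_cdf \<mu> x - put_value \<mu> x"
proof -
  have i: "integrable \<mu> (indicator {0<..x} :: real \<Rightarrow> real)"
    using Ioc_sets[of 0 x] emeasure_finite
    by (intro integrable_real_indicator) (auto simp only: less_top infinity_ennreal_def)
  have "put_value \<mu> x = (\<integral>y. x * indicator {0<..x} y - indicator {0<..x} y * y \<partial>\<mu>)"
    unfolding put_value_def
    by (intro Bochner_Integration.integral_cong) (auto simp: max_def indicator_def dest: P1_pos)
  also have "\<dots> = x * F_cdf \<mu> x - G_cdf \<mu> x"
    unfolding F_cdf_integral G_cdf_def using i integrable_indicator_Ioc by simp
  finally show ?thesis by simp
qed

lemma F_cdf_0: "F_cdf \<mu> 0 = 0"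
  by (simp add: F_cdf_def)

lemma F_cdf_at_top: "(F_cdf \<mu> \<longlongrightarrow> 1) at_top"
proof -
  have "((\<lambda>x. \<integral>y. indicator {0<..x} y \<partial>\<mu>) \<longlongrightarrow> (\<integral>y. (1 :: real) \<partial>\<mu>)) at_top"
  proof (rule integral_dominated_convergence_at_top[where w="\<lambda>_. 1"])
    show "AE y in \<mu>. ((\<lambda>x. indicator {0<..x} y :: real) \<longlongrightarrow> 1) at_top"
    proof (rule AE_I2, rule tendsto_eventually)
      fix y assume "y \<in> space \<mu>"
      then show "\<forall>\<^sub>F x in at_top. (indicator {0<..x} y :: real) = 1"
        using eventually_ge_at_top[of y] P1_pos by (auto elim!: eventually_mono simp: indicator_def)
    qed
  qed (use Ioc_sets[of 0] in \<open>auto intro!: AE_I2 always_eventually\<close>)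
  then show ?thesis using prob_space by (simp add: F_cdf_integral[abs_def])
qed

lemma G_cdf_at_top: "(G_cdf \<mu> \<longlongrightarrow> 1) at_top"
proof -
  have "((\<lambda>x. \<integral>y. indicator {0<..x} y * y \<partial>\<mu>) \<longlongrightarrow> (\<integral>y. y \<partial>\<mu>)) at_top"
  proof (rule integral_dominated_convergence_at_top[where w="\<lambda>y. y"])
    show "AE y in \<mu>. ((\<lambda>x. indicator {0<..x} y * y) \<longlongrightarrow> y) at_top"
    proof (rule AE_I2, rule tendsto_eventually)
      fix y assume "y \<in> space \<mu>"
      then show "\<forall>\<^sub>F x in at_top. indicator {0<..x} y * y = y"
        using eventually_ge_at_top[of y] P1_pos by (auto elim!: eventually_mono simp: indicator_def)
    qed
    show "\<forall>\<^sub>F x in at_top. AE y in \<mu>. norm (indicator {0<..x} y * y) \<le> y"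
      using P1_pos by (intro always_eventually allI AE_I2) (auto simp: indicator_def less_imp_le)
  qed (use integrable_indicator_Ioc P1D(3)[OF \<mu>] in auto)
  then show ?thesis using P1D(4)[OF \<mu>] by (simp add: G_cdf_def[abs_def])
qed

text \<open>Put-call parity: with mean 1 the difference is the integral of
  \<open>max 0 (y - x)\<close>, which tends to 0 by dominated convergence.\<close>

lemma put_value_at_top: "((\<lambda>x. put_value \<mu> x - (x - 1)) \<longlongrightarrow> 0) at_top"
proof -
  have "((\<lambda>x. \<integral>y. max 0 (y - x) \<partial>\<mu>) \<longlongrightarrow> (\<integral>y. 0 \<partial>\<mu>)) at_top"
  proof (rule integral_dominated_convergence_at_top[where w="\<lambda>y. y"])
    show "AE y in \<mu>. ((\<lambda>x. max 0 (y - x)) \<longlongrightarrow> 0) at_top"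
    proof (rule AE_I2, rule tendsto_eventually)
      fix y :: real
      show "\<forall>\<^sub>F x in at_top. max 0 (y - x) = 0"
        using eventually_ge_at_top[of y] by eventually_elim simp
    qed
    show "\<forall>\<^sub>F x in at_top. AE y in \<mu>. norm (max 0 (y - x)) \<le> y"
      using eventually_ge_at_top[of 0]
    proof eventually_elim
      case (elim x)
      show ?case using P1_pos elim by (intro AE_I2) (auto simp: max_def less_imp_le)
    qed
    show "(\<lambda>y. max 0 (y - x)) \<in> borel_measurable \<mu>" for x
      by (rule half_line_borel_measurable) measurable
    show "integrable \<mu> (\<lambda>y. y)" by (rule P1D(3)[OF \<mu>])
  qed simp
  moreover have "put_value \<mu> x - (x - 1) = (\<integral>y. max 0 (y - x) \<partial>\<mu>)" for x
  proof -
    have "(\<integral>y. max 0 (y - x) \<partial>\<mu>) = (\<integral>y. max 0 (x - y) - (x - y) \<partial>\<mu>)"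
      by (intro Bochner_Integration.integral_cong) (auto simp: max_def)
    also have "\<dots> = put_value \<mu> x - (x - 1)"
      unfolding put_value_def using integrable_put P1D(3,4)[OF \<mu>] prob_space by simp
    finally show ?thesis by simp
  qed
  ultimately show ?thesis by simp
qed

lemma ext_integral_put: "ext_integral \<mu> (\<lambda>y. max 0 (x - y)) = ereal (put_value \<mu> x)"
proof -
  have "(\<integral>\<^sup>+y. ennreal (max 0 (x - y)) \<partial>\<mu>) = ennreal (put_value \<mu> x)"
    unfolding put_value_def by (intro nn_integral_eq_integral integrable_put) auto
  moreover have "(\<integral>\<^sup>+y. ennreal (- max 0 (x - y)) \<partial>\<mu>) = (\<integral>\<^sup>+y. 0 \<partial>\<mu>)"
    by (intro nn_integral_cong ennreal_neg) simp
  moreover have "0 \<le> put_value \<mu> x" unfolding put_value_def by simp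
  ultimately show ?thesis by (simp add: ext_integral_def zero_ennreal.rep_eq)
qed

end

lemma put_value_mono_convex_order:
  assumes "\<mu> \<in> P1" "\<nu> \<in> P1" "convex_order \<mu> \<nu>"
  shows "put_value \<mu> x \<le> put_value \<nu> x"
proof -
  have "convex_on {0<..} (\<lambda>y. max 0 (x - y))"
  proof (rule convex_onI)
    fix t u v :: real assume t: "0 < t" "t < 1"
    have "(1 - t) * (x - u) \<le> (1 - t) * max 0 (x - u)" "t * (x - v) \<le> t * max 0 (x - v)"
      using t by (auto intro!: mult_left_mono)
    moreover have "0 \<le> (1 - t) * max 0 (x - u)" "0 \<le> t * max 0 (x - v)" using t by auto
    ultimately show "max 0 (x - ((1 - t) *\<^sub>R u + t *\<^sub>R v)) \<le> (1 - t) * max 0 (x - u) + t * max 0 (x - v)"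
      by (auto simp: max_def algebra_simps)
  qed simp
  then show ?thesis
    using assms(3) ext_integral_put[OF assms(1)] ext_integral_put[OF assms(2)]
    unfolding convex_order_def by (metis ereal_less_eq(3))
qed

locale hk_marginals =
  fixes \<mu> \<nu> :: "real measure" and a b :: real
  assumes \<mu>: "\<mu> \<in> P1" and \<nu>: "\<nu> \<in> P1"
    and \<mu>_atomless: "\<And>x. 0 < x \<Longrightarrow> emeasure \<mu> {x} = 0"
    and \<nu>_atomless: "\<And>x. 0 < x \<Longrightarrow> emeasure \<nu> {x} = 0"
    and shape: "hk_shape (delta_F \<mu> \<nu>) (delta_G \<mu> \<nu>) (\<lambda>x. put_value \<nu> x - put_value \<mu> x) a b"

lemma hk_marginals_exist:
  assumes "\<mu> \<in> P1d" and "\<nu> \<in> P1d" and co: "convex_order \<mu> \<nu>"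
    and ex1: "\<exists>!a. local_maximizer (delta_F \<mu> \<nu>) a"
  obtains a b where "hk_marginals \<mu> \<nu> a b"
proof -
  have P: "\<mu> \<in> P1" "\<nu> \<in> P1" using assms by (auto simp: P1d_def)
  let ?f = "delta_F \<mu> \<nu>" and ?G = "delta_G \<mu> \<nu>" and ?\<Phi> = "\<lambda>x. put_value \<nu> x - put_value \<mu> x"
  have FC: "isCont (F_cdf \<mu>) x" "isCont (F_cdf \<nu>) x" for x
    using P1D[OF P(1)] P1D[OF P(2)] P1d_atomless[OF assms(1)] P1d_atomless[OF assms(2)]
    by (auto intro!: isCont_F_cdf prob_space.finite_measure)
  have cont: "isCont ?f x" for x
    unfolding delta_F_def[abs_def] by (intro continuous_intros FC)
  have f0: "?f 0 = 0" by (simp add: delta_F_def F_cdf_0[OF P(1)] F_cdf_0[OF P(2)])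
  have fl: "(?f \<longlongrightarrow> 0) at_top"
    unfolding delta_F_def[abs_def]
    using tendsto_diff[OF F_cdf_at_top[OF P(2)] F_cdf_at_top[OF P(1)]] by simp
  have Gl: "(?G \<longlongrightarrow> 0) at_top"
    unfolding delta_G_def[abs_def]
    using tendsto_diff[OF G_cdf_at_top[OF P(2)] G_cdf_at_top[OF P(1)]] by simp
  have d: "(?\<Phi> has_real_derivative ?f x) (at x)" for x
    unfolding delta_F_def by (intro derivative_intros put_value_deriv P FC)
  have \<Phi>0: "?\<Phi> 0 = 0" using put_value_0[OF P(1)] put_value_0[OF P(2)] by simp
  have \<Phi>nn: "0 \<le> ?\<Phi> x" for x using put_value_mono_convex_order[OF P co] by simp
  have \<Phi>l: "(?\<Phi> \<longlongrightarrow> 0) at_top"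
    using tendsto_diff[OF put_value_at_top[OF P(2)] put_value_at_top[OF P(1)]] by simp
  obtain a b where ab: "0 < a" "a < b"
    "\<And>s t. 0 \<le> s \<Longrightarrow> s < t \<Longrightarrow> t \<le> a \<Longrightarrow> ?f s < ?f t"
    "\<And>s t. a \<le> s \<Longrightarrow> s < t \<Longrightarrow> t \<le> b \<Longrightarrow> ?f t < ?f s"
    "\<And>s t. b \<le> s \<Longrightarrow> s < t \<Longrightarrow> ?f s < ?f t"
    using strict_shape[OF cont f0 fl d \<Phi>0 \<Phi>nn \<Phi>l ex1] by metis
  have G: "?G x = x * ?f x - ?\<Phi> x" for x
    unfolding delta_G_def delta_F_def G_cdf_eq[OF P(1)] G_cdf_eq[OF P(2)] by (simp add: algebra_simps)
  have "hk_shape ?f ?G ?\<Phi> a b"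
    using ab cont f0 fl d \<Phi>0 G Gl by unfold_locales
  then have "hk_marginals \<mu> \<nu> a b"
    using P P1d_atomless[OF assms(1)] P1d_atomless[OF assms(2)] by (intro hk_marginals.intro)
  then show thesis by (rule that)
qed

section \<open>Construction of the coupling\<close>

context hk_marginals
begin

sublocale hk_shape "delta_F \<mu> \<nu>" "delta_G \<mu> \<nu>" "\<lambda>x. put_value \<nu> x - put_value \<mu> x" a b
  by (rule shape)

abbreviation "dF \<equiv> delta_F \<mu> \<nu>"
abbreviation "dG \<equiv> delta_G \<mu> \<nu>"

text \<open>An arbitrary choice at each \<open>z\<close> suffices, since
  \<open>matched_decreasing\<close> compares any solutions at two different levels.\<close>

definition pq :: "real \<Rightarrow> real \<times> real" where
  "pq z = (SOME r. matched z (fst r) (snd r))"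

definition p :: "real \<Rightarrow> real" where "p z = fst (pq z)"
definition q :: "real \<Rightarrow> real" where "q z = snd (pq z)"

lemma matched_pq: "a < z \<Longrightarrow> z < b \<Longrightarrow> matched z (p z) (q z)"
  unfolding p_def q_def pq_def
  by (rule someI_ex) (metis matched_exists fst_conv snd_conv)

lemma pq_decreasing: "a < z \<Longrightarrow> z < z' \<Longrightarrow> z' < b \<Longrightarrow> p z' < p z \<and> q z' < q z"
  using matched_decreasing[OF matched_pq matched_pq] by auto

lemma pq_range: assumes "a < z" "z < b" shows "0 < p z" "p z \<le> a" "b \<le> q z"
proof -
  \<comment> \<open>\<open>matched\<close> gives only \<open>0 \<le> p\<close>; strict decrease
    towards a later level makes \<open>p z\<close> positive.\<close>
  have m: "a < (z + b) / 2" "z < (z + b) / 2" "(z + b) / 2 < b" using assms by auto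
  show "0 < p z" using pq_decreasing[of z "(z + b) / 2"] matched_pq[OF m(1,3)] m assms
    by (simp add: matched_def)
  show "p z \<le> a" "b \<le> q z" using matched_pq[OF assms] by (auto simp: matched_def)
qed

lemma hk_params_pq: "hk_params a b p q"
  using a0 ab pq_range by (simp add: hk_params_def)

text \<open>The distribution function of the positive part of \<open>\<nu> - \<mu>\<close>.\<close>
definition K :: "real \<Rightarrow> real" where
  "K x = dF (min (max x 0) a) + dF (max x b) - dF b"

lemma K_cases:
  "x \<le> 0 \<Longrightarrow> K x = 0"
  "0 \<le> x \<Longrightarrow> x \<le> a \<Longrightarrow> K x = dF x"
  "a \<le> x \<Longrightarrow> x \<le> b \<Longrightarrow> K x = dF a"
  "b \<le> x \<Longrightarrow> K x = dF a + dF x - dF b"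
  using a0 ab f0 by (auto simp: K_def max_def min_def)

lemma K_mono: assumes "x \<le> y" shows "K x \<le> K y"
proof -
  have "dF (min (max x 0) a) \<le> dF (min (max y 0) a)"
  proof (cases "min (max x 0) a = min (max y 0) a")
    case False
    then have "min (max x 0) a < min (max y 0) a" using assms a0 by (auto simp: min_def max_def split: if_splits)
    then show ?thesis using inc1[of "min (max x 0) a" "min (max y 0) a"] a0 by simp
  qed simp
  moreover have "dF (max x b) \<le> dF (max y b)"
  proof (cases "max x b = max y b")
    case False
    then have "max x b < max y b" using assms by (auto simp: max_def split: if_splits)
    then show ?thesis using inc2[of "max x b" "max y b"] by simp
  qed simp
  ultimately show ?thesis by (simp add: K_def)
qed

lemma K_cont: "continuous_on UNIV K"
proof -
  have "continuous_on UNIV (\<lambda>x. dF (min (max x 0) a))" "continuous_on UNIV (\<lambda>x. dF (max x b))"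
    by (intro continuous_on_compose2[OF f_cont_on[of UNIV]] continuous_intros; simp)+
  then show ?thesis unfolding K_def[abs_def] by (intro continuous_intros)
qed

lemma K_right_cont: "continuous (at_right x) K"
  using K_cont by (metis UNIV_I continuous_at_imp_continuous_within continuous_on_eq_continuous_at open_UNIV)

lemma K_lim: "(K \<longlongrightarrow> dF a - dF b) at_top"
proof -
  have "((\<lambda>x. dF a + dF x - dF b) \<longlongrightarrow> dF a + 0 - dF b) at_top"
    by (intro tendsto_intros f_lim)
  moreover have "\<forall>\<^sub>F x in at_top. dF a + dF x - dF b = K x"
    using eventually_ge_at_top[of b] by eventually_elim (simp add: K_cases)
  ultimately have "(K \<longlongrightarrow> dF a + 0 - dF b) at_top" by (rule Lim_transform_eventually)
  then show ?thesis by simp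
qed

definition \<gamma> :: "real measure" where
  "\<gamma> = restrict_space (interval_measure K) {0<..}"

lemma sets_\<gamma>: "sets \<gamma> = sets half_line"
  unfolding \<gamma>_def by (rule sets_restrict_space_cong) simp

lemma space_\<gamma>: "space \<gamma> = {0<..}"
  by (rule space_eq_half_line[OF sets_\<gamma>])

lemma emeasure_\<gamma>: "A \<subseteq> {0<..} \<Longrightarrow> emeasure \<gamma> A = emeasure (interval_measure K) A"
  unfolding \<gamma>_def by (rule emeasure_restrict_space) simp_all

lemma emeasure_\<gamma>_Ioc: "0 \<le> s \<Longrightarrow> s \<le> t \<Longrightarrow> emeasure \<gamma> {s<..t} = ennreal (K t - K s)"
  by (subst emeasure_\<gamma>) (auto intro!: emeasure_interval_measure_Ioc K_mono K_right_cont)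

lemma emeasure_\<gamma>_Icc: "0 < s \<Longrightarrow> s \<le> t \<Longrightarrow> emeasure \<gamma> {s..t} = ennreal (K t - K s)"
  by (subst emeasure_\<gamma>) (auto intro!: emeasure_interval_measure_Icc K_mono K_cont)

lemma emeasure_\<gamma>_space: "emeasure \<gamma> (space \<gamma>) = ennreal (dF a - dF b)"
proof -
  have "(\<lambda>n. emeasure \<gamma> {0<..real n}) \<longlonglongrightarrow> emeasure \<gamma> (\<Union>n. {0<..real n})"
    by (rule Lim_emeasure_incseq) (auto simp: incseq_def sets_\<gamma> sets_half_line_iff)
  moreover have "(\<Union>n. {0<..real n}) = space \<gamma>"
    unfolding space_\<gamma> using real_arch_simple by auto
  moreover have "(\<lambda>n. ennreal (K (real n) - K 0)) \<longlonglongrightarrow> ennreal (dF a - dF b - K 0)"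
    by (intro tendsto_intros tendsto_ennrealI filterlim_compose[OF K_lim] filterlim_real_sequentially)
  ultimately show ?thesis
    using LIMSEQ_unique by (simp add: emeasure_\<gamma>_Ioc K_cases)
qed

sublocale \<gamma>: finite_measure \<gamma>
  by (rule finite_measureI) (simp add: emeasure_\<gamma>_space)

lemma dF_ab: "dF b < dF a"
  using dec[of a b] ab by simp

lemma measure_\<gamma>_space: "measure \<gamma> (space \<gamma>) = dF a - dF b"
  using dF_ab by (simp add: measure_def emeasure_\<gamma>_space)

lemma measure_\<gamma>_Ioc: "0 \<le> s \<Longrightarrow> s \<le> t \<Longrightarrow> measure \<gamma> {s<..t} = K t - K s"
  using K_mono[of s t] by (simp add: measure_def emeasure_\<gamma>_Ioc)

lemma AE_\<gamma>_ne: "AE y in \<gamma>. y \<noteq> c"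
proof (cases "0 < c")
  case True
  then have "{c} \<in> null_sets \<gamma>"
    using emeasure_\<gamma>_Icc[of c c] by (auto simp: null_sets_def sets_\<gamma> sets_half_line_iff)
  then show ?thesis by (rule AE_I'[where N="{c}"]) auto
next
  case False
  then show ?thesis using space_\<gamma> by (intro AE_I2) auto
qed

lemma AE_\<gamma>_out: "AE y in \<gamma>. y < a \<or> b < y"
proof -
  have "{a..b} \<in> null_sets \<gamma>"
    using emeasure_\<gamma>_Icc[of a b] a0 ab K_cases(3)[of a] K_cases(3)[of b]
    by (auto simp: null_sets_def sets_\<gamma> sets_half_line_iff)
  then show ?thesis by (rule AE_I'[where N="{a..b}"]) auto
qed

text \<open>Where the mass that leaves \<open>(z, b)\<close> goes.\<close>
definition E :: "real \<Rightarrow> real set" where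
  "E z = {0<..<p z} \<union> {b<..<q z}"

lemma E_sets: "E z \<in> sets \<gamma>"
  using a0 ab by (auto simp: sets_\<gamma> sets_half_line_iff E_def)

lemma E_antimono: "a < z \<Longrightarrow> z \<le> z' \<Longrightarrow> z' < b \<Longrightarrow> E z' \<subseteq> E z"
  using pq_decreasing[of z z'] by (cases "z = z'") (auto simp: E_def)

text \<open>The mass equation of \<open>matched\<close>: what \<open>\<gamma>\<close> puts on
  \<open>E z\<close> is the total loss on \<open>(z, b)\<close>. Open and half-open intervals agree
  because \<open>K\<close> is continuous.\<close>

lemma measure_E: assumes z: "a < z" "z < b" shows "measure \<gamma> (E z) = dF z - dF b"
proof -
  note r = pq_range[OF z]
  have "measure \<gamma> (E z) = measure \<gamma> ({0<..p z} \<union> {b<..q z})"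
  proof (rule measure_eq_AE)
    show "AE y in \<gamma>. (y \<in> E z) = (y \<in> {0<..p z} \<union> {b<..q z})"
      using AE_\<gamma>_ne[of "p z"] AE_\<gamma>_ne[of "q z"] by eventually_elim (auto simp: E_def)
  qed (use E_sets a0 ab in \<open>auto simp: sets_\<gamma> sets_half_line_iff\<close>)
  also have "\<dots> = measure \<gamma> {0<..p z} + measure \<gamma> {b<..q z}"
    using r a0 ab by (intro \<gamma>.finite_measure_Union) (auto simp: sets_\<gamma> sets_half_line_iff)
  also have "\<dots> = dF (p z) + dF (q z) - dF b"
    using r a0 ab by (simp add: measure_\<gamma>_Ioc K_cases)
  finally show ?thesis using matched_pq[OF z] by (simp add: matched_def)
qed

text \<open>The transport map read backwards: \<open>T\<close> is the common inverse of \<open>p\<close> and \<open>q\<close>. Pushing \<open>\<gamma>\<close> forward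
  along \<open>y \<mapsto> (T y, y)\<close> makes the second marginal automatic, and avoids the densities \<open>l\<close> and \<open>u\<close>.\<close>
definition T :: "real \<Rightarrow> real" where
  "T y = Sup (insert a {z. a < z \<and> z < b \<and> y \<in> E z})"

lemma T_set: "insert a {z. a < z \<and> z < b \<and> y \<in> E z} \<noteq> {}"
  "bdd_above (insert a {z. a < z \<and> z < b \<and> y \<in> E z})"
  using ab by (auto intro!: bdd_aboveI[where M=b])

lemma T_range: "a \<le> T y" "T y \<le> b"
proof -
  show "a \<le> T y" unfolding T_def using T_set by (intro cSup_upper) auto
  show "T y \<le> b" unfolding T_def using T_set ab by (intro cSup_least) auto
qed

lemma T_ge: "a < z \<Longrightarrow> z < b \<Longrightarrow> y \<in> E z \<Longrightarrow> z \<le> T y"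
  unfolding T_def using T_set by (intro cSup_upper) auto

lemma less_T_iff: "a \<le> z \<Longrightarrow> z < T y \<longleftrightarrow> (\<exists>z'>z. z' < b \<and> y \<in> E z')"
  unfolding T_def less_cSup_iff[OF T_set] by (auto dest: le_less_trans)

lemma T_gt: "a < z \<Longrightarrow> z < T y \<Longrightarrow> y \<in> E z"
  using less_T_iff[of z y] E_antimono[of z] by (meson less_imp_le subsetD)

lemma T_measurable: "T \<in> borel_measurable borel"
proof (subst borel_measurable_iff_greater, intro allI)
  fix z
  have "{y. z < T y} = (if z < a then UNIV else (\<Union>z'\<in>{z<..<b}. E z'))"
    using T_range(1) less_T_iff[of z] by (auto intro: less_le_trans)
  \<comment> \<open>The union is uncountable; it is measurable because the intervals in
    \<open>E\<close> are open.\<close>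
  moreover have "open (\<Union>z'\<in>{z<..<b}. E z')" unfolding E_def by (intro open_UN ballI open_Un) auto
  ultimately show "{y \<in> space borel. z < T y} \<in> sets borel" by auto
qed

lemma T_half_line: "T \<in> measurable \<gamma> half_line"
proof -
  have "T \<in> borel_measurable \<gamma>"
    unfolding measurable_cong_sets[OF sets_\<gamma> refl] by (rule measurable_restrict_space1[OF T_measurable])
  moreover have "T \<in> space \<gamma> \<rightarrow> {0<..}" using T_range(1) a0 by (auto intro: less_le_trans)
  ultimately show ?thesis by (intro measurable_restrict_space2)
qed

lemma T_sets: "{y \<in> space \<gamma>. z < T y} \<in> sets \<gamma>" "{y \<in> space \<gamma>. T y \<le> z} \<in> sets \<gamma>"
proof -
  have [measurable]: "T \<in> borel_measurable \<gamma>"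
    using measurable_compose[OF T_half_line measurable_id_half_line] .
  show "{y \<in> space \<gamma>. z < T y} \<in> sets \<gamma>" "{y \<in> space \<gamma>. T y \<le> z} \<in> sets \<gamma>" by measurable
qed

text \<open>The set is squeezed between \<open>E z'\<close> for \<open>z' > z\<close> and
  \<open>E z\<close>. Continuity of \<open>dF\<close> makes the masses of the outer sets meet as
  \<open>z'\<close> decreases to \<open>z\<close>; at \<open>z = a\<close> the whole mass of
  \<open>\<gamma>\<close> serves as upper bound.\<close>

lemma measure_T_gt:
  assumes z: "a \<le> z" "z < b"
  shows "measure \<gamma> {y \<in> space \<gamma>. z < T y} = dF z - dF b"
proof (rule antisym)
  show "measure \<gamma> {y \<in> space \<gamma>. z < T y} \<le> dF z - dF b"
  proof (cases "z = a")
    case True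
    then show ?thesis using \<gamma>.bounded_measure measure_\<gamma>_space by simp
  next
    case False
    then have "a < z" using z by simp
    then show ?thesis
      unfolding measure_E[OF \<open>a < z\<close> z(2), symmetric]
      using T_gt by (intro \<gamma>.finite_measure_mono E_sets) auto
  qed
  have "dF z' - dF b \<le> measure \<gamma> {y \<in> space \<gamma>. z < T y}" if z': "z < z'" "z' < b" for z'
  proof -
    have "E z' \<subseteq> {y \<in> space \<gamma>. z < T y}"
      using T_ge[of z'] z z' sets.sets_into_space[OF E_sets] by force
    then have "measure \<gamma> (E z') \<le> measure \<gamma> {y \<in> space \<gamma>. z < T y}"
      by (intro \<gamma>.finite_measure_mono T_sets)
    then show ?thesis using measure_E[of z'] z z' by simp
  qed
  then have "\<forall>\<^sub>F z' in at_right z. dF z' - dF b \<le> measure \<gamma> {y \<in> space \<gamma>. z < T y}"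
    using z by (auto simp: eventually_at_right)
  moreover have "((\<lambda>z'. dF z' - dF b) \<longlongrightarrow> dF z - dF b) (at_right z)"
    using f_cont[of z] unfolding isCont_def by (intro tendsto_intros) (rule tendsto_within_subset, auto)
  ultimately show "dF z - dF b \<le> measure \<gamma> {y \<in> space \<gamma>. z < T y}"
    by (intro tendsto_upperbound) auto
qed

definition clamp :: "real \<Rightarrow> real" where "clamp z = min (max z a) b"

text \<open>So \<open>T\<close> carries \<open>\<gamma>\<close>, the gain, to the loss on
  \<open>(a, b)\<close>; \<open>clamp\<close> extends the formula to all levels.\<close>

lemma measure_T_le: "measure \<gamma> {y \<in> space \<gamma>. T y \<le> z} = dF a - dF (clamp z)"
proof -
  consider "z < a" | "a \<le> z" "z < b" | "b \<le> z" by linarith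
  then show ?thesis
  proof cases
    case 1
    then have "\<not> T y \<le> z" for y using T_range(1)[of y] by linarith
    then have "{y \<in> space \<gamma>. T y \<le> z} = {}" by auto
    then show ?thesis using 1 ab by (simp only: measure_empty) (simp add: clamp_def)
  next
    case 2
    have "measure \<gamma> {y \<in> space \<gamma>. T y \<le> z} = measure \<gamma> (space \<gamma> - {y \<in> space \<gamma>. z < T y})"
      by (rule arg_cong[where f="measure \<gamma>"]) auto
    also have "\<dots> = measure \<gamma> (space \<gamma>) - measure \<gamma> {y \<in> space \<gamma>. z < T y}"
      by (rule \<gamma>.finite_measure_compl[OF T_sets(1)])
    finally show ?thesis using 2 measure_\<gamma>_space measure_T_gt[OF 2] by (simp add: clamp_def)
  next
    case 3
    then have "{y \<in> space \<gamma>. T y \<le> z} = space \<gamma>" by (auto intro: order_trans[OF T_range(2)])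
    then show ?thesis using 3 ab measure_\<gamma>_space by (simp add: clamp_def)
  qed
qed

text \<open>\<open>T_gt\<close> gives an inclusion of \<open>{z < T y}\<close> in
  \<open>E z\<close>, and both have the same finite mass; so they agree up to a null set. The
  right-hand side is the complement of \<open>E z\<close> within the region charged by
  \<open>\<gamma>\<close>.\<close>

lemma AE_T_le: assumes z: "a \<le> z" "z < b"
  shows "AE y in \<gamma>. T y \<le> z \<longleftrightarrow> a < z \<and> (p z < y \<and> y \<le> a \<or> q z < y)"
proof (cases "z = a")
  case True
  have "measure \<gamma> {y \<in> space \<gamma>. T y \<le> a} = 0" using measure_T_le[of a] ab by (simp add: clamp_def)
  then have "AE y in \<gamma>. \<not> T y \<le> a"
    using T_sets(2)[of a] by (subst AE_iff_measurable[OF T_sets(2)[of a]]) (auto simp: \<gamma>.emeasure_eq_measure)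
  then show ?thesis by eventually_elim (simp add: True)
next
  case False
  then have z: "a < z" "z < b" using z by auto
  have s: "{y \<in> space \<gamma>. z < T y} \<subseteq> E z" using T_gt z by auto
  have "measure \<gamma> (E z - {y \<in> space \<gamma>. z < T y}) = 0"
    using \<gamma>.finite_measure_Diff[OF E_sets T_sets(1) s] measure_E[OF z] measure_T_gt[of z] z by simp
  then have "E z - {y \<in> space \<gamma>. z < T y} \<in> null_sets \<gamma>"
    using E_sets T_sets(1) by (auto simp: null_sets_def \<gamma>.emeasure_eq_measure)
  then have "AE y in \<gamma>. y \<notin> E z - {y \<in> space \<gamma>. z < T y}" by (rule AE_not_in)
  then show ?thesis using AE_\<gamma>_ne[of "p z"] AE_\<gamma>_ne[of "q z"] AE_\<gamma>_out AE_space
  proof eventually_elim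
    case (elim y)
    have "T y \<le> z \<longleftrightarrow> y \<notin> E z" using elim(1,5) T_gt[OF z(1), of y] by force
    also have "\<dots> \<longleftrightarrow> p z < y \<and> y \<le> a \<or> q z < y"
    proof -
      have "0 < y" using elim(5) unfolding space_\<gamma> by simp
      moreover have "y < a \<or> b < y" "y \<noteq> p z" "y \<noteq> q z" using elim by auto
      ultimately show ?thesis
        unfolding E_def using pq_range[OF z] ab by (simp; linarith)
    qed
    finally show ?case using z by simp
  qed
qed

end

lemma F_cdf_Ioc:
  assumes "sets M = sets half_line" "finite_measure M" "0 \<le> s" "s \<le> t"
  shows "measure M {s<..t} = F_cdf M t - F_cdf M s"
proof -
  have "{0<..x} \<in> sets M" for x using assms(1) by (auto simp: sets_half_line_iff)
  moreover have "{0<..t} - {0<..s} = {s<..t}" "{0<..s} \<subseteq> {0<..t}" using assms by auto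
  ultimately show ?thesis
    using finite_measure.finite_measure_Diff[OF assms(2), of "{0<..t}" "{0<..s}"]
    by (simp add: F_cdf_def)
qed

lemma F_cdf_Ioi:
  assumes "sets M = sets half_line" "finite_measure M" "0 \<le> s"
  shows "measure M {s<..} = measure M (space M) - F_cdf M s"
proof -
  have "space M - {0<..s} = {s<..}" unfolding space_eq_half_line[OF assms(1)] using assms(3) by auto
  moreover have "{0<..s} \<in> sets M" using assms(1) by (auto simp: sets_half_line_iff)
  ultimately show ?thesis
    using finite_measure.finite_measure_compl[OF assms(2), of "{0<..s}"] by (simp add: F_cdf_def)
qed

text \<open>Turns first moments into masses: its distribution function is \<open>G_cdf\<close>, so
  statements about \<open>F_cdf\<close> can be reused for moments.\<close>

definition size_biased :: "real measure \<Rightarrow> real measure" where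
  "size_biased M = density M (\<lambda>y. ennreal y)"

lemma size_biased_sets [simp]: "sets (size_biased M) = sets M"
  by (simp add: size_biased_def)

lemma emeasure_size_biased:
  assumes "sets M = sets half_line" "A \<in> sets half_line"
  shows "emeasure (size_biased M) A = (\<integral>\<^sup>+y. ennreal y * indicator A y \<partial>M)"
proof -
  have "(\<lambda>y. ennreal y) \<in> borel_measurable M"
    unfolding measurable_cong_sets[OF assms(1) refl] by simp
  then show ?thesis
    using assms unfolding size_biased_def by (simp add: emeasure_density)
qed

lemma size_biased_P1:
  assumes "\<mu> \<in> P1"
  shows "prob_space (size_biased \<mu>)" "F_cdf (size_biased \<mu>) = G_cdf \<mu>"
proof -
  note P = P1D[OF assms]
  have sp: "space (size_biased \<mu>) = {0<..}"
    by (rule space_eq_half_line) (simp add: P)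
  have "emeasure (size_biased \<mu>) (space (size_biased \<mu>)) = (\<integral>\<^sup>+y. ennreal y * indicator {0<..} y \<partial>\<mu>)"
    unfolding sp by (rule emeasure_size_biased[OF P(2)]) (simp add: sets_half_line_iff)
  also have "\<dots> = (\<integral>\<^sup>+y. ennreal y \<partial>\<mu>)"
    using P1_pos[OF assms] by (intro nn_integral_cong) (simp add: indicator_def)
  finally show "prob_space (size_biased \<mu>)" using P(5) by (intro prob_spaceI) simp
  show "F_cdf (size_biased \<mu>) = G_cdf \<mu>"
  proof
    fix x
    have nn: "0 \<le> indicator {0<..x} y * y" for y :: real by (simp add: indicator_def)
    have "emeasure (size_biased \<mu>) {0<..x} = (\<integral>\<^sup>+y. ennreal y * indicator {0<..x} y \<partial>\<mu>)"
      by (rule emeasure_size_biased[OF P(2)]) (auto simp: sets_half_line_iff)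
    also have "\<dots> = (\<integral>\<^sup>+y. ennreal (indicator {0<..x} y * y) \<partial>\<mu>)"
      by (intro nn_integral_cong) (simp add: indicator_def)
    also have "\<dots> = ennreal (G_cdf \<mu> x)"
      unfolding G_cdf_def using nn
      by (intro nn_integral_eq_integral integrable_indicator_Ioc[OF assms] AE_I2)
    finally show "F_cdf (size_biased \<mu>) x = G_cdf \<mu> x"
      using nn by (simp add: F_cdf_def measure_def G_cdf_def)
  qed
qed

text \<open>The sum is a \<open>bind\<close> over counting measure on three indices, for which
  integration over the index is plain addition; the summands must be subprobabilities to form a
  kernel.\<close>

lemma sum_of_three_measures:
  assumes "subprob_space N0" "subprob_space N1" "subprob_space N2"
    and s: "sets N0 = sets R" "sets N1 = sets R" "sets N2 = sets R"
  obtains M where "sets M = sets R"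
    "\<And>f. f \<in> borel_measurable R \<Longrightarrow>
      (\<integral>\<^sup>+x. f x \<partial>M) = (\<integral>\<^sup>+x. f x \<partial>N0) + (\<integral>\<^sup>+x. f x \<partial>N1) + (\<integral>\<^sup>+x. f x \<partial>N2)"
proof -
  let ?N = "\<lambda>i :: nat. if i = 0 then N0 else if i = 1 then N1 else N2"
  let ?C = "count_space {0, 1, 2 :: nat}"
  have N: "?N \<in> measurable ?C (subprob_algebra R)"
    using assms by (auto simp: measurable_count_space_eq1 space_subprob_algebra)
  show thesis
  proof (rule that[of "?C \<bind> ?N"])
    show "sets (?C \<bind> ?N) = sets R" by (rule sets_bind) (use s in auto)
    fix f :: "_ \<Rightarrow> ennreal" assume "f \<in> borel_measurable R"
    then show "(\<integral>\<^sup>+x. f x \<partial>(?C \<bind> ?N)) = (\<integral>\<^sup>+x. f x \<partial>N0) + (\<integral>\<^sup>+x. f x \<partial>N1) + (\<integral>\<^sup>+x. f x \<partial>N2)"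
      by (subst nn_integral_bind[OF _ N]) (simp_all add: nn_integral_count_space_finite add.assoc)
  qed
qed

lemma measurable_diagonal: "(\<lambda>x. (x, x)) \<in> measurable half_line quadrant"
  by (intro measurable_Pair) simp_all

lemma subprob_diagonal:
  assumes "\<mu> \<in> P1" "A \<in> sets half_line"
  shows "subprob_space (distr (density \<mu> (indicator A)) quadrant (\<lambda>x. (x, x)))"
    and "f \<in> borel_measurable quadrant \<Longrightarrow>
      (\<integral>\<^sup>+\<omega>. f \<omega> \<partial>distr (density \<mu> (indicator A)) quadrant (\<lambda>x. (x, x))) =
      (\<integral>\<^sup>+x. indicator A x * f (x, x) \<partial>\<mu>)"
proof -
  note P = P1D[OF assms(1)]
  have d: "(\<lambda>x. (x, x)) \<in> measurable \<mu> quadrant"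
    unfolding measurable_cong_sets[OF P(2) refl] by (rule measurable_diagonal)
  then have d': "(\<lambda>x. (x, x)) \<in> measurable (density \<mu> (indicator A)) quadrant" by simp
  have A: "A \<in> sets \<mu>" using assms P by simp
  show nn: "(\<integral>\<^sup>+\<omega>. f \<omega> \<partial>distr (density \<mu> (indicator A)) quadrant (\<lambda>x. (x, x))) =
      (\<integral>\<^sup>+x. indicator A x * f (x, x) \<partial>\<mu>)" if f: "f \<in> borel_measurable quadrant" for f
    using measurable_compose[OF d f] A f
    by (subst nn_integral_distr[OF d']) (simp_all add: nn_integral_density)
  show "subprob_space (distr (density \<mu> (indicator A)) quadrant (\<lambda>x. (x, x)))" (is "subprob_space ?N")
  proof (rule subprob_spaceI)
    have "emeasure ?N (space ?N) = (\<integral>\<^sup>+\<omega>. 1 \<partial>?N)" by simp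
    also have "\<dots> = emeasure \<mu> A" using nn[of "\<lambda>_. 1"] A by simp
    also have "\<dots> \<le> 1" using prob_space.emeasure_le_1[OF P(1)] .
    finally show "emeasure ?N (space ?N) \<le> 1" .
    have "(1, 1) \<in> space ?N" by (simp add: space_pair_measure space_restrict_space)
    then show "space ?N \<noteq> {}" by auto
  qed
qed

context hk_marginals
begin

definition outside :: "real set" where "outside = {0<..a} \<union> {b<..}"

lemma outside_sets: "outside \<in> sets half_line" "{a<..b} \<in> sets half_line" "{0<..z} \<in> sets half_line"
  using a0 ab by (auto simp: outside_def sets_half_line_iff)

lemma T_pair_measurable: "(\<lambda>y. (T y, y)) \<in> measurable \<gamma> quadrant"
proof -
  have "(\<lambda>y. y) \<in> measurable \<gamma> half_line"
    unfolding measurable_cong_sets[OF sets_\<gamma> refl] by simp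
  then show ?thesis using T_half_line by (intro measurable_Pair)
qed

text \<open>The common part of \<open>\<mu>\<close> and \<open>\<nu>\<close> stays put, and the rest is coupled by \<open>T\<close>.\<close>
definition is_hk_sum :: "(real \<times> real) measure \<Rightarrow> bool" where
  "is_hk_sum Q \<longleftrightarrow> sets Q = sets quadrant \<and> (\<forall>f \<in> borel_measurable quadrant.
     (\<integral>\<^sup>+\<omega>. f \<omega> \<partial>Q) = (\<integral>\<^sup>+x. indicator outside x * f (x, x) \<partial>\<mu>) +
       (\<integral>\<^sup>+x. indicator {a<..b} x * f (x, x) \<partial>\<nu>) + (\<integral>\<^sup>+y. f (T y, y) \<partial>\<gamma>))"

lemma hk_sum_exists: obtains Q where "is_hk_sum Q"
proof -
  let ?N = "distr \<gamma> quadrant (\<lambda>y. (T y, y))"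
  have "subprob_space ?N"
  proof (rule subprob_spaceI)
    have "emeasure ?N (space ?N) = emeasure \<gamma> (space \<gamma>)"
      using T_pair_measurable measurable_space[OF T_pair_measurable]
      by (subst emeasure_distr) (auto intro!: arg_cong[where f="emeasure \<gamma>"])
    also have "\<dots> \<le> 1"
    proof -
      \<comment> \<open>The mass \<open>dF a - dF b\<close> is what \<open>\<mu>\<close> has on
        \<open>(a, b]\<close> minus what \<open>\<nu>\<close> has there, hence at most 1.\<close>
      have "F_cdf \<nu> a \<le> F_cdf \<nu> b" "F_cdf \<mu> b - F_cdf \<mu> a \<le> 1"
      proof -
        interpret m: prob_space \<mu> by (rule P1D(1)[OF \<mu>])
        interpret n: prob_space \<nu> by (rule P1D(1)[OF \<nu>])
        show "F_cdf \<nu> a \<le> F_cdf \<nu> b"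
          unfolding F_cdf_def using ab P1D(2)[OF \<nu>]
          by (intro n.finite_measure_mono) (auto simp: sets_half_line_iff)
        have "F_cdf \<mu> b \<le> 1" "0 \<le> F_cdf \<mu> a" unfolding F_cdf_def by simp_all
        then show "F_cdf \<mu> b - F_cdf \<mu> a \<le> 1" by simp
      qed
      then show ?thesis by (simp add: emeasure_\<gamma>_space delta_F_def ennreal_le_1)
    qed
    finally show "emeasure ?N (space ?N) \<le> 1" .
    have "(1, 1) \<in> space ?N" by (simp add: space_pair_measure space_restrict_space)
    then show "space ?N \<noteq> {}" by auto
  qed
  then obtain Q where Q: "sets Q = sets quadrant"
    "\<And>f. f \<in> borel_measurable quadrant \<Longrightarrow> (\<integral>\<^sup>+x. f x \<partial>Q) =
      (\<integral>\<^sup>+x. f x \<partial>distr (density \<mu> (indicator outside)) quadrant (\<lambda>x. (x, x))) +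
      (\<integral>\<^sup>+x. f x \<partial>distr (density \<nu> (indicator {a<..b})) quadrant (\<lambda>x. (x, x))) +
      (\<integral>\<^sup>+x. f x \<partial>?N)"
    by (rule sum_of_three_measures[OF subprob_diagonal(1)[OF \<mu> outside_sets(1)]
      subprob_diagonal(1)[OF \<nu> outside_sets(2)] _ sets_distr sets_distr sets_distr]) blast
  have "is_hk_sum Q"
    unfolding is_hk_sum_def
    using Q subprob_diagonal(2)[OF \<mu> outside_sets(1)] subprob_diagonal(2)[OF \<nu> outside_sets(2)]
    by (auto simp: nn_integral_distr[OF T_pair_measurable])
  then show thesis by (rule that)
qed

lemma measure_pieces:
  assumes M: "sets M = sets half_line" "finite_measure M" and z: "0 < z"
  shows "measure M (outside \<inter> {0<..z}) = F_cdf M (min z a) + F_cdf M (max z b) - F_cdf M b"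
    "measure M ({a<..b} \<inter> {0<..z}) = F_cdf M (clamp z) - F_cdf M a"
proof -
  have "outside \<inter> {0<..z} = {0<..min z a} \<union> {b<..max z b}"
    using a0 ab by (auto simp: outside_def)
  also have "measure M \<dots> = measure M {0<..min z a} + measure M {b<..max z b}"
    using M a0 ab by (intro finite_measure.finite_measure_Union) (auto simp: sets_half_line_iff)
  finally show "measure M (outside \<inter> {0<..z}) = F_cdf M (min z a) + F_cdf M (max z b) - F_cdf M b"
    using F_cdf_Ioc[OF M, of b "max z b"] a0 ab by (simp add: F_cdf_def)
  have "{a<..b} \<inter> {0<..z} = {a<..clamp z}"
    using a0 ab by (auto simp: clamp_def)
  then show "measure M ({a<..b} \<inter> {0<..z}) = F_cdf M (clamp z) - F_cdf M a"
    using F_cdf_Ioc[OF M, of a "clamp z"] a0 ab by (simp add: clamp_def)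
qed

text \<open>The shared telescoping identity: it is used with \<open>F_cdf \<mu>\<close> and
  \<open>F_cdf \<nu>\<close> for the marginals and with \<open>G_cdf \<mu>\<close> for the
  martingale property.\<close>

lemma sum_pieces:
  fixes H :: "real \<Rightarrow> real"
  shows "H (min z a) + H (max z b) - H b + (H (clamp z) - H a) = H z"
  using ab by (auto simp: clamp_def min_def max_def)

lemma K_pieces: "0 < z \<Longrightarrow> K z = dF (min z a) + dF (max z b) - dF b"
  by (simp add: K_def)

section \<open>The glued measure: marginals, martingale property, pattern\<close>

context
  fixes Q assumes Q: "is_hk_sum Q"
begin

lemma Q_sets: "sets Q = sets quadrant"
  using Q by (simp add: is_hk_sum_def)

lemma nn_Q: "f \<in> borel_measurable quadrant \<Longrightarrow>
    (\<integral>\<^sup>+\<omega>. f \<omega> \<partial>Q) = (\<integral>\<^sup>+x. indicator outside x * f (x, x) \<partial>\<mu>) +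
       (\<integral>\<^sup>+x. indicator {a<..b} x * f (x, x) \<partial>\<nu>) + (\<integral>\<^sup>+y. f (T y, y) \<partial>\<gamma>)"
  using Q by (simp add: is_hk_sum_def)

lemma nn_indicator_inter:
  assumes "sets M = sets half_line" "A \<in> sets half_line" "B \<in> sets half_line"
  shows "(\<integral>\<^sup>+x. indicator A x * indicator B x \<partial>M) = emeasure M (A \<inter> B)"
  using assms by (simp add: indicator_inter_arith[symmetric])

lemma Q_first_marginal: "distr Q half_line fst = \<mu>"
proof (rule half_line_measure_eqI[OF _ _ P1D(2)[OF \<mu>]])
  interpret m: prob_space \<mu> by (rule P1D(1)[OF \<mu>])
  interpret n: prob_space \<nu> by (rule P1D(1)[OF \<nu>])
  show "sets (distr Q half_line fst) = sets half_line" by simp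
  show fm: "finite_measure \<mu>" by unfold_locales
  have eq: "emeasure (distr Q half_line fst) {0<..z} = emeasure \<mu> {0<..z}" if z: "0 < z" for z
  proof -
    have "emeasure (distr Q half_line fst) {0<..z} = (\<integral>\<^sup>+x. indicator {0<..z} x \<partial>distr Q half_line fst)"
      using outside_sets(3) by simp
    also have "\<dots> = (\<integral>\<^sup>+\<omega>. indicator {0<..z} (fst \<omega>) \<partial>Q)"
      using outside_sets(3)[of z] by (intro nn_integral_distr quadrant_measurable[OF Q_sets]) simp
    also have "\<dots> = (\<integral>\<^sup>+x. indicator outside x * indicator {0<..z} x \<partial>\<mu>) +
       (\<integral>\<^sup>+x. indicator {a<..b} x * indicator {0<..z} x \<partial>\<nu>) + (\<integral>\<^sup>+y. indicator {0<..z} (T y) \<partial>\<gamma>)"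
      using outside_sets(3)[of z] by (subst nn_Q) simp_all
    also have "(\<integral>\<^sup>+y. indicator {0<..z} (T y) \<partial>\<gamma>) = (\<integral>\<^sup>+y. indicator {y \<in> space \<gamma>. T y \<le> z} y \<partial>\<gamma>)"
      using T_range(1) a0 by (intro nn_integral_cong) (auto simp: indicator_def intro: less_le_trans)
    also have "\<dots> = emeasure \<gamma> {y \<in> space \<gamma>. T y \<le> z}"
      by (rule nn_integral_indicator[OF T_sets(2)])
    also have "(\<integral>\<^sup>+x. indicator outside x * indicator {0<..z} x \<partial>\<mu>) +
       (\<integral>\<^sup>+x. indicator {a<..b} x * indicator {0<..z} x \<partial>\<nu>) + emeasure \<gamma> {y \<in> space \<gamma>. T y \<le> z} =
       ennreal (measure \<mu> (outside \<inter> {0<..z})) + ennreal (measure \<nu> ({a<..b} \<inter> {0<..z})) +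
         ennreal (measure \<gamma> {y \<in> space \<gamma>. T y \<le> z})"
      by (simp add: nn_indicator_inter P1D(2) \<mu> \<nu> outside_sets m.emeasure_eq_measure
          n.emeasure_eq_measure \<gamma>.emeasure_eq_measure)
    also have "\<dots> = ennreal (measure \<mu> (outside \<inter> {0<..z}) + measure \<nu> ({a<..b} \<inter> {0<..z}) +
         measure \<gamma> {y \<in> space \<gamma>. T y \<le> z})"
      by (simp add: ennreal_plus)
    also have "measure \<mu> (outside \<inter> {0<..z}) + measure \<nu> ({a<..b} \<inter> {0<..z}) +
         measure \<gamma> {y \<in> space \<gamma>. T y \<le> z} = F_cdf \<mu> z"
      unfolding measure_pieces(1)[OF P1D(2)[OF \<mu>] m.finite_measure_axioms z]
        measure_pieces(2)[OF P1D(2)[OF \<nu>] n.finite_measure_axioms z] measure_T_le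
      \<comment> \<open>The mass arriving through \<open>T\<close> turns the increment of
        \<open>F_cdf \<nu>\<close> on \<open>(a, clamp z]\<close> into that of
        \<open>F_cdf \<mu>\<close>.\<close>
      using sum_pieces[of "F_cdf \<mu>" z] by (simp add: delta_F_def)
    finally show ?thesis by (simp add: F_cdf_def m.emeasure_eq_measure)
  qed
  show "emeasure (distr Q half_line fst) {0<..z} = emeasure \<mu> {0<..z}" if "0 < z" for z
    using eq that .
  have "emeasure Q (space Q) = (\<integral>\<^sup>+\<omega>. 1 \<partial>Q)" by simp
  also have "\<dots> = emeasure \<mu> outside + emeasure \<nu> {a<..b} + emeasure \<gamma> (space \<gamma>)"
    using nn_Q[of "\<lambda>_. 1"] outside_sets P1D(2)[OF \<mu>] P1D(2)[OF \<nu>] by simp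
  also have "\<dots> < \<infinity>"
    by (simp add: m.emeasure_eq_measure n.emeasure_eq_measure \<gamma>.emeasure_eq_measure flip: ennreal_plus)
  finally have "finite_measure Q" by (intro finite_measureI) simp
  then show "finite_measure (distr Q half_line fst)"
    by (rule finite_measure.finite_measure_distr) (rule quadrant_measurable(1)[OF Q_sets])
qed

lemma Q_prob_space: "prob_space Q"
proof (rule prob_spaceI)
  have "emeasure Q (space Q) = emeasure (distr Q half_line fst) (space (distr Q half_line fst))"
    using quadrant_measurable(1)[OF Q_sets] measurable_space[OF quadrant_measurable(1)[OF Q_sets]]
    by (subst emeasure_distr) (auto simp: sets_half_line_iff intro!: arg_cong[where f="emeasure Q"])
  then show "emeasure Q (space Q) = 1"
    using prob_space.emeasure_space_1[OF P1D(1)[OF \<mu>]] by (simp only: Q_first_marginal)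
qed

lemma Q_second_marginal: "distr Q half_line snd = \<nu>"
proof (rule half_line_measure_eqI[OF _ _ P1D(2)[OF \<nu>]])
  interpret m: prob_space \<mu> by (rule P1D(1)[OF \<mu>])
  interpret n: prob_space \<nu> by (rule P1D(1)[OF \<nu>])
  show "sets (distr Q half_line snd) = sets half_line" by simp
  show "finite_measure \<nu>" by unfold_locales
  show "finite_measure (distr Q half_line snd)"
    by (rule finite_measure.finite_measure_distr[OF prob_space.finite_measure[OF Q_prob_space]])
      (rule quadrant_measurable(2)[OF Q_sets])
  show "emeasure (distr Q half_line snd) {0<..z} = emeasure \<nu> {0<..z}" if z: "0 < z" for z
  proof -
    have "emeasure (distr Q half_line snd) {0<..z} = (\<integral>\<^sup>+x. indicator {0<..z} x \<partial>distr Q half_line snd)"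
      using outside_sets(3) by simp
    also have "\<dots> = (\<integral>\<^sup>+\<omega>. indicator {0<..z} (snd \<omega>) \<partial>Q)"
      using outside_sets(3)[of z] by (intro nn_integral_distr quadrant_measurable[OF Q_sets]) simp
    also have "\<dots> = (\<integral>\<^sup>+x. indicator outside x * indicator {0<..z} x \<partial>\<mu>) +
       (\<integral>\<^sup>+x. indicator {a<..b} x * indicator {0<..z} x \<partial>\<nu>) + (\<integral>\<^sup>+y. indicator {0<..z} y \<partial>\<gamma>)"
      using outside_sets(3)[of z] by (subst nn_Q) simp_all
    also have "\<dots> =
       ennreal (measure \<mu> (outside \<inter> {0<..z})) + ennreal (measure \<nu> ({a<..b} \<inter> {0<..z})) +
         ennreal (measure \<gamma> {0<..z})"
      using outside_sets(3)[of z]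
      by (simp add: nn_indicator_inter P1D(2) \<mu> \<nu> sets_\<gamma> outside_sets m.emeasure_eq_measure
          n.emeasure_eq_measure \<gamma>.emeasure_eq_measure)
    also have "\<dots> = ennreal (measure \<mu> (outside \<inter> {0<..z}) + measure \<nu> ({a<..b} \<inter> {0<..z}) +
         measure \<gamma> {0<..z})"
      by (simp add: ennreal_plus)
    also have "measure \<gamma> {0<..z} = dF (min z a) + dF (max z b) - dF b"
      using measure_\<gamma>_Ioc[of 0 z] z by (simp add: K_cases(1)[of 0] K_pieces)
    also have "measure \<mu> (outside \<inter> {0<..z}) + measure \<nu> ({a<..b} \<inter> {0<..z}) +
         (dF (min z a) + dF (max z b) - dF b) = F_cdf \<nu> z"
      unfolding measure_pieces(1)[OF P1D(2)[OF \<mu>] m.finite_measure_axioms z]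
        measure_pieces(2)[OF P1D(2)[OF \<nu>] n.finite_measure_axioms z]
      using sum_pieces[of "F_cdf \<nu>" z] by (simp add: delta_F_def)
    finally show ?thesis by (simp add: F_cdf_def n.emeasure_eq_measure)
  qed
qed

text \<open>The second marginal, read as a decomposition of \<open>\<nu>\<close>. It shows that
  \<open>\<gamma>\<close> is dominated by \<open>\<nu>\<close>, hence has finite first moment, and
  that on \<open>outside\<close> it accounts for the excess of \<open>\<nu>\<close> over
  \<open>\<mu>\<close>.\<close>

lemma nn_snd:
  assumes f: "f \<in> borel_measurable half_line"
  shows "(\<integral>\<^sup>+y. f y \<partial>\<nu>) = (\<integral>\<^sup>+x. indicator outside x * f x \<partial>\<mu>) +
       (\<integral>\<^sup>+x. indicator {a<..b} x * f x \<partial>\<nu>) + (\<integral>\<^sup>+y. f y \<partial>\<gamma>)"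
proof -
  have "(\<integral>\<^sup>+y. f y \<partial>\<nu>) = (\<integral>\<^sup>+y. f y \<partial>distr Q half_line snd)" by (simp only: Q_second_marginal)
  also have "\<dots> = (\<integral>\<^sup>+\<omega>. f (snd \<omega>) \<partial>Q)"
    using f by (intro nn_integral_distr quadrant_measurable[OF Q_sets]) simp
  also have "\<dots> = (\<integral>\<^sup>+x. indicator outside x * f x \<partial>\<mu>) +
       (\<integral>\<^sup>+x. indicator {a<..b} x * f x \<partial>\<nu>) + (\<integral>\<^sup>+y. f y \<partial>\<gamma>)"
    using f by (subst nn_Q) simp_all
  finally show ?thesis .
qed

abbreviation "\<gamma>1 \<equiv> size_biased \<gamma>"

lemma \<gamma>1_finite: "finite_measure \<gamma>1"
proof (rule finite_measureI)
  have sp: "space \<gamma>1 = {0<..}" by (rule space_eq_half_line) (simp add: sets_\<gamma>)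
  have "emeasure \<gamma>1 (space \<gamma>1) = (\<integral>\<^sup>+y. ennreal y * indicator {0<..} y \<partial>\<gamma>)"
    unfolding sp by (rule emeasure_size_biased[OF sets_\<gamma>]) (simp add: sets_half_line_iff)
  also have "\<dots> \<le> (\<integral>\<^sup>+y. ennreal y \<partial>\<gamma>)"
    by (intro nn_integral_mono) (simp add: indicator_def)
  also have "\<dots> \<le> (\<integral>\<^sup>+y. ennreal y \<partial>\<nu>)"
  proof -
    have e: "(\<integral>\<^sup>+y. ennreal y \<partial>\<nu>) = (\<integral>\<^sup>+x. indicator outside x * ennreal x \<partial>\<mu>) +
       (\<integral>\<^sup>+x. indicator {a<..b} x * ennreal x \<partial>\<nu>) + (\<integral>\<^sup>+y. ennreal y \<partial>\<gamma>)"
      by (rule nn_snd) simp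
    show ?thesis by (subst e, intro add_increasing) simp_all
  qed
  also have "\<dots> = 1" by (rule P1D(5)[OF \<nu>])
  finally show "emeasure \<gamma>1 (space \<gamma>1) \<noteq> \<infinity>" by (auto simp: top_unique)
qed

lemma measure_\<gamma>1:
  assumes A: "A \<in> sets half_line" "A \<subseteq> outside"
  shows "measure \<gamma>1 A = measure (size_biased \<nu>) A - measure (size_biased \<mu>) A"
proof -
  interpret m: prob_space "size_biased \<mu>" by (rule size_biased_P1(1)[OF \<mu>])
  interpret n: prob_space "size_biased \<nu>" by (rule size_biased_P1(1)[OF \<nu>])
  interpret g: finite_measure \<gamma>1 by (rule \<gamma>1_finite)
  have f: "(\<lambda>y. ennreal y * indicator A y) \<in> borel_measurable half_line" using A by simp
  have "(\<integral>\<^sup>+x. indicator outside x * (ennreal x * indicator A x) \<partial>\<mu>) = (\<integral>\<^sup>+x. ennreal x * indicator A x \<partial>\<mu>)"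
    using A(2) by (intro nn_integral_cong) (auto simp: indicator_def)
  moreover have "(\<integral>\<^sup>+x. indicator {a<..b} x * (ennreal x * indicator A x) \<partial>\<nu>) = (\<integral>\<^sup>+x. 0 \<partial>\<nu>)"
    using A(2) by (intro nn_integral_cong) (auto simp: indicator_def outside_def)
  ultimately have "emeasure (size_biased \<nu>) A = emeasure (size_biased \<mu>) A + emeasure \<gamma>1 A"
    using nn_snd[OF f] A by (simp add: emeasure_size_biased P1D(2) \<mu> \<nu> sets_\<gamma>)
  then have "ennreal (measure (size_biased \<nu>) A) = ennreal (measure (size_biased \<mu>) A + measure \<gamma>1 A)"
    by (simp add: m.emeasure_eq_measure n.emeasure_eq_measure g.emeasure_eq_measure ennreal_plus)
  then show ?thesis by (subst (asm) ennreal_inj) auto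
qed

lemma size_biased_facts:
  "sets (size_biased \<mu>) = sets half_line" "finite_measure (size_biased \<mu>)"
  "sets (size_biased \<nu>) = sets half_line" "finite_measure (size_biased \<nu>)"
  "measure (size_biased \<mu>) (space (size_biased \<mu>)) = 1"
  "measure (size_biased \<nu>) (space (size_biased \<nu>)) = 1"
  using size_biased_P1(1)[OF \<mu>] size_biased_P1(1)[OF \<nu>] P1D(2)[OF \<mu>] P1D(2)[OF \<nu>]
  by (auto intro: prob_space.finite_measure prob_space.prob_space)

lemma measure_\<gamma>1_Ioc:
  assumes "0 \<le> s" "s \<le> t" "t \<le> a"
  shows "measure \<gamma>1 {s<..t} = dG t - dG s"
proof -
  have "{s<..t} \<subseteq> outside" "{s<..t} \<in> sets half_line"
    using assms by (auto simp: outside_def sets_half_line_iff)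
  then show ?thesis
    using F_cdf_Ioc[OF size_biased_facts(1,2) assms(1,2)] F_cdf_Ioc[OF size_biased_facts(3,4) assms(1,2)]
      size_biased_P1(2)[OF \<mu>] size_biased_P1(2)[OF \<nu>]
    by (simp add: measure_\<gamma>1 delta_G_def)
qed

text \<open>The tails are complements in total moment, and both total moments are 1, so only
  \<open>- dG s\<close> survives.\<close>

lemma measure_\<gamma>1_Ioi:
  assumes "b \<le> s"
  shows "measure \<gamma>1 {s<..} = - dG s"
proof -
  have s0: "0 \<le> s" using assms a0 ab by simp
  have "{s<..} \<subseteq> outside" "{s<..} \<in> sets half_line"
    using assms s0 by (auto simp: outside_def sets_half_line_iff)
  then show ?thesis
    using F_cdf_Ioi[OF size_biased_facts(1,2) s0] F_cdf_Ioi[OF size_biased_facts(3,4) s0]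
      size_biased_P1(2)[OF \<mu>] size_biased_P1(2)[OF \<nu>] size_biased_facts(5,6)
    by (simp add: measure_\<gamma>1 delta_G_def)
qed

lemma AE_\<gamma>1: "AE y in \<gamma>. P y \<Longrightarrow> AE y in \<gamma>1. P y"
proof -
  assume P: "AE y in \<gamma>. P y"
  have m: "(\<lambda>y. ennreal y) \<in> borel_measurable \<gamma>"
    unfolding measurable_cong_sets[OF sets_\<gamma> refl] by simp
  show "AE y in \<gamma>1. P y"
    unfolding size_biased_def AE_density[OF m] using P by eventually_elim simp
qed

lemma measure_\<gamma>1_two_intervals:
  assumes "0 \<le> s" "s \<le> a" "b \<le> t"
  shows "measure \<gamma>1 ({s<..a} \<union> {t<..}) = dG a - dG s - dG t"
proof -
  interpret g: finite_measure \<gamma>1 by (rule \<gamma>1_finite)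
  have "measure \<gamma>1 ({s<..a} \<union> {t<..}) = measure \<gamma>1 {s<..a} + measure \<gamma>1 {t<..}"
    using assms a0 ab by (intro g.finite_measure_Union) (auto simp: sets_\<gamma> sets_half_line_iff)
  then show ?thesis using assms by (simp add: measure_\<gamma>1_Ioc measure_\<gamma>1_Ioi)
qed

text \<open>The moment counterpart of \<open>measure_T_le\<close>, resting on the moment equation of
  \<open>matched\<close>: the mass that \<open>T\<close> sends below \<open>z\<close> has exactly
  the first moment lost on \<open>(a, clamp z)\<close>. This is the martingale property of the
  moving part.\<close>

lemma measure_\<gamma>1_T_le: "measure \<gamma>1 {y \<in> space \<gamma>. T y \<le> z} = dG a - dG (clamp z)"
proof -
  have cong: "measure \<gamma>1 {y \<in> space \<gamma>. T y \<le> z} = measure \<gamma>1 B"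
    if "AE y in \<gamma>. T y \<le> z \<longleftrightarrow> y \<in> B" "B \<in> sets half_line" for B
  proof (rule measure_eq_AE)
    show "AE y in \<gamma>1. (y \<in> {y \<in> space \<gamma>. T y \<le> z}) = (y \<in> B)"
      by (rule AE_\<gamma>1) (use that(1) AE_space in eventually_elim, auto)
  qed (use that T_sets sets_\<gamma> in auto)
  consider "z < a" | "z = a" | "a < z" "z < b" | "b \<le> z" by linarith
  then show ?thesis
  proof cases
    case 1
    have "measure \<gamma>1 {y \<in> space \<gamma>. T y \<le> z} = measure \<gamma>1 {}"
    proof (rule cong)
      have "\<not> T y \<le> z" for y using T_range(1)[of y] 1 by linarith
      then show "AE y in \<gamma>. T y \<le> z \<longleftrightarrow> y \<in> {}" by simp
    qed simp
    then show ?thesis using 1 ab by (simp add: clamp_def)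
  next
    case 2
    have "measure \<gamma>1 {y \<in> space \<gamma>. T y \<le> z} = measure \<gamma>1 {}"
      by (rule cong) (use AE_T_le[of a] ab 2 in simp_all)
    then show ?thesis using 2 ab by (simp add: clamp_def)
  next
    case 3
    note r = pq_range[OF 3]
    have "measure \<gamma>1 {y \<in> space \<gamma>. T y \<le> z} = measure \<gamma>1 ({p z<..a} \<union> {q z<..})"
    proof (rule cong)
      show "AE y in \<gamma>. T y \<le> z \<longleftrightarrow> y \<in> {p z<..a} \<union> {q z<..}"
        using AE_T_le[of z] 3 by simp
      show "{p z<..a} \<union> {q z<..} \<in> sets half_line"
        using r a0 ab by (auto simp: sets_half_line_iff)
    qed
    also have "\<dots> = dG a - dG (p z) - dG (q z)"
      using r by (intro measure_\<gamma>1_two_intervals) auto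
    also have "\<dots> = dG a - dG z"
      using matched_pq[OF 3] by (simp add: matched_def)
    finally show ?thesis using 3 by (simp add: clamp_def)
  next
    case 4
    have "measure \<gamma>1 {y \<in> space \<gamma>. T y \<le> z} = measure \<gamma>1 ({0<..a} \<union> {b<..})"
    proof (rule cong)
      have T: "T y \<le> z" for y using T_range(2)[of y] 4 by linarith
      show "AE y in \<gamma>. T y \<le> z \<longleftrightarrow> y \<in> {0<..a} \<union> {b<..}"
        using AE_\<gamma>_out AE_space
      proof eventually_elim
        case (elim y)
        then have "0 < y" unfolding space_\<gamma> by simp
        then show ?case using elim(1) T[of y] by auto
      qed
      show "{0<..a} \<union> {b<..} \<in> sets half_line"
        using a0 ab by (auto simp: sets_half_line_iff)
    qed
    also have "\<dots> = dG a - dG 0 - dG b"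
      using a0 by (intro measure_\<gamma>1_two_intervals) auto
    finally show ?thesis using 4 ab G0 by (simp add: clamp_def)
  qed
qed

text \<open>It suffices to compare the two measures on \<open>{0<..z}\<close>. There the weight
  \<open>snd \<omega>\<close> yields the same pieces as the first marginal, with
  \<open>G_cdf\<close> in place of \<open>F_cdf\<close>, and they telescope to
  \<open>G_cdf \<mu> z\<close>.\<close>

lemma Q_reproduces_mean: "reproduces_mean Q"
  unfolding reproduces_mean_def
proof (rule half_line_measure_eqI)
  interpret m: prob_space "size_biased \<mu>" by (rule size_biased_P1(1)[OF \<mu>])
  interpret n: prob_space "size_biased \<nu>" by (rule size_biased_P1(1)[OF \<nu>])
  interpret g: finite_measure \<gamma>1 by (rule \<gamma>1_finite)
  note int = coupling_integrals(3,4)[OF \<mu> \<nu> Q_sets Q_first_marginal Q_second_marginal]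
  have fin: "finite_measure (distr (density Q h) half_line fst)"
    if "(\<integral>\<^sup>+\<omega>. h \<omega> \<partial>Q) = 1" "h \<in> borel_measurable Q" for h
  proof (rule finite_measure.finite_measure_distr)
    show "finite_measure (density Q h)"
      using that by (intro finite_measureI) (simp add: emeasure_density cong: nn_integral_cong)
    show "fst \<in> measurable (density Q h) half_line"
      using quadrant_measurable(1)[OF Q_sets] by simp
  qed
  show "finite_measure (distr (density Q (\<lambda>\<omega>. ennreal (snd \<omega>))) half_line fst)"
    "finite_measure (distr (density Q (\<lambda>\<omega>. ennreal (fst \<omega>))) half_line fst)"
    using int quadrant_measurable[OF Q_sets] by (auto intro!: fin)
  fix z :: real assume z: "0 < z"
  have ind: "(indicator {0<..z} :: real \<Rightarrow> ennreal) \<in> borel_measurable half_line"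
    using outside_sets(3)[of z] by simp
  have D: "emeasure (distr (density Q h) half_line fst) {0<..z} = (\<integral>\<^sup>+\<omega>. h \<omega> * indicator {0<..z} (fst \<omega>) \<partial>Q)"
    if "h \<in> borel_measurable Q" for h
    using nn_integral_distr_density_fst[OF Q_sets ind that] outside_sets(3)[of z] by simp
  have sb: "(\<integral>\<^sup>+x. indicator A x * (ennreal x * indicator {0<..z} x) \<partial>M) = emeasure (size_biased M) (A \<inter> {0<..z})"
    if "sets M = sets half_line" "A \<in> sets half_line" for M A
    using that outside_sets(3)[of z]
    by (subst emeasure_size_biased) (auto intro!: nn_integral_cong simp: indicator_def)
  have qs: "snd \<in> borel_measurable quadrant" by (rule quadrant_measurable(4)) simp
  have "emeasure (distr (density Q (\<lambda>\<omega>. ennreal (snd \<omega>))) half_line fst) {0<..z} =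
      (\<integral>\<^sup>+\<omega>. ennreal (snd \<omega>) * indicator {0<..z} (fst \<omega>) \<partial>Q)"
    using quadrant_measurable[OF Q_sets] by (intro D) simp
  also have "\<dots> = (\<integral>\<^sup>+x. indicator outside x * (ennreal x * indicator {0<..z} x) \<partial>\<mu>) +
      (\<integral>\<^sup>+x. indicator {a<..b} x * (ennreal x * indicator {0<..z} x) \<partial>\<nu>) +
      (\<integral>\<^sup>+y. ennreal y * indicator {0<..z} (T y) \<partial>\<gamma>)"
    using ind qs by (subst nn_Q) simp_all
  also have "(\<integral>\<^sup>+y. ennreal y * indicator {0<..z} (T y) \<partial>\<gamma>) =
      (\<integral>\<^sup>+y. ennreal y * indicator {y \<in> space \<gamma>. T y \<le> z} y \<partial>\<gamma>)"
    using T_range(1) a0 by (intro nn_integral_cong) (auto simp: indicator_def intro: less_le_trans)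
  also have "\<dots> = emeasure \<gamma>1 {y \<in> space \<gamma>. T y \<le> z}"
    using T_sets(2)[of z] sets_\<gamma> by (intro emeasure_size_biased[symmetric]) auto
  also have "(\<integral>\<^sup>+x. indicator outside x * (ennreal x * indicator {0<..z} x) \<partial>\<mu>) +
      (\<integral>\<^sup>+x. indicator {a<..b} x * (ennreal x * indicator {0<..z} x) \<partial>\<nu>) +
      emeasure \<gamma>1 {y \<in> space \<gamma>. T y \<le> z} =
    ennreal (measure (size_biased \<mu>) (outside \<inter> {0<..z}) +
      measure (size_biased \<nu>) ({a<..b} \<inter> {0<..z}) + measure \<gamma>1 {y \<in> space \<gamma>. T y \<le> z})"
    unfolding sb[OF P1D(2)[OF \<mu>] outside_sets(1)] sb[OF P1D(2)[OF \<nu>] outside_sets(2)]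
      m.emeasure_eq_measure n.emeasure_eq_measure g.emeasure_eq_measure
    by (simp add: ennreal_plus)
  also have "measure (size_biased \<mu>) (outside \<inter> {0<..z}) +
      measure (size_biased \<nu>) ({a<..b} \<inter> {0<..z}) + measure \<gamma>1 {y \<in> space \<gamma>. T y \<le> z} =
      F_cdf (size_biased \<mu>) z"
    unfolding measure_pieces(1)[OF size_biased_facts(1,2) z] measure_pieces(2)[OF size_biased_facts(3,4) z]
      measure_\<gamma>1_T_le size_biased_P1(2)[OF \<mu>] size_biased_P1(2)[OF \<nu>]
    using sum_pieces[of "G_cdf \<mu>" z] by (simp add: delta_G_def)
  also have "ennreal (F_cdf (size_biased \<mu>) z) = emeasure (size_biased \<mu>) {0<..z}"
    by (simp add: F_cdf_def m.emeasure_eq_measure)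
  also have "\<dots> = (\<integral>\<^sup>+x. ennreal x * indicator {0<..z} x \<partial>distr Q half_line fst)"
    unfolding Q_first_marginal by (rule emeasure_size_biased[OF P1D(2)[OF \<mu>] outside_sets(3)])
  also have "\<dots> = (\<integral>\<^sup>+\<omega>. ennreal (fst \<omega>) * indicator {0<..z} (fst \<omega>) \<partial>Q)"
    using ind by (intro nn_integral_distr quadrant_measurable[OF Q_sets]) simp
  also have "\<dots> = emeasure (distr (density Q (\<lambda>\<omega>. ennreal (fst \<omega>))) half_line fst) {0<..z}"
    using quadrant_measurable[OF Q_sets] by (intro D[symmetric]) simp
  finally show "emeasure (distr (density Q (\<lambda>\<omega>. ennreal (snd \<omega>))) half_line fst) {0<..z} =
      emeasure (distr (density Q (\<lambda>\<omega>. ennreal (fst \<omega>))) half_line fst) {0<..z}" .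
qed simp_all

text \<open>The stationary part lies on the diagonal, where every pattern holds. For the moving part
  \<open>T\<close> takes values in \<open>[a, b]\<close>, which settles the outer levels, and
  \<open>AE_T_le\<close> settles those in between.\<close>

lemma Q_pattern: assumes z: "0 < z" shows "AE \<omega> in Q. hk_pattern a b p q z \<omega>"
proof -
  have [measurable]: "fst \<in> borel_measurable quadrant" "snd \<in> borel_measurable quadrant"
    by (rule quadrant_measurable; simp)+
  define B where "B = {\<omega> \<in> space quadrant. \<not> hk_pattern a b p q z \<omega>}"
  have B: "B \<in> sets quadrant"
    unfolding B_def hk_pattern_def hk_jump_def by measurable
  have diag: "(x, x) \<notin> B" for x
    by (auto simp: B_def hk_pattern_def hk_jump_def)
  have jump: "AE y in \<gamma>. (T y, y) \<notin> B"
  proof -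
    consider "z \<le> a" | "b \<le> z" | "a < z" "z < b" by linarith
    then show ?thesis
    proof cases
      case 1
      have "\<not> T y < z" for y using T_range(1)[of y] 1 by linarith
      then show ?thesis using 1 by (simp add: B_def hk_pattern_def)
    next
      case 2
      have "\<not> z < T y" for y using T_range(2)[of y] 2 by linarith
      then show ?thesis using 2 ab by (simp add: B_def hk_pattern_def)
    next
      case 3
      note r = pq_range[OF 3]
      have "AE y in \<gamma>. T y \<le> z \<longleftrightarrow> a < z \<and> (p z < y \<and> y \<le> a \<or> q z < y)"
        using 3 by (intro AE_T_le) auto
      then show ?thesis
        using AE_\<gamma>_out AE_\<gamma>_ne[of "p z"] AE_\<gamma>_ne[of "q z"]
      proof eventually_elim
        case (elim y)
        have "hk_jump (p z) z (q z) (T y, y)"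
          unfolding hk_jump_def fst_conv snd_conv
        proof (intro conjI impI)
          \<comment> \<open>The two outer clauses hold vacuously, since
            \<open>p z \<le> a \<le> T y \<le> b \<le> q z\<close>.\<close>
          show "y < p z" if "T y < p z" using that T_range(1)[of y] r by linarith
          show "q z < y" if "q z < T y" using that T_range(2)[of y] r by linarith
          show "p z < y \<and> y < z \<or> q z < y" if "p z < T y \<and> T y < z"
          proof -
            have "p z < y \<and> y \<le> a \<or> q z < y" using elim(1) that by simp
            then show ?thesis using 3 by auto
          qed
          show "y < p z \<or> z < y \<and> y < q z" if "z < T y \<and> T y < q z"
          proof -
            have "\<not> (p z < y \<and> y \<le> a \<or> q z < y)" using elim(1) that 3 by simp
            then show ?thesis using 3 elim(2,3,4) by linarith
          qed
        qed
        then show ?case using 3 by (simp add: B_def hk_pattern_def)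
      qed
    qed
  qed
  have "emeasure Q B = (\<integral>\<^sup>+\<omega>. indicator B \<omega> \<partial>Q)" using B Q_sets by simp
  also have "\<dots> = (\<integral>\<^sup>+x. indicator outside x * indicator B (x, x) \<partial>\<mu>) +
      (\<integral>\<^sup>+x. indicator {a<..b} x * indicator B (x, x) \<partial>\<nu>) + (\<integral>\<^sup>+y. indicator B (T y, y) \<partial>\<gamma>)"
    using B by (subst nn_Q) simp_all
  also have "(\<integral>\<^sup>+y. indicator B (T y, y) \<partial>\<gamma>) = (\<integral>\<^sup>+y. 0 \<partial>\<gamma>)"
    by (intro nn_integral_cong_AE) (use jump in eventually_elim, simp)
  finally have "emeasure Q B = 0" using diag by simp
  then have "B \<in> null_sets Q" using B Q_sets by auto
  then have "AE \<omega> in Q. \<omega> \<notin> B" by (rule AE_not_in)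
  then show ?thesis
    using AE_space
  proof eventually_elim
    case (elim \<omega>)
    then show ?case using sets_eq_imp_space_eq[OF Q_sets] by (simp add: B_def)
  qed
qed

lemma Q_structured:
  shows "atomless_coupling \<mu> \<nu> Q" "atomless_coupling.structured Q a b p q"
proof -
  have "Q \<in> martingale_couplings \<mu> \<nu>"
    using Q_prob_space Q_sets Q_first_marginal Q_second_marginal Q_reproduces_mean
    by (simp add: martingale_couplings_iff[OF \<mu> \<nu>])
  then show A: "atomless_coupling \<mu> \<nu> Q"
    using \<mu> \<nu> \<mu>_atomless \<nu>_atomless by (intro atomless_coupling.intro)
  show "atomless_coupling.structured Q a b p q"
    unfolding atomless_coupling.structured_def[OF A] using Q_pattern by blast
qed

end

lemma SS_op_Q_HK_eq: "SS_op (Q_HK (S_op \<mu>) (S_op \<nu>)) = Q_HK \<mu> \<nu>"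
proof -
  obtain Q where Q: "is_hk_sum Q" by (rule hk_sum_exists)
  show ?thesis using SS_op_Q_HK[OF Q_structured(1)[OF Q] hk_params_pq Q_structured(2)[OF Q]] .
qed

end

theorem mainTheorem1:
  fixes \<mu> \<nu> :: "real measure"
  assumes "\<mu> \<in> P1d" and "\<nu> \<in> P1d"
    and "convex_order \<mu> \<nu>"
    and "\<exists>!a. local_maximizer (delta_F \<mu> \<nu>) a"
  shows "SS_op (Q_HK (S_op \<mu>) (S_op \<nu>)) = Q_HK \<mu> \<nu>"
proof -
  obtain a b where "hk_marginals \<mu> \<nu> a b" using hk_marginals_exist[OF assms] .
  then show ?thesis by (rule hk_marginals.SS_op_Q_HK_eq)
qed

end
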